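(* Let $S_2$ be a closed orientable surface of genus $2$. Let $K$ be any real number field and $A$ any quaternion algebra over $K$ such that $A \otimes_K \mathbb{R} \cong M_2(\mathbb{R})$. Then there exists a hyperbolic structure on $S_2$ whose trace field is $K$ and whose quaternion algebra is $A$. Moreover, for this hyperbolic structure the invariant trace field equals the trace field and the invariant quaternion algebra equals the quaternion algebra.
   Context: A real number field is a field $K \subset \mathbb{R}$ with $[K:\mathbb{Q}]<\infty$. A hyperbolic structure on $S_2$ corresponds to a Fuchsian group $\Gamma \subset \mathrm{PSL}(2,\mathbb{R})$ with $\mathbb{H}^2/\Gamma \cong S_2$; let $\bar\Gamma\subset\mathrm{SL}(2,\mathbb{R})$ be its preimage. The trace field is $\mathbb{Q}(\{\mathrm{tr}\,\gamma : \gamma \in \bar\Gamma\})$; the quaternion algebra is $\{\sum a_i\gamma_i : a_i \in \text{trace field}, \gamma_i\in\bar\Gamma\}$ (finite sums). The invariant trace field is $\mathbb{Q}(\{\mathrm{tr}\,\gamma^2 : \gamma\in\bar\Gamma\})$ and the invariant quaternion algebra is the algebra over the invariant trace field generated by the squares $\gamma^2$, $\gamma\in\bar\Gamma$. A quaternion algebra $\left(\frac{a,b}{K}\right)$ ($a,b\in K^*$) has basis $1,\mathbf{i},\mathbf{j},\mathbf{k}$ with $\mathbf{i}^2=a$, $\mathbf{j}^2=b$, $\mathbf{ij}=-\mathbf{ji}=\mathbf{k}$. *)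

theory Defs
  imports "HOL-Analysis.Analysis"
begin

type_synonym mat2 = "real^2^2"

definition subfield_R :: "real set \<Rightarrow> bool" where
  "subfield_R F \<longleftrightarrow> 0 \<in> F \<and> 1 \<in> F \<and>
     (\<forall>x\<in>F. \<forall>y\<in>F. x + y \<in> F \<and> x * y \<in> F) \<and>
     (\<forall>x\<in>F. - x \<in> F) \<and> (\<forall>x\<in>F. x \<noteq> 0 \<longrightarrow> inverse x \<in> F)"

definition real_number_field :: "real set \<Rightarrow> bool" where
  "real_number_field K \<longleftrightarrow> subfield_R K \<and>
     (\<exists>B. finite B \<and> B \<subseteq> K \<and>
        K \<subseteq> {x. \<exists>c::real \<Rightarrow> rat. x = (\<Sum>b\<in>B. of_rat (c b) * b)})"

definition gen_field :: "real set \<Rightarrow> real set" where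
  "gen_field T = \<Inter> {F. subfield_R F \<and> T \<subseteq> F}"

definition trace_field :: "mat2 set \<Rightarrow> real set" where
  "trace_field G = gen_field {trace g | g. g \<in> G}"

definition inv_trace_field :: "mat2 set \<Rightarrow> real set" where
  "inv_trace_field G = gen_field {trace (g ** g) | g. g \<in> G}"

inductive_set lin_span :: "real set \<Rightarrow> mat2 set \<Rightarrow> mat2 set" for F G where
  zero: "0 \<in> lin_span F G"
| add: "x \<in> lin_span F G \<Longrightarrow> c \<in> F \<Longrightarrow> g \<in> G \<Longrightarrow> c *\<^sub>R g + x \<in> lin_span F G"

definition quat_alg :: "mat2 set \<Rightarrow> mat2 set" where
  "quat_alg G = lin_span (trace_field G) G"

inductive_set alg_gen :: "real set \<Rightarrow> mat2 set \<Rightarrow> mat2 set" for F S where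
  gen: "s \<in> S \<Longrightarrow> s \<in> alg_gen F S"
| smult: "x \<in> alg_gen F S \<Longrightarrow> c \<in> F \<Longrightarrow> c *\<^sub>R x \<in> alg_gen F S"
| add: "x \<in> alg_gen F S \<Longrightarrow> y \<in> alg_gen F S \<Longrightarrow> x + y \<in> alg_gen F S"
| mult: "x \<in> alg_gen F S \<Longrightarrow> y \<in> alg_gen F S \<Longrightarrow> x ** y \<in> alg_gen F S"

definition inv_quat_alg :: "mat2 set \<Rightarrow> mat2 set" where
  "inv_quat_alg G = alg_gen (inv_trace_field G) {g ** g | g. g \<in> G}"

text \<open>S (a set of 2x2 real matrices, an algebra over F with F acting by scalars)
  is isomorphic as F-algebra to the quaternion algebra (a,b / F): there are
  I, J in S with I^2 = a, J^2 = b, IJ = -JI, such that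
  (c0,c1,c2,c3) |-> c0 + c1 I + c2 J + c3 IJ is a bijection F^4 -> S.\<close>
definition quat_iso :: "real set \<Rightarrow> real \<Rightarrow> real \<Rightarrow> mat2 set \<Rightarrow> bool" where
  "quat_iso F a b S \<longleftrightarrow> (\<exists>I J. I \<in> S \<and> J \<in> S \<and>
     I ** I = a *\<^sub>R mat 1 \<and> J ** J = b *\<^sub>R mat 1 \<and> I ** J = - (J ** I) \<and>
     S = {c0 *\<^sub>R mat 1 + c1 *\<^sub>R I + c2 *\<^sub>R J + c3 *\<^sub>R (I ** J) | c0 c1 c2 c3.
            c0 \<in> F \<and> c1 \<in> F \<and> c2 \<in> F \<and> c3 \<in> F} \<and>
     (\<forall>c0 c1 c2 c3. c0 \<in> F \<and> c1 \<in> F \<and> c2 \<in> F \<and> c3 \<in> F \<and>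
        c0 *\<^sub>R mat 1 + c1 *\<^sub>R I + c2 *\<^sub>R J + c3 *\<^sub>R (I ** J) = 0 \<longrightarrow>
        c0 = 0 \<and> c1 = 0 \<and> c2 = 0 \<and> c3 = 0))"

definition uhp :: "complex set" where
  "uhp = {z. Im z > 0}"

definition mob :: "mat2 \<Rightarrow> complex \<Rightarrow> complex" where
  "mob g z = (of_real (g$1$1) * z + of_real (g$1$2)) / (of_real (g$2$1) * z + of_real (g$2$2))"

text \<open>A concrete closed orientable surface of genus 2 in R^3: the boundary of a
  thickening of the lemniscate g(x,y) = (x^2+y^2)^2 - x^2 + y^2 = 0, namely
  g(x,y)^2 + z^2 = 1/100. (The critical values of g are 0 and -1/4, so this is
  the double of the pair of pants |g| <= 1/10, a genus 2 surface.)\<close>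
definition S2 :: "(real \<times> real \<times> real) set" where
  "S2 = {(x, y, z). ((x^2 + y^2)^2 - x^2 + y^2)^2 + z^2 = 1/100}"

text \<open>G is the preimage in SL(2,R) of a Fuchsian group Gamma in PSL(2,R),
  (torsion-free, acting freely on H^2) with H^2/Gamma homeomorphic to S_2.\<close>
definition genus2_structure :: "mat2 set \<Rightarrow> bool" where
  "genus2_structure G \<longleftrightarrow>
     G \<subseteq> {A. det A = 1} \<and> mat 1 \<in> G \<and> - mat 1 \<in> G \<and>
     (\<forall>g\<in>G. \<forall>h\<in>G. g ** h \<in> G) \<and> (\<forall>g\<in>G. matrix_inv g \<in> G) \<and>
     (\<forall>g\<in>G. \<exists>e>0. \<forall>h\<in>G. dist h g < e \<longrightarrow> h = g) \<and>
     (\<forall>g\<in>G. \<forall>z\<in>uhp. mob g z = z \<longrightarrow> g = mat 1 \<or> g = - mat 1) \<and>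
     (\<exists>q. quotient_map (top_of_set uhp) (top_of_set S2) q \<and>
        (\<forall>z\<in>uhp. \<forall>w\<in>uhp. q z = q w \<longleftrightarrow> (\<exists>g\<in>G. mob g z = w)))"

end

theory Submission
  imports Defs "HOL-Computational_Algebra.Fundamental_Theorem_Algebra"
begin

text \<open>A quaternion algebra over \<open>K\<close> that splits over \<open>\<real>\<close> can be written \<open>(m, n / K)\<close> with \<open>m, n > 0\<close>.
  Take \<open>\<alpha>, \<beta>, \<gamma>, \<delta> \<in> K\<close> with \<open>\<alpha>\<^sup>2 - m \<beta>\<^sup>2 = 1 = \<gamma>\<^sup>2 - n \<delta>\<^sup>2\<close>. The five pure quaternions
  \<open>i\<close>, \<open>j\<close>, \<open>\<beta> ij - \<alpha> j\<close>, \<open>\<delta> ij - \<gamma> i\<close> and a common perpendicular of the last two act as the reflections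
  in the sides of a right-angled hyperbolic pentagon, provided \<open>\<alpha>\<close> and \<open>\<gamma>\<close> are not too small.
  Mapping them to the three coordinate reflections of \<open>\<real>\<^sup>3\<close> defines a homomorphism from the reflection
  group to \<open>(\<int> / 2)\<^sup>3\<close>; its kernel is a surface group of genus 2, because eight pentagons glue to \<open>S2\<close>
  just as its eight octants do. A word in which every label occurs an even number of times has coefficients
  in \<open>K\<close>, so the kernel consists of elements of norm 1 of the algebra. It contains \<open>- \<alpha> + \<beta> i\<close> and \<open>- \<gamma> + \<delta> j\<close>,
  which generate the algebra, and by a primitive element argument \<open>\<alpha>\<close> can be chosen such that already
  \<open>\<rat>(\<alpha>\<^sup>2) = K\<close>.\<close>

section \<open>Primitive elements of real number fields\<close>

text \<open>Around the pentagon the labels run x, y, z, y, z. Adjacent sides carry different labels,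
  so the Klein four-group at each corner injects into (Z/2)^3 and the kernel is torsion-free; the
  orbifold Euler characteristic 1 - 5/2 + 5/4 = -1/4 becomes -2 after multiplication by 8. The
  arithmetic obstacle is that a reflection, normalised to determinant -1, does not lie in the
  algebra: a square root intervenes. The two norm equations make both sides labelled y have square n
  and both sides labelled z have square m, so this root depends on the label alone. The parity
  condition that makes the kernel torsion-free therefore also puts it into the algebra. In the Klein
  disc the two long sides are X = d and Y = c, with 1 - c^2 = 1/\<alpha>^2 and 1 - d^2 =
  1/\<gamma>^2. They have a common perpendicular when c^2 + d^2 > 1, and \<alpha>, \<gamma> > 3/2 is
  enough for this. Aiming at \<alpha>^2 instead of \<alpha> serves the invariant field: the element
  -\<alpha> + \<beta> i has a square of trace 4 \<alpha>^2 - 2, so this single element forces the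
  trace field and the invariant trace field to be K at once.\<close>

lemma subfield_R_D:
  assumes "subfield_R F"
  shows "0 \<in> F" "1 \<in> F" "x \<in> F \<Longrightarrow> y \<in> F \<Longrightarrow> x + y \<in> F" "x \<in> F \<Longrightarrow> y \<in> F \<Longrightarrow> x * y \<in> F"
    "x \<in> F \<Longrightarrow> - x \<in> F" "x \<in> F \<Longrightarrow> inverse x \<in> F"
  using assms unfolding subfield_R_def by (blast, blast, blast, blast, blast, cases "x = 0", auto)

lemma subfield_R_diff: "subfield_R F \<Longrightarrow> x \<in> F \<Longrightarrow> y \<in> F \<Longrightarrow> x - y \<in> F"
  using subfield_R_D(3,5)[of F] by (metis add_uminus_conv_diff)

lemma subfield_R_divide: "subfield_R F \<Longrightarrow> x \<in> F \<Longrightarrow> y \<in> F \<Longrightarrow> x / y \<in> F"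
  using subfield_R_D(4,6)[of F] by (simp add: divide_inverse)

lemma subfield_R_power: "subfield_R F \<Longrightarrow> x \<in> F \<Longrightarrow> x ^ n \<in> F"
  by (induction n) (auto intro: subfield_R_D)

lemma subfield_R_sum: "subfield_R F \<Longrightarrow> (\<And>i. i \<in> A \<Longrightarrow> f i \<in> F) \<Longrightarrow> sum f A \<in> F"
  by (induction A rule: infinite_finite_induct) (auto intro: subfield_R_D)

lemma subfield_R_of_nat: "subfield_R F \<Longrightarrow> of_nat n \<in> F"
  by (induction n) (auto intro: subfield_R_D)

lemma subfield_R_of_int: "subfield_R F \<Longrightarrow> of_int n \<in> F"
  by (cases n) (auto intro: subfield_R_D subfield_R_of_nat subfield_R_diff simp del: of_nat_Suc)

lemma subfield_R_numeral: "subfield_R F \<Longrightarrow> numeral n \<in> F"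
  using subfield_R_of_nat[of F "numeral n"] by simp

lemma subfield_R_Rats: "subfield_R F \<Longrightarrow> \<rat> \<subseteq> F"
  by (auto elim!: Rats_cases' intro!: subfield_R_divide subfield_R_of_int)

lemmas subfield_R_intros = subfield_R_D subfield_R_diff subfield_R_divide subfield_R_power
  subfield_R_of_nat subfield_R_of_int subfield_R_numeral

lemma subfield_R_Rats_self: "subfield_R \<rat>"
  unfolding subfield_R_def by auto

lemma subfield_R_gen_field: "subfield_R (gen_field T)"
  unfolding gen_field_def subfield_R_def by auto

lemma gen_field_superset: "T \<subseteq> gen_field T"
  unfolding gen_field_def by auto

lemma gen_field_least: "subfield_R F \<Longrightarrow> T \<subseteq> F \<Longrightarrow> gen_field T \<subseteq> F"
  unfolding gen_field_def by auto

text \<open>Polynomials over a real subfield are kept as complex polynomials with restricted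
  coefficients, so that all conjugates of an element are available as roots.\<close>

definition cpolys :: "real set \<Rightarrow> complex poly set" where
  "cpolys F = {p. \<forall>i. coeff p i \<in> complex_of_real ` F}"

lemma of_real_image_mult:
  "subfield_R F \<Longrightarrow> x \<in> complex_of_real ` F \<Longrightarrow> y \<in> complex_of_real ` F \<Longrightarrow> x * y \<in> complex_of_real ` F"
  by (auto simp flip: of_real_mult intro: subfield_R_D)

lemma of_real_image_add:
  "subfield_R F \<Longrightarrow> x \<in> complex_of_real ` F \<Longrightarrow> y \<in> complex_of_real ` F \<Longrightarrow> x + y \<in> complex_of_real ` F"
  by (auto simp flip: of_real_add intro: subfield_R_D)

lemma of_real_image_sum:
  "subfield_R F \<Longrightarrow> (\<And>i. i \<in> A \<Longrightarrow> f i \<in> complex_of_real ` F) \<Longrightarrow> sum f A \<in> complex_of_real ` F"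
proof (induction A rule: infinite_finite_induct)
  case (insert x F')
  then show ?case by (simp add: of_real_image_add)
qed (use subfield_R_D(1) in \<open>force+\<close>)

lemma of_real_image_0: "subfield_R F \<Longrightarrow> 0 \<in> complex_of_real ` F"
  using subfield_R_D(1) by force

lemma cpolys_add: "subfield_R F \<Longrightarrow> p \<in> cpolys F \<Longrightarrow> q \<in> cpolys F \<Longrightarrow> p + q \<in> cpolys F"
  unfolding cpolys_def by (simp add: of_real_image_add)

lemma cpolys_mult: "subfield_R F \<Longrightarrow> p \<in> cpolys F \<Longrightarrow> q \<in> cpolys F \<Longrightarrow> p * q \<in> cpolys F"
  unfolding cpolys_def by (auto simp: coeff_mult intro!: of_real_image_sum of_real_image_mult)

lemma cpolys_0: "subfield_R F \<Longrightarrow> 0 \<in> cpolys F"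
  unfolding cpolys_def by (simp add: of_real_image_0)

lemma cpolys_pCons: "x \<in> F \<Longrightarrow> p \<in> cpolys F \<Longrightarrow> pCons (of_real x) p \<in> cpolys F"
  unfolding cpolys_def by (auto simp: coeff_pCons split: nat.split)

lemma cpolys_pConsD:
  assumes "pCons x p \<in> cpolys F"
  shows "x \<in> complex_of_real ` F" "p \<in> cpolys F"
proof -
  have c: "coeff (pCons x p) i \<in> complex_of_real ` F" for i
    using assms by (simp add: cpolys_def)
  show "x \<in> complex_of_real ` F" using c[of 0] by simp
  have "coeff p i \<in> complex_of_real ` F" for i using c[of "Suc i"] by simp
  then show "p \<in> cpolys F" by (simp add: cpolys_def)
qed

lemma cpolys_const: "subfield_R F \<Longrightarrow> x \<in> F \<Longrightarrow> [:of_real x:] \<in> cpolys F"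
  by (intro cpolys_pCons cpolys_0)

lemma cpolys_monom: "subfield_R F \<Longrightarrow> x \<in> F \<Longrightarrow> monom (of_real x) n \<in> cpolys F"
  unfolding cpolys_def by (simp add: of_real_image_0)

lemma cpolys_1: "subfield_R F \<Longrightarrow> 1 \<in> cpolys F"
  using cpolys_const[of F 1] by (simp add: subfield_R_D one_pCons)

lemma cpolys_diff: "subfield_R F \<Longrightarrow> p \<in> cpolys F \<Longrightarrow> q \<in> cpolys F \<Longrightarrow> p - q \<in> cpolys F"
  using cpolys_add[of F p "[:of_real (-1):] * q"] cpolys_mult[of F "[:of_real (-1):]" q]
    cpolys_const[of F "-1"] by (simp add: subfield_R_D)

lemma cpolys_power: "subfield_R F \<Longrightarrow> p \<in> cpolys F \<Longrightarrow> p ^ n \<in> cpolys F"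
  by (induction n) (auto intro: cpolys_1 cpolys_mult)

lemma cpolys_pcompose:
  assumes "subfield_R F" "q \<in> cpolys F"
  shows "p \<in> cpolys F \<Longrightarrow> pcompose p q \<in> cpolys F"
proof (induction p)
  case 0
  then show ?case by (simp add: cpolys_0 assms)
next
  case (pCons x p)
  note cpolys_pConsD[OF pCons.prems]
  then show ?case
    using pCons.IH assms by (auto simp: pcompose_pCons intro!: cpolys_add cpolys_mult cpolys_const)
qed

lemma cpolys_pderiv:
  assumes "subfield_R F" "p \<in> cpolys F"
  shows "pderiv p \<in> cpolys F"
proof -
  have "complex_of_real (real (Suc i)) * coeff p (Suc i) \<in> complex_of_real ` F" for i
    using assms by (intro of_real_image_mult imageI subfield_R_of_nat) (auto simp: cpolys_def)
  then show ?thesis by (simp add: cpolys_def coeff_pderiv)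
qed

lemma cpolys_mono: "F \<subseteq> F' \<Longrightarrow> cpolys F \<subseteq> cpolys F'"
  unfolding cpolys_def by blast

text \<open>Division with remainder one step at a time: a monomial multiple of \<open>h\<close>
  cancels the leading term of \<open>f\<close>, its coefficient is a quotient of elements of
  \<open>F\<close>, and the degree drops until minimality leaves only 0.\<close>

lemma minimal_dvd:
  assumes F: "subfield_R F" and h: "h \<in> cpolys F" "poly h y = 0" "h \<noteq> 0"
    and min: "\<And>p. p \<in> cpolys F \<Longrightarrow> p \<noteq> 0 \<Longrightarrow> poly p y = 0 \<Longrightarrow> degree h \<le> degree p"
  shows "f \<in> cpolys F \<Longrightarrow> poly f y = 0 \<Longrightarrow> h dvd f"
proof (induction "degree f" arbitrary: f rule: less_induct)
  case less
  show ?case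
  proof (cases "f = 0")
    case False
    define q where "q = monom (lead_coeff f / lead_coeff h) (degree f - degree h)"
    have le: "degree h \<le> degree f" using min less.prems False by blast
    obtain u v where uv: "u \<in> F" "lead_coeff f = of_real u" "v \<in> F" "lead_coeff h = of_real v"
      using less.prems(1) h(1) unfolding cpolys_def by fast
    have "q = monom (of_real (u / v)) (degree f - degree h)" unfolding q_def uv by simp
    then have q: "q \<in> cpolys F" using cpolys_monom[OF F, of "u/v"] uv F by (simp add: subfield_R_divide)
    have qh: "degree (q * h) = degree f"
      using h(3) False le unfolding q_def by (simp add: degree_mult_eq degree_monom_eq)
    have qh': "lead_coeff (q * h) = lead_coeff f"
      using h(3) False unfolding lead_coeff_mult q_def by (simp add: degree_monom_eq)
    have g: "f - q * h \<in> cpolys F" "poly (f - q * h) y = 0"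
      using F q h less.prems by (auto intro: cpolys_diff cpolys_mult)
    have "h dvd f - q * h"
    proof (cases "f - q * h = 0")
      case nz: False
      have "degree (f - q * h) \<le> degree f" using degree_diff_le[of f "degree f" "q*h"] qh by simp
      moreover have "degree (f - q * h) \<noteq> degree f"
        using qh qh' nz by (metis coeff_diff diff_self leading_coeff_0_iff)
      ultimately show ?thesis using less.hyps[OF _ g] by simp
    qed (auto intro: dvdI)
    then show ?thesis by (metis dvd_add_right_iff dvd_triv_right diff_add_cancel add.commute)
  qed auto
qed

lemma minimal_poly_exists:
  assumes "p \<in> cpolys F" "p \<noteq> 0" "poly p y = 0"
  obtains h where "h \<in> cpolys F" "poly h y = 0" "h \<noteq> 0"
    "\<And>p. p \<in> cpolys F \<Longrightarrow> p \<noteq> 0 \<Longrightarrow> poly p y = 0 \<Longrightarrow> degree h \<le> degree p"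
  using ex_has_least_nat[of "\<lambda>h. h \<in> cpolys F \<and> poly h y = 0 \<and> h \<noteq> 0" p degree] assms by blast

text \<open>The minimal polynomial of \<open>y\<close> over \<open>F\<close> divides \<open>f\<close> and \<open>g\<close>, so \<open>y\<close> is its only root,
  and it is a simple one; hence it is linear.\<close>

lemma unique_common_root_in_subfield:
  assumes F: "subfield_R F" and fg: "f \<in> cpolys F" "g \<in> cpolys F"
    and y: "poly f (of_real y) = 0" "poly g (of_real y) = 0" "poly (pderiv f) (of_real y) \<noteq> 0"
    and uniq: "\<And>w. poly f w = 0 \<Longrightarrow> poly g w = 0 \<Longrightarrow> w = of_real y"
  shows "y \<in> F"
proof -
  let ?y = "complex_of_real y"
  have "f \<noteq> 0" using y(3) by auto
  then obtain h where h: "h \<in> cpolys F" "poly h ?y = 0" "h \<noteq> 0"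
    "\<And>p. p \<in> cpolys F \<Longrightarrow> p \<noteq> 0 \<Longrightarrow> poly p ?y = 0 \<Longrightarrow> degree h \<le> degree p"
    using minimal_poly_exists[OF fg(1) _ y(1)] by blast
  have hf: "h dvd f" and hg: "h dvd g"
    using minimal_dvd[OF F h] fg y by blast+
  obtain q where q: "h = [:- ?y, 1:] * q" using h(2) by (metis dvdE poly_eq_0_iff_dvd)
  have "degree q = 0"
  proof (rule ccontr)
    assume "degree q \<noteq> 0"
    then obtain w where w: "poly q w = 0"
      using fundamental_theorem_of_algebra[of q] constant_degree[of q] by auto
    then have "poly h w = 0" by (simp add: q)
    then have "w = ?y" using uniq hf hg by (metis dvdE mult_eq_0_iff poly_mult)
    then obtain r where "q = [:- ?y, 1:] * r" using w by (metis dvdE poly_eq_0_iff_dvd)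
    then obtain s where s: "f = [:- ?y, 1:] * ([:- ?y, 1:] * s)"
      using hf q by (metis dvdE mult.assoc)
    have "poly (pderiv f) ?y = 0" unfolding s pderiv_mult by simp
    then show False using y(3) by simp
  qed
  then obtain k where k: "q = [:k:]" by (metis degree_eq_zeroE)
  have "k \<noteq> 0" using h(3) q k by auto
  have c: "coeff h 0 = - ?y * k" "coeff h 1 = k" by (simp_all add: q k)
  obtain u v where uv: "u \<in> F" "v \<in> F" "coeff h 0 = of_real u" "coeff h 1 = of_real v"
    using h(1) unfolding cpolys_def by (metis (no_types, lifting) imageE mem_Collect_eq)
  have "complex_of_real y = of_real (- u / v)" using c uv \<open>k \<noteq> 0\<close> by auto
  then have "y = - u / v" by (metis of_real_eq_iff)
  then show ?thesis using uv F by (auto intro: subfield_R_intros)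
qed

section \<open>Algebraic reals and the primitive element theorem\<close>

definition algebraic_R :: "real \<Rightarrow> bool" where
  "algebraic_R x \<longleftrightarrow> (\<exists>p \<in> cpolys \<rat>. p \<noteq> 0 \<and> poly p (of_real x) = 0)"

text \<open>In characteristic 0 the derivative of the minimal polynomial is nonzero and of smaller
  degree, so by minimality it cannot vanish at \<open>x\<close>.\<close>

lemma simple_root_poly:
  assumes "algebraic_R x"
  obtains f where "f \<in> cpolys \<rat>" "poly f (of_real x) = 0" "poly (pderiv f) (of_real x) \<noteq> 0"
proof -
  let ?x = "complex_of_real x"
  obtain h where h: "h \<in> cpolys \<rat>" "poly h ?x = 0" "h \<noteq> 0"
    "\<And>p. p \<in> cpolys \<rat> \<Longrightarrow> p \<noteq> 0 \<Longrightarrow> poly p ?x = 0 \<Longrightarrow> degree h \<le> degree p"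
    using assms minimal_poly_exists unfolding algebraic_R_def by metis
  have d: "degree h \<noteq> 0" using h(2,3) by (metis degree_eq_zeroE pCons_0_0 poly_const_conv)
  then have "pderiv h \<noteq> 0" by (simp add: pderiv_eq_0_iff)
  then have "poly (pderiv h) ?x \<noteq> 0"
    using h(1) h(4)[of "pderiv h"] d cpolys_pderiv[OF subfield_R_Rats_self] degree_pderiv[of h]
    by (metis diff_less gr0I leD zero_less_one)
  then show ?thesis using that h by blast
qed

text \<open>An open interval minus finitely many points is open and nonempty, hence contains
  rationals. The excluded set is complex because it arises from complex conjugates.\<close>

lemma infinite_Rats_interval_diff:
  assumes "u < v" "finite (S::complex set)"
  obtains c where "c \<in> \<rat>" "u < c" "c < v" "complex_of_real c \<notin> S"
proof -
  have "\<not> {u<..<v} \<subseteq> of_real -` S"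
    using assms finite_vimageI[OF assms(2), of complex_of_real]
    by (metis finite_subset infinite_Ioo inj_of_real)
  moreover have "open ({u<..<v} - of_real -` S)"
    using finite_vimageI[OF assms(2), of complex_of_real]
    by (intro open_Diff finite_imp_closed) (auto simp: inj_def)
  ultimately obtain x e where xe: "e > 0" "x \<in> {u<..<v} - of_real -` S"
     "\<And>y. \<bar>y - x\<bar> < e \<Longrightarrow> y \<in> {u<..<v} - of_real -` S"
    unfolding open_dist dist_real_def by (metis Diff_eq_empty_iff all_not_in_conv)
  obtain c where c: "c \<in> \<rat>" "x < c" "c < x + e" using Rats_dense_in_real[of x "x+e"] xe(1) by auto
  then have "c \<in> {u<..<v} - of_real -` S" using xe(3)[of c] by auto
  then show ?thesis using that c by auto
qed

text \<open>If \<open>c\<close> avoids the finitely many values for which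
  \<open>x + c y = x' + c y'\<close> with conjugates \<open>y' \<noteq> y\<close>, then
  \<open>y\<close> is the only common root of \<open>g\<close> and of \<open>f\<close> composed with
  \<open>(x + c y) - c T\<close>, both over the field generated by \<open>x + c y\<close>.\<close>

lemma primitive_element_two:
  assumes "algebraic_R x" "algebraic_R y"
  obtains c where "c \<in> \<rat>" "{x, y} \<subseteq> gen_field {x + c * y}"
proof -
  obtain f where f: "f \<in> cpolys \<rat>" "poly f (of_real x) = 0" "poly (pderiv f) (of_real x) \<noteq> 0"
    using simple_root_poly[OF assms(1)] .
  obtain g where g: "g \<in> cpolys \<rat>" "poly g (of_real y) = 0" "poly (pderiv g) (of_real y) \<noteq> 0"
    using simple_root_poly[OF assms(2)] .
  \<comment> \<open>Pairs with \<open>y' = y\<close> give 0 through division by zero, which merely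
    excludes \<open>c = 0\<close>.\<close>
  let ?S = "(\<lambda>(x', y'). (x' - of_real x) / (of_real y - y')) ` ({w. poly f w = 0} \<times> {w. poly g w = 0})"
  have "f \<noteq> 0" "g \<noteq> 0" using f(3) g(3) by auto
  then have "finite ?S" by (auto intro: poly_roots_finite)
  then obtain c where c: "c \<in> \<rat>" "complex_of_real c \<notin> ?S"
    using infinite_Rats_interval_diff[of 0 1] by (metis zero_less_one)
  let ?F = "gen_field {x + c * y}"
  have F: "subfield_R ?F" by (rule subfield_R_gen_field)
  have QF: "\<rat> \<subseteq> ?F" by (rule subfield_R_Rats[OF F])
  have z: "x + c * y \<in> ?F" using gen_field_superset by blast
  let ?r = "[:of_real (x + c * y), of_real (- c):] :: complex poly"
  have r: "?r \<in> cpolys ?F"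
    using z c QF F by (intro cpolys_pCons cpolys_0) (auto intro: subfield_R_D)
  have "y \<in> ?F"
  proof (rule unique_common_root_in_subfield[OF F])
    show "g \<in> cpolys ?F" using g(1) cpolys_mono[OF QF] by blast
    show "pcompose f ?r \<in> cpolys ?F" using f(1) cpolys_mono[OF QF] cpolys_pcompose[OF F r] by blast
    show "poly (pcompose f ?r) (of_real y) = 0" using f(2) by (simp add: poly_pcompose algebra_simps)
    fix w assume w: "poly g w = 0" "poly (pcompose f ?r) w = 0"
    show "w = of_real y"
    proof (rule ccontr)
      assume ne: "w \<noteq> of_real y"
      define x' where "x' = of_real x + of_real c * (of_real y - w)"
      have "poly f x' = 0" using w(2) by (simp add: poly_pcompose x'_def algebra_simps)
      moreover have "of_real c = (x' - of_real x) / (of_real y - w)" using ne by (simp add: x'_def)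
      ultimately show False using c(2) w(1) by force
    qed
  qed (use g in auto)
  moreover have "x = (x + c * y) - c * y" by simp
  then have "x \<in> ?F" using z c QF F \<open>y \<in> ?F\<close> by (metis subfield_R_D(4) subfield_R_diff subsetD)
  ultimately show ?thesis using that c by blast
qed

text \<open>The \<open>card B + 1\<close> powers of \<open>x\<close> up to exponent
  \<open>card B\<close> lie in a rational space spanned by \<open>card B\<close> elements.
  Dependence is a property of sets of vectors, so a repetition among the powers is a separate
  case.\<close>

lemma real_number_field_algebraic:
  assumes "real_number_field K" "x \<in> K"
  shows "algebraic_R x"
proof -
  interpret Q: vector_space "\<lambda>q x. real_of_rat q * x"
    by unfold_locales (auto simp: algebra_simps of_rat_add of_rat_mult)
  obtain B where K: "subfield_R K" and B: "finite B"
    "K \<subseteq> {x. \<exists>c::real \<Rightarrow> rat. x = (\<Sum>b\<in>B. of_rat (c b) * b)}"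
    using assms(1) unfolding real_number_field_def by blast
  have "K \<subseteq> Q.span B"
  proof
    fix y assume "y \<in> K"
    then obtain c :: "real \<Rightarrow> rat" where y: "y = (\<Sum>b\<in>B. of_rat (c b) * b)" using B by blast
    show "y \<in> Q.span B" unfolding y by (intro Q.span_sum Q.span_scale Q.span_base)
  qed
  let ?n = "card B"
  let ?p = "\<lambda>i. x ^ i"
  show ?thesis
  proof (cases "inj_on ?p {..?n}")
    case False
    then obtain i j where ij: "i \<noteq> j" "x ^ i = x ^ j" unfolding inj_on_def by blast
    let ?q = "monom (of_real 1) i - monom (of_real 1) j :: complex poly"
    have "coeff ?q i = 1" using ij by simp
    then have "?q \<noteq> 0" by (metis coeff_0 zero_neq_one)
    moreover have "?q \<in> cpolys \<rat>"
      by (intro cpolys_diff cpolys_monom subfield_R_Rats_self) auto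
    moreover have "poly ?q (of_real x) = 0" using ij(2) by (simp add: poly_monom flip: of_real_power)
    ultimately show ?thesis unfolding algebraic_R_def by blast
  next
    case True
    let ?S = "?p ` {..?n}"
    have "?S \<subseteq> Q.span B" using \<open>K \<subseteq> Q.span B\<close> assms(2) K by (auto intro: subfield_R_power)
    then have "Q.dependent ?S"
      using Q.independent_span_bound[OF B(1)] True by (force simp: card_image)
    then obtain u v where u: "(\<Sum>v\<in>?S. of_rat (u v) * v) = 0" "v \<in> ?S" "u v \<noteq> 0"
      using Q.dependent_finite[of ?S] by auto
    define q :: "complex poly" where "q = (\<Sum>i\<le>?n. monom (of_real (of_rat (u (x ^ i)))) i)"
    have co: "coeff q i = (if i \<le> ?n then of_real (of_rat (u (x ^ i))) else 0)" for i
      unfolding q_def by (auto simp: coeff_sum)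
    obtain k where "k \<le> ?n" "u (x ^ k) \<noteq> 0" using u by auto
    then have "coeff q k \<noteq> 0" by (simp add: co)
    then have "q \<noteq> 0" by auto
    have "q \<in> cpolys \<rat>" unfolding cpolys_def using co by (auto simp: of_real_image_0 subfield_R_Rats_self)
    have "poly q (of_real x) = of_real (\<Sum>i\<le>?n. of_rat (u (x ^ i)) * x ^ i)"
      unfolding q_def by (simp add: poly_sum poly_monom)
    moreover have "(\<Sum>i\<le>?n. of_rat (u (x ^ i)) * x ^ i) = 0" using u(1) by (simp add: sum.reindex[OF True])
    ultimately have "poly q (of_real x) = 0" by (metis of_real_0)
    with \<open>q \<noteq> 0\<close> \<open>q \<in> cpolys \<rat>\<close> show ?thesis unfolding algebraic_R_def by blast
  qed
qed

lemma primitive_element_finite: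
  assumes K: "real_number_field K" and "finite B" "B \<subseteq> K"
  shows "\<exists>t\<in>K. B \<subseteq> gen_field {t}"
  using assms(2,3)
proof (induction rule: finite_induct)
  case empty
  then show ?case using K subfield_R_D(1) unfolding real_number_field_def by blast
next
  case (insert b B)
  then obtain t where t: "t \<in> K" "B \<subseteq> gen_field {t}" by auto
  obtain c where c: "c \<in> \<rat>" "{b, t} \<subseteq> gen_field {b + c * t}"
    using primitive_element_two real_number_field_algebraic K t insert.prems by (metis insert_subset)
  have sK: "subfield_R K" using K unfolding real_number_field_def by blast
  have "b + c * t \<in> K" using sK t insert.prems c subfield_R_Rats[OF sK] by (auto intro!: subfield_R_intros)
  moreover have "gen_field {t} \<subseteq> gen_field {b + c * t}"
    using c by (intro gen_field_least subfield_R_gen_field) auto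
  ultimately show ?case using t c by blast
qed

lemma primitive_element:
  assumes K: "real_number_field K"
  obtains t where "t \<in> K" "gen_field {t} = K"
proof -
  obtain B where sK: "subfield_R K" and B: "finite B" "B \<subseteq> K"
    "K \<subseteq> {x. \<exists>c::real \<Rightarrow> rat. x = (\<Sum>b\<in>B. of_rat (c b) * b)}"
    using K unfolding real_number_field_def by blast
  obtain t where t: "t \<in> K" "B \<subseteq> gen_field {t}" using primitive_element_finite[OF K B(1,2)] by blast
  have F: "subfield_R (gen_field {t})" by (rule subfield_R_gen_field)
  have "K \<subseteq> gen_field {t}"
    using B(3) t F subfield_R_Rats[OF F] by (fastforce intro!: subfield_R_sum subfield_R_D)
  moreover have "gen_field {t} \<subseteq> K" using t sK by (intro gen_field_least) auto
  ultimately show ?thesis using that t by blast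
qed

text \<open>The polynomial values at \<open>t\<close> form a field. For inverses, write the minimal
  polynomial of \<open>x\<close> as \<open>r + T q(T)\<close>; minimality gives
  \<open>r \<noteq> 0\<close>, and \<open>1 / x = - q(x) / r\<close>. The lemma serves to carry an
  element of \<open>K\<close> along when \<open>t\<close> is replaced by a conjugate.\<close>

lemma gen_field_algebraic_poly:
  assumes K: "real_number_field K" and t: "gen_field {t} = K" and x: "x \<in> K"
  obtains p where "p \<in> cpolys \<rat>" "poly p (of_real t) = of_real x"
proof -
  have sK: "subfield_R K" using K unfolding real_number_field_def by blast
  let ?P = "{x \<in> K. \<exists>p \<in> cpolys \<rat>. poly p (of_real t) = of_real x}"
  note Q = subfield_R_Rats_self
  have "subfield_R ?P"
    unfolding subfield_R_def
  proof (intro conjI ballI impI)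
    show "0 \<in> ?P" using sK Q by (auto intro!: bexI[of _ 0] cpolys_0 subfield_R_D)
    show "1 \<in> ?P" using sK Q by (auto intro!: bexI[of _ 1] cpolys_1 subfield_R_D)
    fix x assume x: "x \<in> ?P"
    then obtain p where p: "p \<in> cpolys \<rat>" "poly p (of_real t) = of_real x" by blast
    show "- x \<in> ?P" using sK x p Q by (auto intro!: bexI[of _ "0 - p"] cpolys_diff cpolys_0 subfield_R_D)
    {
      fix y assume y: "y \<in> ?P"
      then obtain q where q: "q \<in> cpolys \<rat>" "poly q (of_real t) = of_real y" by blast
      show "x + y \<in> ?P" using sK x y p q Q by (auto intro!: bexI[of _ "p + q"] cpolys_add subfield_R_D)
      show "x * y \<in> ?P" using sK x y p q Q by (auto intro!: bexI[of _ "p * q"] cpolys_mult subfield_R_D)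
    }
    assume nz: "x \<noteq> 0"
    obtain h where h: "h \<in> cpolys \<rat>" "poly h (of_real x) = 0" "h \<noteq> 0"
      "\<And>p. p \<in> cpolys \<rat> \<Longrightarrow> p \<noteq> 0 \<Longrightarrow> poly p (of_real x) = 0 \<Longrightarrow> degree h \<le> degree p"
      using real_number_field_algebraic[OF K, of x] x minimal_poly_exists unfolding algebraic_R_def
      by (metis (no_types, lifting) mem_Collect_eq)
    obtain a q where aq: "h = pCons a q" by (cases h)
    have q: "q \<in> cpolys \<rat>" and "a \<in> complex_of_real ` \<rat>"
      using cpolys_pConsD h(1) unfolding aq by blast+
    then obtain r where r: "r \<in> \<rat>" "a = of_real r" by blast
    have "a \<noteq> 0"
    proof
      assume "a = 0"
      then have "q \<noteq> 0" "poly q (of_real x) = 0" using h(2,3) nz aq by auto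
      then have "degree h \<le> degree q" using h(4) q by blast
      then show False using aq \<open>q \<noteq> 0\<close> by simp
    qed
    then have "r \<noteq> 0" using r by auto
    have "of_real r + of_real x * poly q (of_real x) = 0" using h(2) by (simp add: aq r)
    then have "of_real x * poly q (of_real x) = - of_real r" by (metis add_eq_0_iff)
    then have "complex_of_real (inverse x) = of_real (- inverse r) * poly q (of_real x)"
      using nz \<open>r \<noteq> 0\<close> by (auto simp: field_simps add_eq_0_iff2)
    then have "poly ([:of_real (- inverse r):] * pcompose q p) (of_real t) = of_real (inverse x)"
      using p(2) by (simp add: poly_pcompose)
    moreover have "[:of_real (- inverse r):] * pcompose q p \<in> cpolys \<rat>"
      using Q q p r by (intro cpolys_mult cpolys_const cpolys_pcompose) (auto intro: subfield_R_D)
    moreover have "inverse x \<in> K" using x sK subfield_R_D(6) by blast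
    ultimately show "inverse x \<in> ?P" by blast
  qed
  moreover have "t \<in> K" using t gen_field_superset by blast
  then have "{t} \<subseteq> ?P"
    using cpolys_pCons[of 0 "\<rat>" "[:of_real 1:]"] Q cpolys_const[OF Q, of 1]
    by (auto intro!: bexI[of _ "[:0, 1:]"])
  ultimately have "gen_field {t} \<subseteq> ?P" by (rule gen_field_least)
  then show ?thesis using that x t by blast
qed

text \<open>With \<open>\<tau> = m t\<^sup>2\<close>, a conjugate of \<open>t\<close> fixing \<open>((1 + \<tau>) / (1 - \<tau>))\<^sup>2\<close> maps \<open>\<tau>\<close> to
  \<open>\<tau>\<close> or \<open>1 / \<tau>\<close>; each nontrivial conjugate excludes only finitely many rational translates \<open>t\<close>
  of a fixed primitive element.\<close>

lemma primitive_cosh_square: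
  assumes K: "real_number_field K" and m: "m \<in> K" "m \<noteq> 0" and uv: "u < v"
  obtains t where "t \<in> K" "u < t" "t < v" "m * t\<^sup>2 \<noteq> 1 \<Longrightarrow> gen_field {((1 + m * t\<^sup>2) / (1 - m * t\<^sup>2))\<^sup>2} = K"
proof -
  have sK: "subfield_R K" using K unfolding real_number_field_def by blast
  obtain s where s: "s \<in> K" "gen_field {s} = K" using primitive_element[OF K] .
  let ?s = "complex_of_real s" and ?m = "complex_of_real m"
  obtain f where f: "f \<in> cpolys \<rat>" "poly f ?s = 0" "poly (pderiv f) ?s \<noteq> 0"
    using simple_root_poly[OF real_number_field_algebraic[OF K s(1)]] .
  obtain \<mu> where \<mu>: "\<mu> \<in> cpolys \<rat>" "poly \<mu> ?s = ?m" using gen_field_algebraic_poly[OF K s(2) m(1)] .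
  have f0: "f \<noteq> 0" using f(3) by auto
  \<comment> \<open>For a root \<open>w\<close> of \<open>f\<close> let \<sigma> be the
    corresponding conjugate of \<tau>, the value of \<mu> at \<open>w\<close> times
    \<open>(w + c)^2\<close>. As functions of the translation \<open>c\<close>, \<open>P1 w\<close>
    is \<sigma> - \<tau> and \<open>P2 w\<close> is \<sigma> \<tau> - 1; their roots are the bad
    translations.\<close>
  define P1 where "P1 w = smult (poly \<mu> w) ([:w, 1:]\<^sup>2) - smult ?m ([:?s, 1:]\<^sup>2)" for w
  define P2 where "P2 w = smult (poly \<mu> w * ?m) ([:w, 1:]\<^sup>2 * [:?s, 1:]\<^sup>2) - 1" for w
  have P1: "P1 w \<noteq> 0" if "w \<noteq> ?s" for w
  proof -
    have "poly (P1 w) (- w) = - ?m * (?s - w)\<^sup>2" by (simp add: P1_def power2_eq_square algebra_simps)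
    then show ?thesis using m(2) that by auto
  qed
  have P2: "P2 w \<noteq> 0" for w
  proof -
    have "poly (P2 w) (- ?s) = - 1" by (simp add: P2_def)
    then show ?thesis by auto
  qed
  let ?S = "\<Union>w \<in> {w. poly f w = 0} - {?s}. {c. poly (P1 w) c = 0} \<union> {c. poly (P2 w) c = 0}"
  have "finite ?S" using f0 P1 P2 by (auto intro!: poly_roots_finite)
  then obtain c where c: "c \<in> \<rat>" "u - s < c" "c < v - s" "complex_of_real c \<notin> ?S"
    using infinite_Rats_interval_diff[of "u - s" "v - s" ?S] uv by auto
  define t where "t = s + c"
  have tK: "t \<in> K" using s c sK subfield_R_Rats[OF sK] by (auto simp: t_def intro!: subfield_R_D)
  define \<tau> where "\<tau> = m * t\<^sup>2"
  have \<tau>K: "\<tau> \<in> K" using tK m sK by (auto simp: \<tau>_def intro!: subfield_R_intros)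
  have "gen_field {((1 + \<tau>) / (1 - \<tau>))\<^sup>2} = K" if ne: "\<tau> \<noteq> 1"
  proof
    define \<xi> where "\<xi> = ((1 + \<tau>) / (1 - \<tau>))\<^sup>2"
    have \<xi>: "\<xi> * (1 - \<tau>)\<^sup>2 = (1 + \<tau>)\<^sup>2" using ne by (simp add: \<xi>_def power_divide)
    have "\<xi> \<in> K" using \<tau>K sK by (auto simp: \<xi>_def intro!: subfield_R_intros)
    then show "gen_field {\<xi>} \<subseteq> K" using sK by (intro gen_field_least) auto
    let ?F = "gen_field {\<xi>}"
    have F: "subfield_R ?F" by (rule subfield_R_gen_field)
    have QF: "\<rat> \<subseteq> ?F" by (rule subfield_R_Rats[OF F])
    define A where "A = \<mu> * [:of_real c, of_real 1:]\<^sup>2"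
    have A: "A \<in> cpolys ?F" unfolding A_def
      using \<mu>(1) cpolys_mono[OF QF] c QF F
      by (intro cpolys_mult cpolys_power cpolys_pCons cpolys_0) auto
    \<comment> \<open>The equation \<open>((1 + A) / (1 - A))^2 = \<xi>\<close> with denominators
      cleared. Its coefficients lie in the field generated by \<xi>, and \<open>A\<close> takes the
      value \<tau> at \<open>s\<close>.\<close>
    define g where "g = (1 + A)\<^sup>2 - [:of_real \<xi>:] * (1 - A)\<^sup>2"
    have g: "g \<in> cpolys ?F" unfolding g_def using A F gen_field_superset[of "{\<xi>}"]
      by (intro cpolys_mult cpolys_power cpolys_add cpolys_diff cpolys_const cpolys_1) auto
    have As: "poly A ?s = of_real \<tau>" by (simp add: A_def \<mu>(2) \<tau>_def t_def algebra_simps)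
    have \<xi>c: "complex_of_real \<xi> * (1 - of_real \<tau>)\<^sup>2 = (1 + of_real \<tau>)\<^sup>2"
      using arg_cong[OF \<xi>, of complex_of_real] by simp
    have "s \<in> ?F"
    proof (rule unique_common_root_in_subfield[OF F _ g])
      show "f \<in> cpolys ?F" using f(1) cpolys_mono[OF QF] by blast
      show "poly g ?s = 0" using \<xi>c by (simp add: g_def As)
      fix w assume w: "poly f w = 0" "poly g w = 0"
      show "w = ?s"
      proof (rule ccontr)
        assume ws: "w \<noteq> ?s"
        define \<sigma> where "\<sigma> = poly A w"
        have "(1 + \<sigma>)\<^sup>2 = of_real \<xi> * (1 - \<sigma>)\<^sup>2" using w(2) by (simp add: g_def \<sigma>_def)
        then have "(1 + \<sigma>)\<^sup>2 * (1 - of_real \<tau>)\<^sup>2 = (1 + of_real \<tau>)\<^sup>2 * (1 - \<sigma>)\<^sup>2"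
          using \<xi>c by (metis mult.assoc mult.commute)
        then have "(\<sigma> - of_real \<tau>) * (\<sigma> * of_real \<tau> - 1) = 0"
          by algebra
        then have "\<sigma> = of_real \<tau> \<or> \<sigma> * of_real \<tau> = 1" by auto
        moreover have "poly (P1 w) (of_real c) = \<sigma> - of_real \<tau>"
          by (simp add: P1_def \<sigma>_def A_def \<tau>_def t_def algebra_simps power2_eq_square)
        moreover have "poly (P2 w) (of_real c) = \<sigma> * of_real \<tau> - 1"
          by (simp add: P2_def \<sigma>_def A_def \<tau>_def t_def algebra_simps power2_eq_square)
        ultimately show False using c(4) w(1) ws by auto
      qed
    qed (use f in auto)
    then show "K \<subseteq> ?F" using s(2) gen_field_least[OF F, of "{s}"] by auto
  qed
  then show ?thesis using that[of t] tK c unfolding \<tau>_def t_def by auto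
qed

section \<open>Right-angled pentagons and their reflection groups\<close>

lemma mat2_eq_iff: "(A::mat2) = B \<longleftrightarrow> A$1$1 = B$1$1 \<and> A$1$2 = B$1$2 \<and> A$2$1 = B$2$1 \<and> A$2$2 = B$2$2"
  by (auto simp: vec_eq_iff forall_2)

lemma mat2_mult_nth: "((A::mat2) ** B)$i$j = A$i$1 * B$1$j + A$i$2 * B$2$j"
  by (simp add: matrix_matrix_mult_def sum_2)

lemma mat2_one_nth: "(mat 1 :: mat2)$1$1 = 1" "(mat 1 :: mat2)$1$2 = 0"
    "(mat 1 :: mat2)$2$1 = 0" "(mat 1 :: mat2)$2$2 = 1"
  by (simp_all add: mat_def)

lemma uhpI [intro]: "Im z > 0 \<Longrightarrow> z \<in> uhp" and uhpD [dest]: "z \<in> uhp \<Longrightarrow> Im z > 0"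
  by (auto simp: uhp_def)

lemma mob_cnj: "mob A (cnj z) = cnj (mob A z)"
  by (simp add: mob_def)

lemma mob_denominator_nonzero:
  assumes "det (A::mat2) \<noteq> 0" "Im z \<noteq> 0"
  shows "of_real (A$2$1) * z + of_real (A$2$2) \<noteq> 0"
  using assms by (auto simp: complex_eq_iff det_2)

lemma mob_mult:
  assumes "det B \<noteq> 0" "Im z \<noteq> 0"
  shows "mob (A ** B) z = mob A (mob B z)"
proof -
  let ?n = "of_real (B$1$1) * z + of_real (B$1$2)" and ?e = "of_real (B$2$1) * z + of_real (B$2$2)"
  have e: "?e \<noteq> 0" using mob_denominator_nonzero[OF assms] .
  have lin: "of_real a * (?n / ?e) + of_real b = (of_real a * ?n + of_real b * ?e) / ?e" for a b
    using e by (simp add: field_simps)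
  have "mob A (mob B z) = (of_real (A$1$1) * ?n + of_real (A$1$2) * ?e) / (of_real (A$2$1) * ?n + of_real (A$2$2) * ?e)"
    unfolding mob_def[of B] unfolding mob_def[of A] lin using e by simp
  also have "\<dots> = mob (A ** B) z"
    unfolding mob_def by (simp add: mat2_mult_nth algebra_simps)
  finally show ?thesis ..
qed

lemma mob_one: "mob (mat 1) z = z"
  by (simp add: mob_def mat2_one_nth)

text \<open>Coordinates of the hyperboloid model, in which reflections act linearly.\<close>

definition h1 :: "complex \<Rightarrow> real" where "h1 z = Re z / Im z"
definition h2 :: "complex \<Rightarrow> real" where "h2 z = (1 - (Re z)\<^sup>2 - (Im z)\<^sup>2) / (2 * Im z)"
definition h3 :: "complex \<Rightarrow> real" where "h3 z = (1 + (Re z)\<^sup>2 + (Im z)\<^sup>2) / (2 * Im z)"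

lemma h3_pos: "z \<in> uhp \<Longrightarrow> h3 z > 0"
  unfolding h3_def by (intro divide_pos_pos add_pos_nonneg) auto

lemma h_hyperboloid: "z \<in> uhp \<Longrightarrow> (h3 z)\<^sup>2 = 1 + (h1 z)\<^sup>2 + (h2 z)\<^sup>2"
  unfolding h1_def h2_def h3_def by (drule uhpD) (simp add: field_simps power2_eq_square)

lemma h_inj:
  assumes "z \<in> uhp" "w \<in> uhp" "h1 z = h1 w" "h2 z = h2 w" "h3 z = h3 w"
  shows "z = w"
proof -
  have im: "h2 z + h3 z = 1 / Im z" if "z \<in> uhp" for z
    using that unfolding h2_def h3_def by (simp add: add_divide_distrib[symmetric])
  have re: "Re z = h1 z * Im z" if "z \<in> uhp" for z
    using uhpD[OF that] unfolding h1_def by simp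
  have "1 / Im z = 1 / Im w" using assms im by metis
  then have "Im z = Im w" by simp
  then show ?thesis using assms re by (metis complex_eqI)
qed

text \<open>The general trace-free matrix, that is, a pure quaternion, in coordinates where minus
  the determinant is the Lorentz form. If this form has value 1, then letting the matrix act on the
  conjugate of \<open>z\<close> is the reflection in the geodesic
  \<open>p h1 + q h2 + s h3 = 0\<close>.\<close>

definition reflm :: "real \<Rightarrow> real \<Rightarrow> real \<Rightarrow> mat2" where
  "reflm p q s = vector [vector [p, q + s], vector [q - s, - p]]"

lemma reflm_nth: "reflm p q s $1$1 = p" "reflm p q s $1$2 = q + s"
    "reflm p q s $2$1 = q - s" "reflm p q s $2$2 = - p"
  by (simp_all add: reflm_def)

lemma det_reflm: "det (reflm p q s) = - (p\<^sup>2 + q\<^sup>2 - s\<^sup>2)"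
  by (simp add: det_2 reflm_nth algebra_simps power2_eq_square)

lemma reflection_coordinates:
  assumes z: "z \<in> uhp" and n: "p\<^sup>2 + q\<^sup>2 - s\<^sup>2 = 1"
  defines "w \<equiv> mob (reflm p q s) (cnj z)" and "l \<equiv> p * h1 z + q * h2 z + s * h3 z"
  shows "w \<in> uhp" "h1 w = h1 z - 2 * l * p" "h2 w = h2 z - 2 * l * q" "h3 w = h3 z + 2 * l * s"
proof -
  obtain x y where xy: "z = Complex x y" by (cases z)
  have y: "y > 0" using z xy by auto
  \<comment> \<open>\<open>D\<close>, \<open>M\<close> and \<open>N\<close> are the squared moduli
    of denominator and numerator of \<open>w\<close> and the real part of numerator times conjugate
    denominator. All coordinates of \<open>w\<close> are expressed through them.\<close>
  define D where "D = ((q - s) * x - p)\<^sup>2 + ((q - s) * y)\<^sup>2"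
  have "of_real (reflm p q s $2$1) * cnj z + of_real (reflm p q s $2$2) \<noteq> 0"
    using mob_denominator_nonzero[of "reflm p q s" "cnj z"] n y xy by (simp add: det_reflm)
  then have "(q - s) * x - p \<noteq> 0 \<or> (q - s) * y \<noteq> 0"
    by (auto simp: reflm_nth xy complex_eq_iff)
  then have D: "D > 0" unfolding D_def by (simp add: sum_power2_gt_zero_iff)
  define N where "N = (p * x + (q + s)) * ((q - s) * x - p) + p * y * ((q - s) * y)"
  have re: "Re w = N / D"
    unfolding w_def mob_def Re_divide by (simp add: reflm_nth xy D_def N_def power2_eq_square)
  have "Im w = (p * ((q - s) * y) * x + (q + s) * ((q - s) * y) - p * y * ((q - s) * x - p)) / D"
    unfolding w_def mob_def Im_divide by (simp add: reflm_nth xy D_def power2_eq_square algebra_simps)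
  also have "p * ((q - s) * y) * x + (q + s) * ((q - s) * y) - p * y * ((q - s) * x - p) = y * (p\<^sup>2 + q\<^sup>2 - s\<^sup>2)"
    by (simp add: power2_eq_square algebra_simps)
  finally have im: "Im w = y / D" by (simp add: n)
  show w: "w \<in> uhp" using im D y by auto
  define M where "M = (p * x + (q + s))\<^sup>2 + (p * y)\<^sup>2"
  have "(cmod w)\<^sup>2 = M / D"
    unfolding w_def mob_def norm_divide power_divide cmod_power2
    by (simp add: reflm_nth xy D_def M_def power2_eq_square algebra_simps)
  then have nw: "(Re w)\<^sup>2 + (Im w)\<^sup>2 = M / D" by (simp add: cmod_power2)
  have l: "l * (2 * y) = 2 * p * x + q * (1 - x\<^sup>2 - y\<^sup>2) + s * (1 + x\<^sup>2 + y\<^sup>2)"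
    using y unfolding l_def by (simp add: h1_def h2_def h3_def xy field_simps)
  have h1w: "h1 w = N / y" using D y by (simp add: h1_def re im)
  have h2w: "h2 w = (D - M) / (2 * y)"
  proof -
    have "h2 w = (1 - ((Re w)\<^sup>2 + (Im w)\<^sup>2)) / (2 * Im w)" by (simp add: h2_def algebra_simps)
    also have "\<dots> = (1 - M / D) / (2 * (y / D))" unfolding nw unfolding im ..
    also have "\<dots> = (D - M) / (2 * y)" using D y by (simp add: field_simps)
    finally show ?thesis .
  qed
  have h3w: "h3 w = (D + M) / (2 * y)"
  proof -
    have "h3 w = (1 + ((Re w)\<^sup>2 + (Im w)\<^sup>2)) / (2 * Im w)" by (simp add: h3_def algebra_simps)
    also have "\<dots> = (1 + M / D) / (2 * (y / D))" unfolding nw unfolding im ..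
    also have "\<dots> = (D + M) / (2 * y)" using D y by (simp add: field_simps)
    finally show ?thesis .
  qed
  have s2: "s\<^sup>2 = p\<^sup>2 + q\<^sup>2 - 1" using n by simp
  have "N = x - (l * (2 * y)) * p" unfolding l N_def using s2 by algebra
  then show "h1 w = h1 z - 2 * l * p" unfolding h1w using y by (simp add: h1_def xy field_simps)
  have "D - M = 1 - x\<^sup>2 - y\<^sup>2 - 2 * (l * (2 * y)) * q" unfolding l D_def M_def using s2 by algebra
  then show "h2 w = h2 z - 2 * l * q" unfolding h2w using y by (simp add: h2_def xy field_simps)
  have "D + M = 1 + x\<^sup>2 + y\<^sup>2 + 2 * (l * (2 * y)) * s" unfolding l D_def M_def using s2 by algebra
  then show "h3 w = h3 z + 2 * l * s" unfolding h3w using y by (simp add: h3_def xy field_simps)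
qed

section \<open>Sides, labels and reflections of the pentagon\<close>

datatype side = SX | SY1 | SZ1 | SY2 | SZ2
datatype axis = AX | AY | AZ

fun axis_of :: "side \<Rightarrow> axis" where
  "axis_of SX = AX" | "axis_of SY1 = AY" | "axis_of SY2 = AY" | "axis_of SZ1 = AZ" | "axis_of SZ2 = AZ"

definition cnt :: "axis \<Rightarrow> side list \<Rightarrow> nat" where
  "cnt A w = length (filter (\<lambda>s. axis_of s = A) w)"

lemma cnt_simps [simp]: "cnt A [] = 0" "cnt A (s # w) = (if axis_of s = A then Suc (cnt A w) else cnt A w)"
    "cnt A (v @ w) = cnt A v + cnt A w" "cnt A (rev w) = cnt A w"
  by (auto simp: cnt_def rev_filter[symmetric])

lemma length_eq_cnt: "length w = cnt AX w + cnt AY w + cnt AZ w"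
proof (induction w)
  case (Cons s w)
  then show ?case by (cases s) auto
qed simp

text \<open>In the Klein model with coordinates \<open>h1 / h3\<close> and \<open>h2 / h3\<close> the pentagon is the rectangle
  \<open>[0, d] \<times> [0, c]\<close> with the corner \<open>d X + c Y > 1\<close> cut off. Each side carries the coordinate
  of \<open>\<real>\<^sup>3\<close> that vanishes on the corresponding edge of an octant of \<open>S2\<close>.\<close>

locale pentagon =
  fixes c d :: real
  assumes c: "0 < c" "c < 1" and d: "0 < d" "d < 1" and cd: "c\<^sup>2 + d\<^sup>2 > 1"
begin

text \<open>By \<open>cd\<close> the point \<open>(d, c)\<close> lies outside the Klein disc; its
  polar line \<open>d X + c Y = 1\<close> is the common perpendicular of \<open>X = d\<close> and
  \<open>Y = c\<close> and supplies the fifth side. The three factors turn the normals of these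
  walls into unit vectors of the Lorentz form.\<close>

definition "al = 1 / sqrt (1 - c\<^sup>2)"
definition "ga = 1 / sqrt (1 - d\<^sup>2)"
definition "et = 1 / sqrt (c\<^sup>2 + d\<^sup>2 - 1)"

lemma coef_pos: "al > 0" "ga > 0" "et > 0"
  using c d cd by (auto simp: al_def ga_def et_def abs_square_less_1)

lemma coef_sq: "al\<^sup>2 * (1 - c\<^sup>2) = 1" "ga\<^sup>2 * (1 - d\<^sup>2) = 1" "et\<^sup>2 * (c\<^sup>2 + d\<^sup>2 - 1) = 1"
proof -
  have "1 - c\<^sup>2 > 0" "1 - d\<^sup>2 > 0" using c d by (auto simp: abs_square_less_1)
  then show "al\<^sup>2 * (1 - c\<^sup>2) = 1" "ga\<^sup>2 * (1 - d\<^sup>2) = 1" "et\<^sup>2 * (c\<^sup>2 + d\<^sup>2 - 1) = 1"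
    using cd by (auto simp: al_def ga_def et_def power_divide)
qed

text \<open>The wall of \<open>s\<close> is \<open>cp s * h1 + cq s * h2 + cs s * h3 = 0\<close>; its unit normal for the
  Lorentz form is \<open>(cp s, cq s, - cs s)\<close>, hence the sign in \<open>ip\<close>.\<close>

fun cp :: "side \<Rightarrow> real" where
  "cp SZ1 = 1" | "cp SY2 = 0" | "cp SY1 = 0" | "cp SZ2 = - ga" | "cp SX = - et * d"

fun cq :: "side \<Rightarrow> real" where
  "cq SZ1 = 0" | "cq SY2 = 1" | "cq SY1 = - al" | "cq SZ2 = 0" | "cq SX = - et * c"

fun cs :: "side \<Rightarrow> real" where
  "cs SZ1 = 0" | "cs SY2 = 0" | "cs SY1 = al * c" | "cs SZ2 = ga * d" | "cs SX = et"

definition ip :: "side \<Rightarrow> side \<Rightarrow> real" where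
  "ip s t = cp s * cp t + cq s * cq t - cs s * cs t"

definition ell :: "side \<Rightarrow> complex \<Rightarrow> real" where
  "ell s z = cp s * h1 z + cq s * h2 z + cs s * h3 z"

definition rm :: "side \<Rightarrow> mat2" where
  "rm s = reflm (cp s) (cq s) (cs s)"

definition act1 :: "side \<Rightarrow> complex \<Rightarrow> complex" where
  "act1 s z = mob (rm s) (cnj z)"

definition P :: "complex set" where
  "P = {z \<in> uhp. \<forall>s. ell s z \<ge> 0}"

lemma unit: "(cp s)\<^sup>2 + (cq s)\<^sup>2 - (cs s)\<^sup>2 = 1"
  using coef_sq by (cases s) (auto simp: power_mult_distrib algebra_simps)

lemma ip_self: "ip s s = 1"
  using unit[of s] by (simp add: ip_def power2_eq_square)

lemma ip_sym: "ip s t = ip t s"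
  by (simp add: ip_def)

lemma act1_uhp: "z \<in> uhp \<Longrightarrow> act1 s z \<in> uhp"
  and act1_h1: "z \<in> uhp \<Longrightarrow> h1 (act1 s z) = h1 z - 2 * ell s z * cp s"
  and act1_h2: "z \<in> uhp \<Longrightarrow> h2 (act1 s z) = h2 z - 2 * ell s z * cq s"
  and act1_h3: "z \<in> uhp \<Longrightarrow> h3 (act1 s z) = h3 z + 2 * ell s z * cs s"
  using reflection_coordinates[OF _ unit[of s]] by (auto simp: act1_def rm_def ell_def)

lemma ell_act1: "z \<in> uhp \<Longrightarrow> ell t (act1 s z) = ell t z - 2 * ell s z * ip s t"
  unfolding ell_def[of t] by (simp add: act1_h1 act1_h2 act1_h3 ip_def algebra_simps)

lemma act1_act1: "z \<in> uhp \<Longrightarrow> act1 s (act1 s z) = z"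
  by (rule h_inj) (simp_all add: act1_uhp act1_h1 act1_h2 act1_h3 ell_act1 ip_self)

lemma act1_commute: "z \<in> uhp \<Longrightarrow> ip s t = 0 \<Longrightarrow> act1 s (act1 t z) = act1 t (act1 s z)"
  using ip_sym[of s t]
  by (intro h_inj) (simp_all add: act1_uhp act1_h1 act1_h2 act1_h3 ell_act1)

lemma act1_fixed: "z \<in> uhp \<Longrightarrow> ell s z = 0 \<Longrightarrow> act1 s z = z"
  by (rule h_inj) (simp_all add: act1_uhp act1_h1 act1_h2 act1_h3)

lemma h2_less: "z \<in> uhp \<Longrightarrow> \<bar>h2 z\<bar> < h3 z" and h1_less: "z \<in> uhp \<Longrightarrow> \<bar>h1 z\<bar> < h3 z"
  using h_hyperboloid[of z] h3_pos[of z]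
  by (auto intro!: power2_less_imp_less[of _ "h3 z"] simp: power2_abs add_pos_nonneg)

text \<open>Such a point would have Klein coordinates at least \<open>d\<close> and
  \<open>c\<close>, hence lie outside the unit disc.\<close>

lemma not_both_far:
  assumes "z \<in> uhp" "h1 z \<ge> d * h3 z" "h2 z \<ge> c * h3 z"
  shows False
proof -
  have h: "h3 z > 0" using assms h3_pos by blast
  have "(d * h3 z)\<^sup>2 \<le> (h1 z)\<^sup>2" "(c * h3 z)\<^sup>2 \<le> (h2 z)\<^sup>2"
    using assms h c d by (auto intro!: power_mono)
  then have "(c\<^sup>2 + d\<^sup>2) * (h3 z)\<^sup>2 \<le> (h3 z)\<^sup>2 - 1"
    using h_hyperboloid[OF assms(1)] by (simp add: power_mult_distrib algebra_simps)
  moreover have "1 * (h3 z)\<^sup>2 \<le> (c\<^sup>2 + d\<^sup>2) * (h3 z)\<^sup>2" using cd by (intro mult_right_mono) auto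
  ultimately show False by simp
qed

lemma ell_le_iff:
  "ell SZ1 z \<le> 0 \<longleftrightarrow> h1 z \<le> 0" "ell SY2 z \<le> 0 \<longleftrightarrow> h2 z \<le> 0"
  "ell SY1 z \<le> 0 \<longleftrightarrow> c * h3 z \<le> h2 z" "ell SZ2 z \<le> 0 \<longleftrightarrow> d * h3 z \<le> h1 z"
  "ell SX z \<le> 0 \<longleftrightarrow> h3 z \<le> d * h1 z + c * h2 z"
proof -
  have "ell SY1 z = al * (c * h3 z - h2 z)" "ell SZ2 z = ga * (d * h3 z - h1 z)"
    "ell SX z = et * (h3 z - (d * h1 z + c * h2 z))" by (simp_all add: ell_def algebra_simps)
  then show "ell SY1 z \<le> 0 \<longleftrightarrow> c * h3 z \<le> h2 z" "ell SZ2 z \<le> 0 \<longleftrightarrow> d * h3 z \<le> h1 z"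
     "ell SX z \<le> 0 \<longleftrightarrow> h3 z \<le> d * h1 z + c * h2 z"
    using coef_pos by (simp_all add: mult_le_0_iff)
qed (simp_all add: ell_def)

lemma ip_zero:
  "ip SX SY1 = 0" "ip SY1 SZ1 = 0" "ip SZ1 SY2 = 0" "ip SY2 SZ2 = 0" "ip SZ2 SX = 0"
  by (simp_all add: ip_def algebra_simps)

text \<open>Adjacent sides are orthogonal, so \<open>ip s t \<noteq> 0\<close> leaves the five
  nonadjacent pairs. For these the closed negative half-planes are disjoint, which follows from
  \<open>\<bar>h1\<bar>, \<bar>h2\<bar> < h3\<close> and, for the pair \<open>SY1\<close>,
  \<open>SZ2\<close>, from \<open>(d, c)\<close> being outside the disc.\<close>

lemma far_walls_disjoint:
  assumes z: "z \<in> uhp" and st: "s \<noteq> t" "ip s t \<noteq> 0" and le: "ell s z \<le> 0"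
  shows "ell t z > 0"
proof (rule ccontr)
  assume "\<not> ell t z > 0"
  then have le': "ell t z \<le> 0" by simp
  note h = h3_pos[OF z] h1_less[OF z] h2_less[OF z]
  have X: False if "h1 z \<le> 0" "h3 z \<le> d * h1 z + c * h2 z"
  proof -
    have "d * h1 z \<le> 0" using that d by (simp add: mult_le_0_iff)
    moreover have "c * h2 z \<le> c * \<bar>h2 z\<bar>" using c by (intro mult_left_mono) auto
    moreover have "c * \<bar>h2 z\<bar> \<le> 1 * \<bar>h2 z\<bar>" using c by (intro mult_right_mono) auto
    ultimately show False using that h by linarith
  qed
  have Y: False if "h2 z \<le> 0" "h3 z \<le> d * h1 z + c * h2 z"
  proof -
    have "c * h2 z \<le> 0" using that c by (simp add: mult_le_0_iff)
    moreover have "d * h1 z \<le> d * \<bar>h1 z\<bar>" using d by (intro mult_left_mono) auto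
    moreover have "d * \<bar>h1 z\<bar> \<le> 1 * \<bar>h1 z\<bar>" using d by (intro mult_right_mono) auto
    ultimately show False using that h by linarith
  qed
  have Z: False if "h1 z \<le> 0" "d * h3 z \<le> h1 z"
    using that mult_pos_pos[OF d(1) h(1)] by linarith
  have U: False if "h2 z \<le> 0" "c * h3 z \<le> h2 z"
    using that mult_pos_pos[OF c(1) h(1)] by linarith
  show False
    using le le' st ip_zero ip_sym X Y Z U not_both_far[OF z]
    by (cases s; cases t) (auto simp: ell_le_iff)
qed

section \<open>Words in the reflections and the fundamental domain\<close>

definition wact :: "side list \<Rightarrow> complex \<Rightarrow> complex" where
  "wact w z = foldr act1 w z"

lemma wact_simps [simp]: "wact [] z = z" "wact (s # w) z = act1 s (wact w z)"
    "wact (v @ w) z = wact v (wact w z)"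
  by (simp_all add: wact_def)

lemma wact_uhp: "z \<in> uhp \<Longrightarrow> wact w z \<in> uhp"
  by (induction w) (auto intro: act1_uhp)

lemma wact_rev: "z \<in> uhp \<Longrightarrow> wact (rev w) (wact w z) = z"
  by (induction w arbitrary: z) (simp_all add: act1_act1 wact_uhp)

lemma wact_rev': "z \<in> uhp \<Longrightarrow> wact w (wact (rev w) z) = z"
  using wact_rev[of z "rev w"] by simp

text \<open>Parities are part of the relation, so they survive the passage to a shortest word
  without first being shown to depend on the isometry alone.\<close>

definition weq :: "side list \<Rightarrow> side list \<Rightarrow> bool" where
  "weq v w \<longleftrightarrow> (\<forall>z\<in>uhp. wact v z = wact w z) \<and> (\<forall>A. even (cnt A v) = even (cnt A w))"

definition minimal :: "side list \<Rightarrow> bool" where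
  "minimal w \<longleftrightarrow> (\<forall>v. weq v w \<longrightarrow> length w \<le> length v)"

lemma weq_refl: "weq w w" by (simp add: weq_def)

lemma weq_trans: "weq u v \<Longrightarrow> weq v w \<Longrightarrow> weq u w" by (simp add: weq_def)

lemma weq_Cons: "weq v w \<Longrightarrow> weq (s # v) (s # w)"
  by (simp add: weq_def)

lemma weq_cancel: "weq w (s # s # w)"
  by (simp add: weq_def wact_uhp act1_act1)

lemma weq_commute: "ip s t = 0 \<Longrightarrow> weq (s # t # w) (t # s # w)"
  using act1_commute[OF wact_uhp, of _ s t w] by (auto simp: weq_def)

lemma minimal_tl: "minimal (s # w) \<Longrightarrow> minimal w"
  unfolding minimal_def using weq_Cons[of _ w s] by fastforce

lemma minimal_exists: obtains v where "weq v w" "minimal v"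
  using ex_has_least_nat[of "\<lambda>v. weq v w" w length] weq_refl weq_trans
  unfolding minimal_def by metis

text \<open>If the second letter commutes with the first, it may be dropped; otherwise its
  negative half-plane already lies on the positive side of the first wall.\<close>

lemma minimal_negative_side:
  assumes "minimal (s # w)" "p \<in> P"
  shows "ell s (wact (s # w) p) \<le> 0"
  using assms
proof (induction "length w" arbitrary: s w rule: less_induct)
  case less
  have p: "p \<in> uhp" "ell s p \<ge> 0" using less.prems by (auto simp: P_def)
  have "ell s (wact w p) \<ge> 0"
  proof (cases w)
    case Nil
    then show ?thesis using p by simp
  next
    case (Cons t u)
    have mt: "minimal (t # u)" using less.prems minimal_tl Cons by blast
    have "t \<noteq> s"
    proof
      assume "t = s"
      then have "weq u (s # w)" using weq_cancel Cons by simp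
      then show False using less.prems(1) Cons unfolding minimal_def by fastforce
    qed
    show ?thesis
    proof (cases "ip t s = 0")
      case False
      have "ell t (wact (t # u) p) \<le> 0" using less.hyps[of u t] mt less.prems Cons by simp
      then show ?thesis
        using far_walls_disjoint[OF wact_uhp[OF p(1)] \<open>t \<noteq> s\<close> False, of w] Cons by simp
    next
      case True
      have "minimal (s # u)"
        unfolding minimal_def
      proof (intro allI impI)
        fix v assume "weq v (s # u)"
        then have "weq (t # v) (s # w)"
          using weq_Cons[of v "s # u" t] weq_commute[OF True, of u] weq_trans Cons by blast
        then show "length (s # u) \<le> length v" using less.prems(1) Cons unfolding minimal_def by fastforce
      qed
      then have "ell s (wact (s # u) p) \<le> 0" using less.hyps[of u s] less.prems Cons by simp
      then have "ell s (wact u p) \<ge> 0" by (simp add: ell_act1 wact_uhp p ip_self)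
      then show ?thesis by (simp add: Cons ell_act1 wact_uhp p True)
    qed
  qed
  then show ?case by (simp add: ell_act1 wact_uhp p ip_self)
qed

text \<open>The image lies on the nonpositive side of the first wall and also in \<open>P\<close>,
  hence on that wall. The first letter then acts trivially there, and the argument repeats with the
  remaining word.\<close>

lemma minimal_fixes:
  assumes "minimal w" "p \<in> P" "wact w p \<in> P"
  shows "wact w p = p \<and> (\<forall>s \<in> set w. ell s p = 0)"
  using assms
proof (induction w)
  case (Cons s w)
  have p: "p \<in> uhp" using Cons.prems by (auto simp: P_def)
  have "ell s (wact (s # w) p) = 0"
    using minimal_negative_side[OF Cons.prems(1,2)] Cons.prems(3) by (intro antisym) (auto simp: P_def)
  then have e: "ell s (wact w p) = 0" by (simp add: ell_act1 wact_uhp p ip_self)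
  then have "wact (s # w) p = wact w p" by (simp add: act1_fixed wact_uhp p)
  moreover have "wact w p = p \<and> (\<forall>s \<in> set w. ell s p = 0)"
    using Cons.IH minimal_tl[OF Cons.prems(1)] Cons.prems(2,3) calculation by simp
  ultimately show ?case using e by simp
qed simp

lemma fundamental_domain:
  assumes "p \<in> P" "wact w p \<in> P"
  shows "wact w p = p" "\<exists>v. weq v w \<and> (\<forall>s \<in> set v. ell s p = 0)"
proof -
  obtain v where v: "weq v w" "minimal v" using minimal_exists .
  have "wact v p = wact w p" using v assms by (auto simp: weq_def P_def)
  then show "wact w p = p" "\<exists>v. weq v w \<and> (\<forall>s \<in> set v. ell s p = 0)"
    using minimal_fixes[OF v(2) assms(1)] assms v(1) by auto
qed

lemma wact_commute_past:
  assumes "\<forall>t \<in> set x. ip s t = 0" "z \<in> uhp"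
  shows "act1 s (wact x z) = wact x (act1 s z)"
  using assms by (induction x) (auto simp: act1_commute wact_uhp)

text \<open>Walls meeting in \<open>P\<close> belong to adjacent sides, and the labelling was chosen
  so that adjacent sides differ in their axis. Freeness of the action of the kernel rests on
  this.\<close>

lemma walls_through_point:
  assumes "p \<in> P" "ell s p = 0" "ell t p = 0" "s \<noteq> t"
  shows "ip s t = 0" "axis_of s \<noteq> axis_of t"
proof -
  show "ip s t = 0" using far_walls_disjoint[of p s t] assms by (force simp: P_def)
  then show "axis_of s \<noteq> axis_of t"
    using assms(4) coef_pos by (cases s; cases t) (auto simp: ip_def)
qed

text \<open>Among the walls through \<open>p\<close> the axis determines the side, so even parities
  make every letter recur. All these reflections commute, and the two occurrences cancel.\<close>

lemma even_stabilizer_trivial: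
  assumes p: "p \<in> P" and v: "\<forall>s \<in> set v. ell s p = 0" and ev: "\<forall>A. even (cnt A v)" and z: "z \<in> uhp"
  shows "wact v z = z"
  using v ev
proof (induction "length v" arbitrary: v rule: less_induct)
  case less
  show ?case
  proof (cases v)
    case (Cons s w)
    have "odd (cnt (axis_of s) w)" using less.prems(2) Cons by (metis cnt_simps(2) even_Suc)
    then have "cnt (axis_of s) w \<noteq> 0" by (metis even_zero)
    then obtain t where t: "t \<in> set w" "axis_of t = axis_of s"
      unfolding cnt_def by (auto simp: filter_empty_conv)
    then have "t = s" using walls_through_point(2)[OF p, of t s] less.prems(1) Cons by auto
    then obtain x y where w: "w = x @ s # y" "s \<notin> set x" using t split_list_first by metis
    have "\<forall>t \<in> set x. ip s t = 0"
      using walls_through_point(1)[OF p, of s] less.prems(1) Cons w by fastforce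
    then have "wact v z = wact (x @ y) z"
      using z by (simp add: Cons w wact_commute_past act1_uhp wact_uhp act1_act1)
    also have "\<dots> = z"
    proof (rule less.hyps)
      show "\<forall>A. even (cnt A (x @ y))"
      proof
        fix A
        have "even (cnt A v)" using less.prems(2) by blast
        then show "even (cnt A (x @ y))" by (auto simp: Cons w split: if_splits)
      qed
    qed (use less.prems(1) Cons w in auto)
    finally show ?thesis .
  qed simp
qed

section \<open>Matrices representing words\<close>

definition wm :: "side list \<Rightarrow> mat2" where
  "wm w = foldr (\<lambda>s A. rm s ** A) w (mat 1)"

lemma wm_simps [simp]: "wm [] = mat 1" "wm (s # w) = rm s ** wm w"
  by (simp_all add: wm_def)

lemma wm_append: "wm (v @ w) = wm v ** wm w"
  by (induction v) (simp_all add: matrix_mul_assoc)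

lemma det_rm: "det (rm s) = - 1"
  using unit[of s] by (simp add: rm_def det_reflm)

lemma det_wm: "det (wm w) = (- 1) ^ length w"
  by (induction w) (simp_all add: det_mul det_rm)

lemma wact_eq_mob: "z \<in> uhp \<Longrightarrow> wact w z = mob (wm w) (if even (length w) then z else cnj z)"
proof (induction w)
  case (Cons s w)
  let ?z = "if even (length w) then z else cnj z"
  have i: "Im ?z \<noteq> 0" using uhpD[OF Cons.prems] by auto
  have "wact (s # w) z = mob (rm s) (cnj (mob (wm w) ?z))"
    using Cons by (simp add: act1_def)
  also have "\<dots> = mob (rm s) (mob (wm w) (cnj ?z))" by (simp add: mob_cnj)
  also have "\<dots> = mob (wm (s # w)) (cnj ?z)"
    using i by (simp add: mob_mult det_wm)
  finally show ?case by auto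
qed (simp add: mob_one)

lemma rm_rm: "rm s ** rm s = mat 1"
  using unit[of s] by (auto simp: mat2_eq_iff mat2_mult_nth mat2_one_nth rm_def reflm_nth power2_eq_square algebra_simps)

lemma wm_rev: "wm (rev w) ** wm w = mat 1"
proof (induction w)
  case (Cons s w)
  have "wm (rev (s # w)) ** wm (s # w) = wm (rev w) ** (rm s ** rm s) ** wm w"
    by (simp add: wm_append matrix_mul_assoc)
  then show ?case using Cons by (simp add: rm_rm)
qed simp

lemma wm_rev': "wm w ** wm (rev w) = mat 1"
  using wm_rev[of "rev w"] by simp

end

section \<open>Discreteness and tessellation\<close>

text \<open>Inverse of the Klein projection with coordinates \<open>h1 / h3\<close> and
  \<open>h2 / h3\<close>, obtained from \<open>Im z = 1 / (h2 + h3)\<close> and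
  \<open>Re z = h1 / (h2 + h3)\<close>.\<close>

definition kinv :: "real \<Rightarrow> real \<Rightarrow> complex" where
  "kinv X Y = Complex (X / (1 + Y)) (sqrt (1 - X\<^sup>2 - Y\<^sup>2) / (1 + Y))"

lemma kinv:
  assumes "X\<^sup>2 + Y\<^sup>2 < 1"
  defines "r \<equiv> sqrt (1 - X\<^sup>2 - Y\<^sup>2)"
  shows "kinv X Y \<in> uhp" "h1 (kinv X Y) = X / r" "h2 (kinv X Y) = Y / r" "h3 (kinv X Y) = 1 / r"
proof -
  have "Y\<^sup>2 < 1" using assms(1) zero_le_power2[of X] by linarith
  then have Y: "1 + Y > 0" using abs_square_less_1[of Y] by linarith
  have r: "r > 0" "r\<^sup>2 = 1 - X\<^sup>2 - Y\<^sup>2" using assms by (auto simp: r_def)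
  have z: "Re (kinv X Y) = X / (1 + Y)" "Im (kinv X Y) = r / (1 + Y)" by (simp_all add: kinv_def r_def)
  show "kinv X Y \<in> uhp" using z Y r by auto
  show "h1 (kinv X Y) = X / r" using Y r by (simp add: h1_def z)
  have n: "(Re (kinv X Y))\<^sup>2 + (Im (kinv X Y))\<^sup>2 = (1 - Y) / (1 + Y)"
  proof -
    have "(Re (kinv X Y))\<^sup>2 + (Im (kinv X Y))\<^sup>2 = (X\<^sup>2 + r\<^sup>2) / (1 + Y)\<^sup>2"
      by (simp add: z power_divide add_divide_distrib)
    also have "X\<^sup>2 + r\<^sup>2 = (1 - Y) * (1 + Y)"
      unfolding r(2) by (simp add: power2_eq_square algebra_simps)
    finally show ?thesis using Y by (simp add: power2_eq_square)
  qed
  have "h2 (kinv X Y) = (1 - (1 - Y) / (1 + Y)) / (2 * (r / (1 + Y)))"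
    using n z by (simp add: h2_def diff_diff_eq)
  also have "1 - (1 - Y) / (1 + Y) = 2 * Y / (1 + Y)" using Y by (simp add: field_simps)
  also have "\<dots> / (2 * (r / (1 + Y))) = Y / r" using Y r(1) by simp
  finally show "h2 (kinv X Y) = Y / r" .
  have "h3 (kinv X Y) = (1 + (1 - Y) / (1 + Y)) / (2 * (r / (1 + Y)))"
    using n z by (simp add: h3_def add.assoc)
  also have "1 + (1 - Y) / (1 + Y) = 2 / (1 + Y)" using Y by (simp add: field_simps)
  also have "2 * (r / (1 + Y)) = r * (2 / (1 + Y))" by simp
  also have "2 / (1 + Y) / (r * (2 / (1 + Y))) = 1 / r"
  proof -
    have "t / (r * t) = 1 / r" if "t > 0" for t using that by simp
    moreover have "2 / (1 + Y) > 0" using Y by simp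
    ultimately show ?thesis by blast
  qed
  finally show "h3 (kinv X Y) = 1 / r" .
qed

lemma kinv_klein:
  assumes "z \<in> uhp"
  shows "(h1 z / h3 z)\<^sup>2 + (h2 z / h3 z)\<^sup>2 < 1" "kinv (h1 z / h3 z) (h2 z / h3 z) = z"
proof -
  have h: "h3 z > 0" "(h3 z)\<^sup>2 = 1 + (h1 z)\<^sup>2 + (h2 z)\<^sup>2" using assms h3_pos h_hyperboloid by auto
  have e: "1 - (h1 z / h3 z)\<^sup>2 - (h2 z / h3 z)\<^sup>2 = (1 / h3 z)\<^sup>2"
  proof -
    have "1 - (h1 z / h3 z)\<^sup>2 - (h2 z / h3 z)\<^sup>2 = ((h3 z)\<^sup>2 - (h1 z)\<^sup>2 - (h2 z)\<^sup>2) / (h3 z)\<^sup>2"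
      using h(1) by (simp add: power_divide diff_divide_distrib)
    then show ?thesis using h(2) by (simp add: power_divide)
  qed
  moreover have "(1 / h3 z)\<^sup>2 > 0" using h by simp
  ultimately show l: "(h1 z / h3 z)\<^sup>2 + (h2 z / h3 z)\<^sup>2 < 1" by linarith
  have r: "sqrt (1 - (h1 z / h3 z)\<^sup>2 - (h2 z / h3 z)\<^sup>2) = 1 / h3 z"
    unfolding e using h by (simp add: real_sqrt_abs)
  show "kinv (h1 z / h3 z) (h2 z / h3 z) = z"
    using kinv[OF l] h(1) assms unfolding r by (intro h_inj) auto
qed

lemma continuous_on_h: "continuous_on uhp h1" "continuous_on uhp h2" "continuous_on uhp h3"
  unfolding h1_def h2_def h3_def by (auto intro!: continuous_intros simp: uhp_def)

text \<open>The fixed point equations at \<open>\<i>\<close> and \<open>2 * \<i>\<close> already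
  force a scalar matrix.\<close>

lemma mob_identity:
  assumes A: "det (A::mat2) = 1" and id: "\<And>z. z \<in> uhp \<Longrightarrow> mob A z = z"
  shows "A = mat 1 \<or> A = - mat 1"
proof -
  have lin: "of_real (A$1$1) * z + of_real (A$1$2) = z * (of_real (A$2$1) * z + of_real (A$2$2))"
    if "z \<in> uhp" for z
    using id[OF that] mob_denominator_nonzero[of A z] A uhpD[OF that] by (simp add: mob_def divide_eq_eq)
  have "A$1$2 = - A$2$1" "A$1$1 = A$2$2"
    using lin[of \<i>] by (auto simp: complex_eq_iff uhp_def)
  moreover have "A$1$2 = - 4 * A$2$1"
    using lin[of "2 * \<i>"] by (auto simp: complex_eq_iff uhp_def)
  ultimately have e: "A$1$2 = 0" "A$2$1 = 0" "A$1$1 = A$2$2" by auto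
  then have "A$1$1 * A$1$1 = 1" using A by (simp add: det_2)
  then have "A$1$1 = 1 \<or> A$1$1 = - 1" by algebra
  then show ?thesis using e by (auto simp: mat2_eq_iff mat2_one_nth)
qed

text \<open>Properness of the action: \<open>h3\<close> is the hyperbolic cosine of the distance to
  \<open>\<i>\<close>. A bound on \<open>h3 z\<close> confines \<open>z\<close> to a compact set,
  and a bound on \<open>h3\<close> of the image bounds numerator and denominator of the Moebius map,
  because that value is the sum of their squared moduli divided by \<open>2 * Im z\<close>. The
  alternative for \<open>z'\<close> covers words of odd length.\<close>

lemma mob_entries_bounded:
  assumes A: "\<bar>det (A::mat2)\<bar> = 1" and z: "z \<in> uhp" and z': "z' = z \<or> z' = cnj z"
    and w: "mob A z' \<in> uhp" and C: "h3 z \<le> C" "h3 (mob A z') \<le> C"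
  shows "\<bar>A$i$j\<bar> \<le> 2 * C + 8 * C ^ 3 + 4 * C\<^sup>2"
proof -
  define y where "y = Im z"
  have y: "y > 0" using z by (auto simp: y_def)
  have yz: "\<bar>Im z'\<bar> = y" "cmod z' = cmod z" using z' y by (auto simp: y_def)
  have C0: "C > 0" using C h3_pos[OF z] by linarith
  have hz: "1 + (cmod z)\<^sup>2 \<le> 2 * C * y"
    using C(1) y by (simp add: h3_def y_def[symmetric] cmod_power2 field_simps)
  have "y\<^sup>2 \<le> (cmod z)\<^sup>2" by (simp add: cmod_power2 y_def)
  then have "y * y \<le> 2 * C * y" using hz by (simp add: power2_eq_square)
  then have yC: "y \<le> 2 * C" using y by simp
  have "1 \<le> 2 * C * y" using hz zero_le_power2[of "cmod z"] by linarith
  then have yl: "1 / y \<le> 2 * C" using y by (simp add: field_simps)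
  have "2 * C * y \<le> 2 * C * (2 * C)" using yC C0 by (intro mult_left_mono) auto
  then have "(cmod z)\<^sup>2 \<le> (2 * C)\<^sup>2" using hz unfolding power2_eq_square by linarith
  then have zC: "cmod z \<le> 2 * C" by (rule power2_le_imp_le) (use C0 in simp)
  define n where "n = of_real (A$1$1) * z' + of_real (A$1$2)"
  define e where "e = of_real (A$2$1) * z' + of_real (A$2$2)"
  have e: "cmod e > 0"
    using mob_denominator_nonzero[of A z'] A y yz unfolding e_def by fastforce
  have m: "mob A z' = n / e" by (simp add: mob_def n_def e_def)
  have "Im (mob A z') = det A * Im z' / (cmod e)\<^sup>2"
    unfolding m Im_divide cmod_power2[symmetric] by (simp add: n_def e_def det_2 algebra_simps)
  then have "\<bar>Im (mob A z')\<bar> = y / (cmod e)\<^sup>2"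
    using A yz by (simp add: abs_mult)
  then have im: "Im (mob A z') = y / (cmod e)\<^sup>2" using uhpD[OF w] by simp
  have "h3 (mob A z') = (1 + (cmod (mob A z'))\<^sup>2) / (2 * Im (mob A z'))"
    by (simp add: h3_def cmod_power2 add.assoc)
  also have "\<dots> = (1 + (cmod n)\<^sup>2 / (cmod e)\<^sup>2) / (2 * (y / (cmod e)\<^sup>2))"
    unfolding im by (simp add: m norm_divide power_divide)
  also have "\<dots> = ((cmod e)\<^sup>2 + (cmod n)\<^sup>2) / (2 * y)" using e y by (simp add: field_simps)
  finally have "((cmod e)\<^sup>2 + (cmod n)\<^sup>2) / (2 * y) \<le> C" using C(2) by simp
  then have "(cmod e)\<^sup>2 + (cmod n)\<^sup>2 \<le> 2 * C * y" using y by (simp add: pos_divide_le_eq mult.commute mult.left_commute)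
  also have "\<dots> \<le> (2 * C)\<^sup>2" using \<open>2 * C * y \<le> 2 * C * (2 * C)\<close> by (simp add: power2_eq_square)
  finally have en: "(cmod e)\<^sup>2 + (cmod n)\<^sup>2 \<le> (2 * C)\<^sup>2" .
  have "(cmod e)\<^sup>2 \<le> (2 * C)\<^sup>2" "(cmod n)\<^sup>2 \<le> (2 * C)\<^sup>2"
    using en zero_le_power2[of "cmod n"] zero_le_power2[of "cmod e"] by linarith+
  then have ne: "cmod e \<le> 2 * C" "cmod n \<le> 2 * C"
    using power2_le_imp_le[of _ "2 * C"] C0 by simp_all
  have coef: "\<bar>a\<bar> \<le> 4 * C\<^sup>2 \<and> \<bar>b\<bar> \<le> 2 * C + 8 * C ^ 3" if "cmod (of_real a * z' + of_real b) \<le> 2 * C" for a b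
  proof -
    have "\<bar>a\<bar> * y = \<bar>Im (of_real a * z' + of_real b)\<bar>" using yz by (simp add: abs_mult)
    also have "\<dots> \<le> 2 * C" using that abs_Im_le_cmod order_trans by blast
    finally have "\<bar>a\<bar> \<le> 2 * C * (1 / y)" using y by (simp add: field_simps)
    also have "\<dots> \<le> 2 * C * (2 * C)" using yl C0 by (intro mult_left_mono) auto
    finally have a: "\<bar>a\<bar> \<le> 4 * C\<^sup>2" by (simp add: power2_eq_square)
    have "\<bar>b\<bar> = cmod ((of_real a * z' + of_real b) - of_real a * z')" by simp
    also have "\<dots> \<le> cmod (of_real a * z' + of_real b) + cmod (of_real a * z')" by (rule norm_triangle_ineq4)
    also have "\<dots> \<le> 2 * C + \<bar>a\<bar> * cmod z" using that yz by (simp add: norm_mult)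
    also have "\<bar>a\<bar> * cmod z \<le> 4 * C\<^sup>2 * (2 * C)" using a zC C0 by (intro mult_mono) auto
    finally show ?thesis using a by (simp add: power2_eq_square power3_eq_cube)
  qed
  have pos: "0 \<le> 2 * C + 8 * C ^ 3" "0 \<le> 4 * C\<^sup>2" using C0 by auto
  have "i = 1 \<or> i = 2" "j = 1 \<or> j = 2" using exhaust_2 by blast+
  then show ?thesis
    using coef[of "A$1$1" "A$1$2"] coef[of "A$2$1" "A$2$2"] ne pos unfolding n_def e_def by auto
qed

lemma mat2_norm_le:
  assumes "\<And>i j. \<bar>(A::mat2)$i$j\<bar> \<le> B"
  shows "norm A \<le> 4 * B"
proof -
  have "norm A \<le> (\<Sum>i\<in>UNIV. norm (A$i))" by (simp add: norm_vec_def L2_set_le_sum)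
  also have "\<dots> \<le> (\<Sum>i\<in>UNIV. \<Sum>j\<in>UNIV. \<bar>A$i$j\<bar>)" by (intro sum_mono norm_le_l1_cart)
  also have "\<dots> \<le> (\<Sum>i\<in>(UNIV::2 set). \<Sum>j\<in>(UNIV::2 set). B)" using assms by (intro sum_mono) auto
  finally show ?thesis by simp
qed

definition mat2_adj :: "mat2 \<Rightarrow> mat2" where
  "mat2_adj A = vector [vector [A$2$2, - A$1$2], vector [- A$2$1, A$1$1]]"

lemma mat2_adj_nth: "mat2_adj A$1$1 = A$2$2" "mat2_adj A$1$2 = - A$1$2"
    "mat2_adj A$2$1 = - A$2$1" "mat2_adj A$2$2 = A$1$1"
  by (simp_all add: mat2_adj_def)

lemma mat2_adj_mult: "mat2_adj A ** A = det A *\<^sub>R mat 1" "A ** mat2_adj A = det A *\<^sub>R mat 1"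
  by (simp_all add: mat2_eq_iff mat2_mult_nth mat2_adj_nth mat2_one_nth det_2 algebra_simps)

lemma mat2_scaleR_mult: "(k *\<^sub>R (A::mat2)) ** B = k *\<^sub>R (A ** B)" "A ** (k *\<^sub>R B) = k *\<^sub>R (A ** (B::mat2))"
  by (simp_all add: mat2_eq_iff mat2_mult_nth algebra_simps)

lemma tendsto_mat2I:
  assumes "((\<lambda>x. f x$1$1) \<longlongrightarrow> (A::mat2)$1$1) F" "((\<lambda>x. f x$1$2) \<longlongrightarrow> A$1$2) F"
    "((\<lambda>x. f x$2$1) \<longlongrightarrow> A$2$1) F" "((\<lambda>x. f x$2$2) \<longlongrightarrow> A$2$2) F"
  shows "(f \<longlongrightarrow> A) F"
proof -
  have "((\<lambda>x. f x$i$j) \<longlongrightarrow> A$i$j) F" for i j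
    using assms exhaust_2[of i] exhaust_2[of j] by auto
  then show ?thesis by (intro vec_tendstoI)
qed

lemma tendsto_mat2_mult:
  assumes "(f \<longlongrightarrow> (A::mat2)) F" "(g \<longlongrightarrow> (B::mat2)) F"
  shows "((\<lambda>x. f x ** g x) \<longlongrightarrow> A ** B) F"
  using assms by (intro tendsto_mat2I) (auto simp: mat2_mult_nth intro!: tendsto_intros)

lemma tendsto_mat2_adj: "(f \<longlongrightarrow> A) F \<Longrightarrow> ((\<lambda>x. mat2_adj (f x)) \<longlongrightarrow> mat2_adj A) F"
  by (rule tendsto_mat2I) (auto simp: mat2_adj_nth intro!: tendsto_intros)

lemma tendsto_mat2_det: "(f \<longlongrightarrow> (A::mat2)) F \<Longrightarrow> ((\<lambda>x. det (f x)) \<longlongrightarrow> det A) F"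
  unfolding det_2 by (auto intro!: tendsto_intros)

context pentagon begin

definition z0 :: complex where "z0 = kinv (d / 2) (c / 2)"

text \<open>The wall functional at the homogeneous point \<open>(d / 2, c / 2, 1)\<close> over
  \<open>z0\<close>, a positive multiple of \<open>ell s z0\<close>.\<close>

definition kap :: "side \<Rightarrow> real" where
  "kap s = cs s + d / 2 * cp s + c / 2 * cq s"

lemma kap_pos: "kap s > 0"
proof -
  have "c\<^sup>2 < 1" "d\<^sup>2 < 1" using c d by (auto simp: abs_square_less_1)
  then have "et * (1 - (c\<^sup>2 + d\<^sup>2) / 2) > 0" using coef_pos by (intro mult_pos_pos) auto
  moreover have "kap SX = et * (1 - (c\<^sup>2 + d\<^sup>2) / 2)"
    by (simp add: kap_def power2_eq_square algebra_simps add_divide_distrib)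
  ultimately show ?thesis using coef_pos c d by (cases s) (auto simp: kap_def)
qed

lemma z0: "z0 \<in> uhp" "ell s z0 > 0"
proof -
  have "c\<^sup>2 < 1" "d\<^sup>2 < 1" using c d by (auto simp: abs_square_less_1)
  then have k: "(d / 2)\<^sup>2 + (c / 2)\<^sup>2 < 1" by (simp add: power_divide)
  show "z0 \<in> uhp" using kinv(1)[OF k] by (simp add: z0_def)
  let ?r = "sqrt (1 - (d / 2)\<^sup>2 - (c / 2)\<^sup>2)"
  have "ell s z0 = kap s / ?r"
    unfolding ell_def z0_def kinv(2-4)[OF k] kap_def by (simp add: add_divide_distrib mult.commute)
  moreover have "?r > 0" using k by simp
  ultimately show "ell s z0 > 0" using kap_pos[of s] by simp
qed

text \<open>A positive multiple of the hyperbolic cosine of the distance to \<open>z0\<close>, as a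
  Lorentz product.\<close>

definition en :: "complex \<Rightarrow> real" where
  "en z = h3 z - d / 2 * h1 z - c / 2 * h2 z"

lemma en_act1: "z \<in> uhp \<Longrightarrow> en (act1 s z) = en z + 2 * ell s z * kap s"
  by (simp add: en_def act1_h1 act1_h2 act1_h3 kap_def algebra_simps)

lemma h3_le_en: "z \<in> uhp \<Longrightarrow> h3 z \<le> en z / (1 - (c + d) / 2)"
proof -
  assume z: "z \<in> uhp"
  have "d / 2 * h1 z \<le> d / 2 * h3 z" "c / 2 * h2 z \<le> c / 2 * h3 z"
    using h1_less[OF z] h2_less[OF z] c d by (auto intro!: mult_left_mono)
  then have "h3 z * (1 - (c + d) / 2) \<le> en z" by (simp add: en_def algebra_simps add_divide_distrib)
  moreover have "1 - (c + d) / 2 > 0" using c d by simp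
  ultimately show ?thesis by (simp add: pos_le_divide_eq)
qed

lemma weq_Nil_imp_wm:
  assumes "\<And>z. z \<in> uhp \<Longrightarrow> wact w z = z" "even (length w)"
  shows "wm w = mat 1 \<or> wm w = - mat 1"
  using assms wact_eq_mob[of _ w] by (intro mob_identity) (auto simp: det_wm)

text \<open>A matrix close to 1 keeps \<open>z0\<close> in the interior of \<open>P\<close>. If it
  comes from a word, that word equals one in walls through \<open>z0\<close>, and there are none, so
  the matrix is 1 or -1. A positive determinant excludes odd words, a positive upper left entry
  excludes -1.\<close>

lemma wm_near_one: "\<forall>\<^sub>F A in nhds (mat 1). \<forall>w. wm w = A \<longrightarrow> A = mat 1"
proof -
  have t: "((\<lambda>A::mat2. A) \<longlongrightarrow> mat 1) (nhds (mat 1))" by (rule tendsto_ident_at[of _ UNIV, simplified] filterlim_ident)+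
  have m: "((\<lambda>A. mob A z0) \<longlongrightarrow> z0) (nhds (mat 1))"
    unfolding mob_def
    by (rule tendsto_eq_intros t tendsto_of_real tendsto_vec_nth | simp add: mat2_one_nth)+
  have "continuous (at z0) h1" "continuous (at z0) h2" "continuous (at z0) h3"
    using continuous_on_h z0(1) unfolding uhp_def
    by (auto simp: continuous_on_eq_continuous_at open_halfspace_Im_gt)
  then have h: "((\<lambda>A. h1 (mob A z0)) \<longlongrightarrow> h1 z0) (nhds (mat 1))" "((\<lambda>A. h2 (mob A z0)) \<longlongrightarrow> h2 z0) (nhds (mat 1))"
     "((\<lambda>A. h3 (mob A z0)) \<longlongrightarrow> h3 z0) (nhds (mat 1))"
    using m by (auto intro: isCont_tendsto_compose)
  have "((\<lambda>A. ell s (mob A z0)) \<longlongrightarrow> ell s z0) (nhds (mat 1))" for s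
    unfolding ell_def by (intro tendsto_intros h)
  from order_tendstoD(1)[OF this z0(2)]
  have e: "\<forall>\<^sub>F A in nhds (mat 1). ell s (mob A z0) > 0" for s .
  have "\<forall>\<^sub>F A in nhds (mat 1). det (A::mat2) > 0"
    using order_tendstoD(1)[OF tendsto_mat2_det[OF t], of 0] by simp
  moreover have "((\<lambda>A::mat2. A$1$1) \<longlongrightarrow> (mat 1::mat2)$1$1) (nhds (mat 1))"
    by (rule tendsto_vec_nth[OF tendsto_vec_nth[OF t]])
  then have "\<forall>\<^sub>F A in nhds (mat 1). (A::mat2)$1$1 > 0"
    using order_tendstoD(1)[of _ "1::real" _ 0] by (simp add: mat2_one_nth)
  ultimately have "\<forall>\<^sub>F A in nhds (mat 1). det A > 0 \<and> A$1$1 > 0 \<and> ell SX (mob A z0) > 0 \<and> ell SY1 (mob A z0) > 0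
      \<and> ell SY2 (mob A z0) > 0 \<and> ell SZ1 (mob A z0) > 0 \<and> ell SZ2 (mob A z0) > 0"
    using e by (intro eventually_conj) auto
  then show ?thesis
  proof (rule eventually_mono, intro allI impI)
    fix A w
    assume A: "det A > 0 \<and> A$1$1 > 0 \<and> ell SX (mob A z0) > 0 \<and> ell SY1 (mob A z0) > 0
      \<and> ell SY2 (mob A z0) > 0 \<and> ell SZ1 (mob A z0) > 0 \<and> ell SZ2 (mob A z0) > 0" and w: "wm w = A"
    have ev: "even (length w)" using A w det_wm[of w] by (cases "even (length w)") auto
    have "ell s (mob A z0) > 0" for s using A by (cases s) auto
    moreover have "wact w z0 = mob A z0" using wact_eq_mob[OF z0(1), of w] ev w by simp
    ultimately have "wact w z0 \<in> P" using wact_uhp[OF z0(1), of w] by (auto simp: P_def intro: less_imp_le)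
    moreover have "z0 \<in> P" using z0 by (auto simp: P_def intro: less_imp_le)
    ultimately obtain v where "weq v w" "\<forall>s\<in>set v. ell s z0 = 0" using fundamental_domain(2) by blast
    then have "weq [] w" using z0(2) by (cases v) (auto simp: less_le)
    then have "wm w = mat 1 \<or> wm w = - mat 1" using ev by (intro weq_Nil_imp_wm) (auto simp: weq_def)
    then show "A = mat 1" using A w by (auto simp: mat2_one_nth)
  qed
qed

text \<open>An infinite bounded set would contain a sequence converging to a limit that it never
  attains. Quotients of consecutive terms tend to 1, are again matrices of words, and so are
  eventually equal to 1; the sequence becomes constant, which is absurd.\<close>

lemma finite_wm_bounded: "finite {A \<in> range wm. norm A \<le> B}"
proof (rule ccontr)
  let ?S = "{A \<in> range wm. norm A \<le> B}"
  assume "infinite ?S"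
  then obtain L where "L islimpt ?S"
    using Heine_Borel_imp_Bolzano_Weierstrass[OF compact_cball[of "0::mat2" B], of ?S] by (auto simp: subset_iff)
  then obtain f where f: "\<And>n. f n \<in> ?S" "\<And>n. f n \<noteq> L" "f \<longlonglongrightarrow> L"
    unfolding islimpt_sequential by blast
  define g where "g n = det (f n) *\<^sub>R mat2_adj (f n)" for n :: nat
  have dt: "det (f n) * det (f n) = 1" for n
    using f(1)[of n] by (auto simp: det_wm simp flip: power_mult_distrib)
  have gf: "g n ** f n = mat 1" "f n ** g n = mat 1" for n
    using dt[of n] by (simp_all add: g_def mat2_adj_mult mat2_scaleR_mult)
  have lim: "(\<lambda>n. g n ** f (Suc n)) \<longlonglongrightarrow> (det L *\<^sub>R mat2_adj L) ** L"
    unfolding g_def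
    by (intro tendsto_mat2_mult tendsto_scaleR tendsto_mat2_det tendsto_mat2_adj f(3) LIMSEQ_Suc)
  have "(\<lambda>n. det (f n) * det (f n)) \<longlonglongrightarrow> det L * det L"
    by (intro tendsto_mult tendsto_mat2_det f(3))
  then have "det L * det L = 1" by (simp add: dt LIMSEQ_const_iff)
  then have "(det L *\<^sub>R mat2_adj L) ** L = mat 1"
    by (simp add: mat2_adj_mult mat2_scaleR_mult)
  then have "\<forall>\<^sub>F n in sequentially. \<forall>w. wm w = g n ** f (Suc n) \<longrightarrow> g n ** f (Suc n) = mat 1"
    using lim wm_near_one by (auto simp: filterlim_iff)
  then obtain N where N: "\<And>n. n \<ge> N \<Longrightarrow> \<forall>w. wm w = g n ** f (Suc n) \<longrightarrow> g n ** f (Suc n) = mat 1"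
    by (auto simp: eventually_sequentially)
  have step: "f (Suc n) = f n" if "n \<ge> N" for n
  proof -
    obtain v w where vw: "f n = wm v" "f (Suc n) = wm w" using f(1) by blast
    have "g n = g n ** (wm v ** wm (rev v))" by (simp add: wm_rev')
    also have "\<dots> = wm (rev v)" using gf(1)[of n] by (simp add: matrix_mul_assoc vw)
    finally have "wm (rev v @ w) = g n ** f (Suc n)" by (simp add: wm_append vw)
    then have "g n ** f (Suc n) = mat 1" using N[OF that] by blast
    then have "f n ** g n ** f (Suc n) = f n" by (simp flip: matrix_mul_assoc)
    then show ?thesis using gf by simp
  qed
  have "f n = f N" if "n \<ge> N" for n
    using that by (induction rule: dec_induct) (simp_all add: step)
  then have "f \<longlonglongrightarrow> f N"
    using tendsto_eventually[of f "f N" sequentially] unfolding eventually_sequentially by blast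
  then show False using f(2,3) LIMSEQ_unique by blast
qed

lemma finite_wm_h3: "finite {wm w | w. \<exists>z\<in>uhp. h3 z \<le> C \<and> h3 (wact w z) \<le> C}"
proof (rule finite_subset[OF _ finite_wm_bounded], rule subsetI)
  fix A assume "A \<in> {wm w | w. \<exists>z\<in>uhp. h3 z \<le> C \<and> h3 (wact w z) \<le> C}"
  then obtain w z where w: "A = wm w" "z \<in> uhp" "h3 z \<le> C" "h3 (wact w z) \<le> C" by blast
  have "\<bar>A$i$j\<bar> \<le> 2 * C + 8 * C ^ 3 + 4 * C\<^sup>2" for i j
    unfolding w(1)
    by (rule mob_entries_bounded[where z' = "if even (length w) then z else cnj z"])
      (use w wact_uhp[OF w(2), of w] in \<open>auto simp: det_wm wact_eq_mob\<close>)
  then show "A \<in> {A \<in> range wm. norm A \<le> 4 * (2 * C + 8 * C ^ 3 + 4 * C\<^sup>2)}"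
    using w(1) mat2_norm_le by blast
qed

text \<open>Choose an image of \<open>z\<close> closest to \<open>z0\<close>; properness leaves only
  finitely many candidate values. On the negative side of a wall, reflecting in that wall would
  bring it still closer.\<close>

lemma tiles_cover:
  assumes z: "z \<in> uhp"
  shows "\<exists>w. wact w z \<in> P"
proof -
  define C where "C = max (h3 z) (en z / (1 - (c + d) / 2))"
  let ?V = "{en (wact w z) | w. en (wact w z) \<le> en z}"
  let ?S = "{wm w | w. \<exists>z\<in>uhp. h3 z \<le> C \<and> h3 (wact w z) \<le> C}"
  \<comment> \<open>The sign of the determinant recovers the parity of the word, so the value of
    \<open>en\<close> depends on the matrix alone.\<close>
  have "?V \<subseteq> (\<lambda>A. en (mob A (if det A > 0 then z else cnj z))) ` ?S"
  proof
    fix v assume "v \<in> ?V"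
    then obtain w where w: "v = en (wact w z)" "en (wact w z) \<le> en z" by blast
    have "h3 (wact w z) \<le> en (wact w z) / (1 - (c + d) / 2)" by (intro h3_le_en wact_uhp z)
    also have "\<dots> \<le> en z / (1 - (c + d) / 2)" using w c d by (intro divide_right_mono) auto
    finally have "wm w \<in> ?S" using z by (auto simp: C_def intro!: exI[of _ w] bexI[of _ z])
    moreover have "det (wm w) > 0 \<longleftrightarrow> even (length w)" by (cases "even (length w)") (auto simp: det_wm)
    then have "v = en (mob (wm w) (if det (wm w) > 0 then z else cnj z))"
      using w(1) wact_eq_mob[OF z, of w] by simp
    ultimately show "v \<in> (\<lambda>A. en (mob A (if det A > 0 then z else cnj z))) ` ?S" by (rule rev_image_eqI)
  qed
  then have fin: "finite ?V" using finite_wm_h3 finite_subset by blast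
  have ne: "en z \<in> ?V" using wact_simps(1) by (metis (mono_tags, lifting) mem_Collect_eq order_refl)
  obtain w where w: "Min ?V = en (wact w z)" "en (wact w z) \<le> en z"
    using Min_in[OF fin] ne by blast
  have u: "wact w z \<in> uhp" using wact_uhp z by blast
  have "ell s (wact w z) \<ge> 0" for s
  proof (rule ccontr)
    assume "\<not> ell s (wact w z) \<ge> 0"
    then have "ell s (wact w z) * kap s < 0" using kap_pos[of s] by (simp add: mult_less_0_iff)
    moreover have "en (wact (s # w) z) = en (wact w z) + 2 * (ell s (wact w z) * kap s)"
      using en_act1[OF u, of s] by simp
    ultimately have l: "en (wact (s # w) z) < en (wact w z)" by linarith
    then have "en (wact (s # w) z) \<in> ?V" using w(2) by (smt (verit) mem_Collect_eq)
    then show False using Min_le[OF fin] l w(1) by fastforce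
  qed
  then show ?thesis using u by (auto simp: P_def)
qed

section \<open>The pentagon as a compact subset of the Klein disc\<close>

definition PK :: "(real \<times> real) set" where
  "PK = {(X, Y). 0 \<le> X \<and> X \<le> d \<and> 0 \<le> Y \<and> Y \<le> c \<and> d * X + c * Y \<le> 1}"

text \<open>From \<open>X * X \<le> d * X\<close> and \<open>Y * Y \<le> c * Y\<close> the squared
  radius is at most 1. Equality would put the point at a corner of the rectangle, and no corner lies
  on the unit circle.\<close>

lemma PK_disc: "(X, Y) \<in> PK \<Longrightarrow> X\<^sup>2 + Y\<^sup>2 < 1"
proof -
  assume p: "(X, Y) \<in> PK"
  have "X * X \<le> d * X" "Y * Y \<le> c * Y" using p by (auto simp: PK_def intro!: mult_right_mono)
  moreover have "d * X + c * Y \<le> 1" using p by (simp add: PK_def)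
  ultimately have le: "X\<^sup>2 + Y\<^sup>2 \<le> 1" and eq: "X\<^sup>2 + Y\<^sup>2 = 1 \<Longrightarrow> X * X = d * X \<and> Y * Y = c * Y"
    unfolding power2_eq_square by linarith+
  have "X\<^sup>2 + Y\<^sup>2 \<noteq> 1"
  proof
    assume 1: "X\<^sup>2 + Y\<^sup>2 = 1"
    then have "X = 0 \<or> X = d" "Y = 0 \<or> Y = c" using eq by auto
    moreover have "c\<^sup>2 < 1" "d\<^sup>2 < 1" using c d by (auto simp: abs_square_less_1)
    ultimately show False using 1 cd by auto
  qed
  then show ?thesis using le by simp
qed

lemma ell_ge_iff:
  assumes "z \<in> uhp"
  shows "ell SZ1 z \<ge> 0 \<longleftrightarrow> h1 z / h3 z \<ge> 0" "ell SY2 z \<ge> 0 \<longleftrightarrow> h2 z / h3 z \<ge> 0"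
    "ell SY1 z \<ge> 0 \<longleftrightarrow> h2 z / h3 z \<le> c" "ell SZ2 z \<ge> 0 \<longleftrightarrow> h1 z / h3 z \<le> d"
    "ell SX z \<ge> 0 \<longleftrightarrow> d * (h1 z / h3 z) + c * (h2 z / h3 z) \<le> 1"
    "ell SZ1 z = 0 \<longleftrightarrow> h1 z / h3 z = 0" "ell SY2 z = 0 \<longleftrightarrow> h2 z / h3 z = 0"
    "ell SY1 z = 0 \<longleftrightarrow> h2 z / h3 z = c" "ell SZ2 z = 0 \<longleftrightarrow> h1 z / h3 z = d"
    "ell SX z = 0 \<longleftrightarrow> d * (h1 z / h3 z) + c * (h2 z / h3 z) = 1"
proof -
  have h: "h3 z > 0" using h3_pos assms by blast
  have e: "ell SY1 z = al * (c * h3 z - h2 z)" "ell SZ2 z = ga * (d * h3 z - h1 z)"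
    "ell SX z = et * (h3 z - (d * h1 z + c * h2 z))" by (simp_all add: ell_def algebra_simps)
  have X: "d * (h1 z / h3 z) + c * (h2 z / h3 z) = (d * h1 z + c * h2 z) / h3 z"
    by (simp add: add_divide_distrib)
  show "ell SZ1 z \<ge> 0 \<longleftrightarrow> h1 z / h3 z \<ge> 0" "ell SY2 z \<ge> 0 \<longleftrightarrow> h2 z / h3 z \<ge> 0"
    "ell SZ1 z = 0 \<longleftrightarrow> h1 z / h3 z = 0" "ell SY2 z = 0 \<longleftrightarrow> h2 z / h3 z = 0"
    using h by (auto simp: ell_def zero_le_divide_iff)
  have pm: "0 \<le> k * t \<longleftrightarrow> 0 \<le> t" "k * t = 0 \<longleftrightarrow> t = 0" if "k > 0" for k t :: real
    using that by (auto simp: zero_le_mult_iff)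
  show "ell SY1 z \<ge> 0 \<longleftrightarrow> h2 z / h3 z \<le> c" "ell SZ2 z \<ge> 0 \<longleftrightarrow> h1 z / h3 z \<le> d"
    "ell SX z \<ge> 0 \<longleftrightarrow> d * (h1 z / h3 z) + c * (h2 z / h3 z) \<le> 1"
    unfolding e X pm(1)[OF coef_pos(1)] pm(1)[OF coef_pos(2)] pm(1)[OF coef_pos(3)] pos_divide_le_eq[OF h]
    by auto
  have dq: "x / h3 z = y \<longleftrightarrow> x = y * h3 z" for x y using h by (simp add: divide_eq_eq)
  show "ell SY1 z = 0 \<longleftrightarrow> h2 z / h3 z = c" "ell SZ2 z = 0 \<longleftrightarrow> h1 z / h3 z = d"
    "ell SX z = 0 \<longleftrightarrow> d * (h1 z / h3 z) + c * (h2 z / h3 z) = 1"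
    unfolding e X pm(2)[OF coef_pos(1)] pm(2)[OF coef_pos(2)] pm(2)[OF coef_pos(3)] dq by auto
qed

lemma P_iff: "z \<in> P \<longleftrightarrow> z \<in> uhp \<and> (h1 z / h3 z, h2 z / h3 z) \<in> PK"
proof -
  have "(\<forall>s. ell s z \<ge> 0) \<longleftrightarrow> ell SX z \<ge> 0 \<and> ell SY1 z \<ge> 0 \<and> ell SY2 z \<ge> 0 \<and> ell SZ1 z \<ge> 0 \<and> ell SZ2 z \<ge> 0"
    by (metis side.exhaust)
  then show ?thesis using ell_ge_iff[of z] by (auto simp: P_def PK_def)
qed

lemma P_eq_image: "P = (\<lambda>(X, Y). kinv X Y) ` PK"
proof
  show "P \<subseteq> (\<lambda>(X, Y). kinv X Y) ` PK"
    using kinv_klein(2) by (force simp: P_iff)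
  show "(\<lambda>(X, Y). kinv X Y) ` PK \<subseteq> P"
  proof clarify
    fix X Y assume p: "(X, Y) \<in> PK"
    note k = kinv[OF PK_disc[OF p]]
    have "sqrt (1 - X\<^sup>2 - Y\<^sup>2) > 0" using PK_disc[OF p] by simp
    then have "h1 (kinv X Y) / h3 (kinv X Y) = X" "h2 (kinv X Y) / h3 (kinv X Y) = Y"
      unfolding k by simp_all
    then show "kinv X Y \<in> P" using p k(1) by (simp add: P_iff)
  qed
qed

lemma compact_PK: "compact PK"
proof (rule compact_Int_closed[of "{0..d} \<times> {0..c}" "{p. d * fst p + c * snd p \<le> 1}", THEN back_subst[of compact]])
  show "compact ({0..d} \<times> {0..c})" by (intro compact_Times compact_Icc)
  show "closed {p. d * fst p + c * snd p \<le> 1}" by (intro closed_Collect_le continuous_intros)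
  show "{0..d} \<times> {0..c} \<inter> {p. d * fst p + c * snd p \<le> 1} = PK" by (auto simp: PK_def)
qed

lemma compact_P: "compact P"
  unfolding P_eq_image
proof (rule compact_continuous_image[OF _ compact_PK])
  have "1 + snd p \<noteq> 0" if "p \<in> PK" for p using that by (auto simp: PK_def)
  then show "continuous_on PK (\<lambda>(X, Y). kinv X Y)"
    unfolding kinv_def Complex_eq case_prod_beta by (intro continuous_intros) auto
qed

lemma P_subset_uhp: "P \<subseteq> uhp" by (auto simp: P_def)

lemma h3_bounded_on_compact:
  assumes "compact S" "S \<subseteq> uhp"
  shows "\<exists>C. \<forall>z\<in>S. h3 z \<le> C"
proof -
  have "compact (h3 ` S)"
    using assms continuous_on_h(3) continuous_on_subset compact_continuous_image by blast
  then have "bdd_above (h3 ` S)" by (intro bounded_imp_bdd_above compact_imp_bounded)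
  then show ?thesis by (auto simp: bdd_above_def)
qed

end

section \<open>The pentagon as an octant of the surface\<close>

context pentagon begin

text \<open>Abscissa of the corner between the sides \<open>Y = c\<close> and
  \<open>d X + c Y = 1\<close>.\<close>

definition X0 :: real where "X0 = (1 - c\<^sup>2) / d"

lemma X0: "0 < X0" "X0 < d" "d * X0 = 1 - c\<^sup>2"
proof -
  have "c\<^sup>2 < 1" using c by (auto simp: abs_square_less_1)
  then show "0 < X0" "d * X0 = 1 - c\<^sup>2" using d by (auto simp: X0_def)
  show "X0 < d" using d cd by (simp add: X0_def pos_divide_less_eq power2_eq_square)
qed

definition topY :: "real \<Rightarrow> real" where "topY X = min c ((1 - d * X) / c)"

text \<open>Increasing piecewise linear function with values -1/10, 0, 1/10 at 0, \<open>X0\<close>,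
  \<open>d\<close>; it becomes the value of the lemniscate function. The extreme levels are where
  \<open>S2\<close> meets z = 0, and level 0 passes through the origin, where the edges x = 0 and y
  = 0 meet.\<close>

definition lev :: "real \<Rightarrow> real" where
  "lev X = min (X - X0) 0 / (10 * X0) + max (X - X0) 0 / (10 * (d - X0))"

definition lev_inv :: "real \<Rightarrow> real" where
  "lev_inv g = X0 + 10 * X0 * min g 0 + 10 * (d - X0) * max g 0"

lemma lev_lev_inv: "lev (lev_inv g) = g"
proof (cases "g \<le> 0")
  case True
  then have "10 * X0 * g \<le> 0" using X0 by (simp add: mult_le_0_iff)
  then show ?thesis using True X0 by (simp add: lev_def lev_inv_def)
next
  case False
  then have "10 * (d - X0) * g \<ge> 0" using X0 by simp
  then show ?thesis using False X0 by (simp add: lev_def lev_inv_def)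
qed

lemma lev_inv_lev: "lev_inv (lev X) = X"
proof (cases "X \<le> X0")
  case True
  then have "(X - X0) / (10 * X0) \<le> 0" using X0 by (simp add: divide_le_0_iff)
  then show ?thesis using True X0 by (simp add: lev_def lev_inv_def field_simps)
next
  case False
  then have "(X - X0) / (10 * (d - X0)) \<ge> 0" using X0 by simp
  moreover have "(10 * (d - X0)) * ((X - X0) / (10 * (d - X0))) = X - X0" using X0 by simp
  ultimately show ?thesis using False X0 by (simp add: lev_def lev_inv_def)
qed

lemma lev_inj: "lev X = lev X' \<Longrightarrow> X = X'"
  using lev_inv_lev by metis

lemma lev_ends: "lev 0 = - 1/10" "lev d = 1/10" "lev X0 = 0"
  using X0 d by (simp_all add: lev_def)

lemma lev_le_0_iff: "lev X \<le> 0 \<longleftrightarrow> X \<le> X0"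
proof (cases "X \<le> X0")
  case True
  then show ?thesis using X0 by (simp add: lev_def divide_le_0_iff)
next
  case False
  then have "lev X > 0" using X0 by (simp add: lev_def)
  then show ?thesis using False by simp
qed

lemma lev_range: "0 \<le> X \<Longrightarrow> X \<le> d \<Longrightarrow> \<bar>lev X\<bar> \<le> 1/10"
  using X0 by (cases "X \<le> X0") (simp_all add: lev_def abs_le_iff divide_le_eq)

lemma lev_inv_range: "\<bar>g\<bar> \<le> 1/10 \<Longrightarrow> 0 \<le> lev_inv g \<and> lev_inv g \<le> d"
proof (cases "g \<le> 0")
  case True
  assume "\<bar>g\<bar> \<le> 1/10"
  then have "X0 * (-1) \<le> X0 * (10 * g)" using X0 by (intro mult_left_mono) auto
  moreover have "X0 * (10 * g) \<le> 0" using True X0 by (simp add: mult_le_0_iff)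
  moreover have "lev_inv g = X0 + X0 * (10 * g)" using True by (simp add: lev_inv_def)
  ultimately show ?thesis using X0 by linarith
next
  case False
  assume "\<bar>g\<bar> \<le> 1/10"
  then have "(d - X0) * (10 * g) \<le> (d - X0) * 1" using X0 by (intro mult_left_mono) auto
  moreover have "(d - X0) * (10 * g) \<ge> 0" using False X0 by simp
  moreover have "lev_inv g = X0 + (d - X0) * (10 * g)" using False by (simp add: lev_inv_def)
  ultimately show ?thesis using X0(1) by simp
qed

text \<open>With \<open>\<omega> = (x + \<i> y)\<^sup>2\<close> the lemniscate function is \<open>\<bar>\<omega> - 1/2\<bar>\<^sup>2 - 1/4\<close>, so an octant of \<open>S2\<close>
  is a half annulus \<open>\<omega> = 1/2 + rad \<cdot> e\<^bsup>\<i>\<phi>\<^esup>\<close>; \<open>ang\<close> is \<open>cos \<phi>\<close> and \<open>oN\<close> is \<open>\<bar>\<omega>\<bar>\<close>. The end \<open>\<phi> = \<pi>\<close>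
  is divided at \<open>\<omega> = 0\<close>, which is the corner \<open>X = X0\<close> of the pentagon.\<close>

definition rad :: "real \<Rightarrow> real" where "rad X = sqrt (lev X + 1/4)"
definition ang :: "real \<Rightarrow> real \<Rightarrow> real" where "ang X Y = 1 - 2 * Y / topY X"
definition oR :: "real \<Rightarrow> real \<Rightarrow> real" where "oR X Y = 1/2 + rad X * ang X Y"
definition oN :: "real \<Rightarrow> real \<Rightarrow> real" where "oN X Y = sqrt (1/4 + rad X * ang X Y + (rad X)\<^sup>2)"

text \<open>The square root x + \<i> y of \<omega> in the first quadrant, from x^2 + y^2 =
  \<open>oN\<close> and x^2 - y^2 = \<open>oR\<close>; the third coordinate then solves the equation
  of \<open>S2\<close>.\<close>

fun oct :: "axis \<Rightarrow> real \<times> real \<Rightarrow> real" where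
  "oct AX (X, Y) = sqrt ((oN X Y + oR X Y) / 2)"
| "oct AY (X, Y) = sqrt ((oN X Y - oR X Y) / 2)"
| "oct AZ (X, Y) = sqrt (1/100 - (lev X)\<^sup>2)"

lemma rad:
  assumes "\<bar>lev X\<bar> \<le> 1/10"
  shows "rad X > 0" "(rad X)\<^sup>2 = lev X + 1/4"
  using assms by (auto simp: rad_def abs_le_iff)

lemma topY_pos:
  assumes "0 \<le> X" "X \<le> d"
  shows "topY X > 0"
proof -
  have "d * X \<le> d * d" using assms d by (intro mult_left_mono) auto
  moreover have "d * d < 1" using d abs_square_less_1[of d] by (simp add: power2_eq_square)
  ultimately show ?thesis using c by (simp add: topY_def)
qed

lemma PK_iff: "(X, Y) \<in> PK \<longleftrightarrow> 0 \<le> X \<and> X \<le> d \<and> 0 \<le> Y \<and> Y \<le> topY X"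
  using c by (auto simp: PK_def topY_def pos_le_divide_eq algebra_simps)

lemma oN_sq:
  assumes "\<bar>lev X\<bar> \<le> 1/10" "\<bar>ang X Y\<bar> \<le> 1"
  shows "(oN X Y)\<^sup>2 = 1/4 + rad X * ang X Y + (rad X)\<^sup>2" "oN X Y \<ge> 0"
    "(oN X Y)\<^sup>2 - (oR X Y)\<^sup>2 = (rad X)\<^sup>2 * (1 - (ang X Y)\<^sup>2)" "\<bar>oR X Y\<bar> \<le> oN X Y"
proof -
  have "rad X * (- 1) \<le> rad X * ang X Y" using assms(2) rad(1)[OF assms(1)] by (intro mult_left_mono) auto
  \<comment> \<open>The radicand of \<open>oN\<close> at its minimum, where \<open>ang\<close> is
    -1.\<close>
  moreover have "(1/2 - rad X)\<^sup>2 = 1/4 - rad X + (rad X)\<^sup>2" by (simp add: power2_eq_square algebra_simps)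
  then have "1/4 - rad X + (rad X)\<^sup>2 \<ge> 0" by (metis zero_le_power2)
  ultimately have pos: "1/4 + rad X * ang X Y + (rad X)\<^sup>2 \<ge> 0" by linarith
  then show sq: "(oN X Y)\<^sup>2 = 1/4 + rad X * ang X Y + (rad X)\<^sup>2" and N: "oN X Y \<ge> 0"
    by (simp_all add: oN_def)
  show e: "(oN X Y)\<^sup>2 - (oR X Y)\<^sup>2 = (rad X)\<^sup>2 * (1 - (ang X Y)\<^sup>2)"
    unfolding sq oR_def by (simp add: power2_eq_square algebra_simps)
  have "(ang X Y)\<^sup>2 \<le> 1" using assms(2) by (simp add: abs_square_le_1)
  then have "(rad X)\<^sup>2 * (1 - (ang X Y)\<^sup>2) \<ge> 0" by simp
  then have "\<bar>oR X Y\<bar>\<^sup>2 \<le> (oN X Y)\<^sup>2" using e by simp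
  then show "\<bar>oR X Y\<bar> \<le> oN X Y" by (rule power2_le_imp_le) (rule N)
qed

lemma PK_bounds:
  assumes "(X, Y) \<in> PK"
  shows "\<bar>lev X\<bar> \<le> 1/10" "\<bar>ang X Y\<bar> \<le> 1" "topY X > 0"
proof -
  have p: "0 \<le> X" "X \<le> d" "0 \<le> Y" "Y \<le> topY X" using assms by (auto simp: PK_iff)
  show "topY X > 0" "\<bar>lev X\<bar> \<le> 1/10" using p topY_pos lev_range by auto
  then have "0 \<le> Y / topY X" "Y / topY X \<le> 1" using p by auto
  then show "\<bar>ang X Y\<bar> \<le> 1" by (simp add: ang_def abs_le_iff)
qed

lemma oct_nonneg: "p \<in> PK \<Longrightarrow> oct A p \<ge> 0"
proof -
  assume p: "p \<in> PK"
  obtain X Y where xy: "p = (X, Y)" by (cases p)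
  have "(lev X)\<^sup>2 \<le> (1/10)\<^sup>2"
    using PK_bounds(1)[of X Y] p xy power_mono[of "\<bar>lev X\<bar>" "1/10" 2] by simp
  then show ?thesis using PK_bounds[of X Y] oN_sq(4)[of X Y] p xy
    by (cases A) (auto simp: abs_le_iff power_divide)
qed

lemma oct_squares:
  assumes "(X, Y) \<in> PK"
  shows "(oct AX (X, Y))\<^sup>2 + (oct AY (X, Y))\<^sup>2 = oN X Y" "(oct AX (X, Y))\<^sup>2 - (oct AY (X, Y))\<^sup>2 = oR X Y"
    "(oN X Y)\<^sup>2 - oR X Y = lev X" "(oct AZ (X, Y))\<^sup>2 = 1/100 - (lev X)\<^sup>2"
proof -
  note b = PK_bounds[OF assms]
  have "(lev X)\<^sup>2 \<le> (1/10)\<^sup>2" using b(1) power_mono[of "\<bar>lev X\<bar>" "1/10" 2] by simp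
  then show "(oct AZ (X, Y))\<^sup>2 = 1/100 - (lev X)\<^sup>2" by (simp add: power_divide)
  show "(oct AX (X, Y))\<^sup>2 + (oct AY (X, Y))\<^sup>2 = oN X Y" "(oct AX (X, Y))\<^sup>2 - (oct AY (X, Y))\<^sup>2 = oR X Y"
    using oN_sq(4)[OF b(1,2)] by (auto simp: abs_le_iff add_divide_distrib diff_divide_distrib)
  show "(oN X Y)\<^sup>2 - oR X Y = lev X"
    unfolding oN_sq(1)[OF b(1,2)] oR_def using rad(2)[OF b(1)] by simp
qed

lemma oct_S2:
  assumes "p \<in> PK"
  shows "(oct AX p, oct AY p, oct AZ p) \<in> S2"
proof -
  obtain X Y where xy: "p = (X, Y)" by (cases p)
  note q = oct_squares[of X Y, folded xy, OF assms]
  have "((oct AX p)\<^sup>2 + (oct AY p)\<^sup>2)\<^sup>2 - (oct AX p)\<^sup>2 + (oct AY p)\<^sup>2 = (oN X Y)\<^sup>2 - oR X Y"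
    using q(1,2) by simp
  then show ?thesis using q(3,4) by (simp add: S2_def)
qed

text \<open>The first two coordinates determine \<bar>\<omega>\<bar> and the real part of \<omega>;
  these determine the level, hence \<open>X\<close>, and then the cosine, hence
  \<open>Y\<close>.\<close>

lemma oct_inj:
  assumes "p \<in> PK" "p' \<in> PK" "\<And>A. oct A p = oct A p'"
  shows "p = p'"
proof -
  obtain X Y X' Y' where xy: "p = (X, Y)" "p' = (X', Y')" by (cases p; cases p')
  note q = oct_squares[of X Y, folded xy, OF assms(1)] and q' = oct_squares[of X' Y', folded xy, OF assms(2)]
  have N: "oN X Y = oN X' Y'" "oR X Y = oR X' Y'" using q(1,2) q'(1,2) assms(3) by simp_all
  then have "lev X = lev X'" using q(3) q'(3) by simp
  then have X: "X = X'" by (rule lev_inj)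
  have b: "topY X > 0" "rad X > 0" using PK_bounds[of X Y] rad assms(1) xy by auto
  have "ang X Y = ang X Y'" using N(2) b by (simp add: oR_def X)
  then show ?thesis using b by (simp add: ang_def X xy)
qed

lemma oct_surj:
  assumes "(x, y, z) \<in> S2" "x \<ge> 0" "y \<ge> 0" "z \<ge> 0"
  obtains p where "p \<in> PK" "oct AX p = x" "oct AY p = y" "oct AZ p = z"
proof -
  define g where "g = (x\<^sup>2 + y\<^sup>2)\<^sup>2 - x\<^sup>2 + y\<^sup>2"
  have g: "g\<^sup>2 + z\<^sup>2 = 1/100" using assms by (simp add: S2_def g_def)
  then have "g\<^sup>2 \<le> 1/100" using zero_le_power2[of z] by linarith
  then have "\<bar>g\<bar>\<^sup>2 \<le> (1/10)\<^sup>2" by (simp add: power_divide)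
  then have g1: "\<bar>g\<bar> \<le> 1/10" by (rule power2_le_imp_le) simp
  define X where "X = lev_inv g"
  have X: "lev X = g" "0 \<le> X" "X \<le> d" using lev_lev_inv lev_inv_range[OF g1] by (auto simp: X_def)
  note r = rad[of X, unfolded X(1), OF g1] and t = topY_pos[OF X(2,3)]
  \<comment> \<open>The cosine of \<phi>. It is at most 1 in absolute value because the squared
    radius exceeds the squared real part of \<omega> - 1/2 by 4 x^2 y^2.\<close>
  define C where "C = (x\<^sup>2 - y\<^sup>2 - 1/2) / rad X"
  have "(x\<^sup>2 - y\<^sup>2 - 1/2)\<^sup>2 = (rad X)\<^sup>2 - 4 * (x\<^sup>2 * y\<^sup>2)"
    unfolding r(2) g_def by (simp add: power2_eq_square algebra_simps)
  then have "(x\<^sup>2 - y\<^sup>2 - 1/2)\<^sup>2 \<le> (rad X)\<^sup>2" by simp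
  then have "\<bar>x\<^sup>2 - y\<^sup>2 - 1/2\<bar>\<^sup>2 \<le> (rad X)\<^sup>2" by simp
  then have "\<bar>x\<^sup>2 - y\<^sup>2 - 1/2\<bar> \<le> rad X" by (rule power2_le_imp_le) (use r(1) in simp)
  then have C: "\<bar>C\<bar> \<le> 1" using r(1) by (simp add: C_def)
  define Y where "Y = (1 - C) / 2 * topY X"
  have "Y \<le> 1 * topY X" unfolding Y_def using C t by (intro mult_right_mono) auto
  moreover have "0 \<le> Y" using C t by (simp add: Y_def)
  ultimately have p: "(X, Y) \<in> PK" using X by (simp add: PK_iff)
  have a: "ang X Y = C" using t by (simp add: ang_def Y_def)
  have R: "oR X Y = x\<^sup>2 - y\<^sup>2" using r(1) by (simp add: oR_def a C_def)
  have "(oN X Y)\<^sup>2 = (x\<^sup>2 + y\<^sup>2)\<^sup>2"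
    using oct_squares(3)[OF p] R X(1) by (simp add: g_def)
  then have N: "oN X Y = x\<^sup>2 + y\<^sup>2"
    using oN_sq(2)[OF PK_bounds(1,2)[OF p]] by (simp add: power2_eq_iff_nonneg)
  have "oct AX (X, Y) = x" "oct AY (X, Y) = y" "oct AZ (X, Y) = z"
    using assms(2-4) g by (simp_all add: N R X(1) real_sqrt_unique algebra_simps)
  then show ?thesis using that p by blast
qed

text \<open>Here y = 0 means that \<omega> is real and nonnegative: \<open>ang = 1\<close>, or
  \<open>ang = -1\<close> with radius at most 1/2. Similarly x = 0 means \<open>ang = -1\<close>
  with radius at least 1/2. Radius 1/2 corresponds to \<open>X = X0\<close>, where the upper
  boundary \<open>topY\<close> changes from the side \<open>Y = c\<close> to the slanted
  side.\<close>

lemma oct_zero_iff: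
  assumes "(X, Y) \<in> PK"
  shows "oct AX (X, Y) = 0 \<longleftrightarrow> d * X + c * Y = 1" "oct AY (X, Y) = 0 \<longleftrightarrow> Y = 0 \<or> Y = c"
    "oct AZ (X, Y) = 0 \<longleftrightarrow> X = 0 \<or> X = d"
proof -
  note b = PK_bounds[OF assms]
  note r = rad[OF b(1)]
  have p: "0 \<le> X" "X \<le> d" "0 \<le> Y" "Y \<le> c" "d * X + c * Y \<le> 1" using assms by (auto simp: PK_def)
  have "oct AZ (X, Y) = 0 \<longleftrightarrow> (lev X)\<^sup>2 = (1/10)\<^sup>2" by (auto simp: power_divide)
  also have "\<dots> \<longleftrightarrow> lev X = lev 0 \<or> lev X = lev d" unfolding lev_ends power2_eq_iff by auto
  also have "\<dots> \<longleftrightarrow> X = 0 \<or> X = d" using lev_inj by blast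
  finally show "oct AZ (X, Y) = 0 \<longleftrightarrow> X = 0 \<or> X = d" .
  have a1: "ang X Y = 1 \<longleftrightarrow> Y = 0" "ang X Y = - 1 \<longleftrightarrow> Y = topY X"
    using b(3) by (auto simp: ang_def field_simps)
  have rl: "rad X \<le> 1/2 \<longleftrightarrow> X \<le> X0" "1/2 \<le> rad X \<longleftrightarrow> X0 \<le> X"
  proof -
    have "rad X \<le> 1/2 \<longleftrightarrow> (rad X)\<^sup>2 \<le> (1/2)\<^sup>2" using r(1) by (simp add: power2_le_iff_abs_le abs_le_square_iff[symmetric])
    then show "rad X \<le> 1/2 \<longleftrightarrow> X \<le> X0" unfolding r(2) lev_le_0_iff[symmetric] by (simp add: power_divide)
    have "1/2 \<le> rad X \<longleftrightarrow> (1/2)\<^sup>2 \<le> (rad X)\<^sup>2" using r(1) by (simp add: abs_le_square_iff[symmetric])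
    also have "\<dots> \<longleftrightarrow> 0 \<le> lev X" unfolding r(2) by (simp add: power_divide)
    also have "\<dots> \<longleftrightarrow> X0 \<le> X" using lev_le_0_iff[of X] lev_inj[of X X0] lev_ends(3) by (metis linorder_le_cases order_antisym order_refl)
    finally show "1/2 \<le> rad X \<longleftrightarrow> X0 \<le> X" .
  qed
  have pm: "(oN X Y)\<^sup>2 = (oR X Y)\<^sup>2 \<longleftrightarrow> ang X Y = 1 \<or> ang X Y = - 1"
  proof -
    have "(oN X Y)\<^sup>2 = (oR X Y)\<^sup>2 \<longleftrightarrow> (rad X)\<^sup>2 * (1 - (ang X Y)\<^sup>2) = 0"
      using oN_sq(3)[OF b(1,2)] by linarith
    also have "\<dots> \<longleftrightarrow> (ang X Y)\<^sup>2 = 1" using r(1) by simp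
    finally show ?thesis by (simp add: power2_eq_1_iff)
  qed
  have N0: "oN X Y \<ge> 0" using oN_sq(2)[OF b(1,2)] .
  have left: "Y = topY X \<and> X \<le> X0 \<longleftrightarrow> Y = c"
  proof
    assume "Y = topY X \<and> X \<le> X0"
    moreover have "d * X \<le> d * X0" if "X \<le> X0" using that d by (intro mult_left_mono) auto
    ultimately show "Y = c" using X0 c by (simp add: topY_def min_def pos_le_divide_eq power2_eq_square)
  next
    assume Y: "Y = c"
    then have "d * X \<le> d * X0" using p X0 by (simp add: power2_eq_square)
    then have "X \<le> X0" using d by simp
    moreover have "c \<le> (1 - d * X) / c" using p Y c by (simp add: pos_le_divide_eq)
    ultimately show "Y = topY X \<and> X \<le> X0" using Y by (simp add: topY_def)
  qed
  have right: "Y = topY X \<and> X0 \<le> X \<longleftrightarrow> d * X + c * Y = 1"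
  proof
    assume a: "Y = topY X \<and> X0 \<le> X"
    then have "d * X0 \<le> d * X" using d by (intro mult_left_mono) auto
    then have "(1 - d * X) / c \<le> c" using X0 c by (simp add: pos_divide_le_eq power2_eq_square)
    then have "Y = (1 - d * X) / c" using a by (simp add: topY_def)
    then show "d * X + c * Y = 1" using c by simp
  next
    assume e: "d * X + c * Y = 1"
    then have Y: "Y = (1 - d * X) / c" using c by (simp add: field_simps)
    then have "(1 - d * X) / c \<le> c" using p by simp
    then have "d * X0 \<le> d * X" using X0 c by (simp add: pos_divide_le_eq power2_eq_square)
    then have "X0 \<le> X" using d by simp
    then show "Y = topY X \<and> X0 \<le> X" using Y p by (simp add: topY_def)
  qed
  have "oct AY (X, Y) = 0 \<longleftrightarrow> oN X Y = oR X Y" by simp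
  also have "\<dots> \<longleftrightarrow> (oN X Y)\<^sup>2 = (oR X Y)\<^sup>2 \<and> oR X Y \<ge> 0"
    using N0 by (auto simp: power2_eq_iff)
  also have "\<dots> \<longleftrightarrow> ang X Y = 1 \<or> (ang X Y = - 1 \<and> rad X \<le> 1/2)"
    unfolding pm using r(1) by (auto simp: oR_def)
  also have "\<dots> \<longleftrightarrow> Y = 0 \<or> Y = c" unfolding a1 rl left[symmetric] ..
  finally show "oct AY (X, Y) = 0 \<longleftrightarrow> Y = 0 \<or> Y = c" .
  have "oct AX (X, Y) = 0 \<longleftrightarrow> oN X Y = - oR X Y" by auto
  also have "\<dots> \<longleftrightarrow> (oN X Y)\<^sup>2 = (oR X Y)\<^sup>2 \<and> oR X Y \<le> 0"
    using N0 by (auto simp: power2_eq_iff)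
  also have "\<dots> \<longleftrightarrow> ang X Y = - 1 \<and> 1/2 \<le> rad X"
    unfolding pm using r(1) by (auto simp: oR_def)
  also have "\<dots> \<longleftrightarrow> d * X + c * Y = 1" unfolding a1 rl right ..
  finally show "oct AX (X, Y) = 0 \<longleftrightarrow> d * X + c * Y = 1" .
qed

lemma continuous_on_oct: "continuous_on PK (oct A)"
proof -
  have t: "continuous_on PK (\<lambda>p. topY (fst p))"
    unfolding topY_def using c by (intro continuous_intros) auto
  have l: "continuous_on PK (\<lambda>p. lev (fst p))"
    unfolding lev_def using X0 by (intro continuous_intros) auto
  have r: "continuous_on PK (\<lambda>p. rad (fst p))"
    unfolding rad_def by (intro continuous_intros l)
  have a: "continuous_on PK (\<lambda>p. ang (fst p) (snd p))"
    unfolding ang_def using PK_bounds(3) by (intro continuous_intros t) (metis less_irrefl prod.collapse)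
  have R: "continuous_on PK (\<lambda>p. oR (fst p) (snd p))"
    unfolding oR_def by (intro continuous_intros r a)
  have N: "continuous_on PK (\<lambda>p. oN (fst p) (snd p))"
    unfolding oN_def by (intro continuous_intros r a)
  have "oct AX = (\<lambda>p. sqrt ((oN (fst p) (snd p) + oR (fst p) (snd p)) / 2))"
    "oct AY = (\<lambda>p. sqrt ((oN (fst p) (snd p) - oR (fst p) (snd p)) / 2))"
    "oct AZ = (\<lambda>p. sqrt (1/100 - (lev (fst p))\<^sup>2))" by auto
  then show ?thesis by (cases A) (auto intro!: continuous_intros R N l)
qed

section \<open>The octant map on the hyperbolic pentagon\<close>

definition foct :: "axis \<Rightarrow> complex \<Rightarrow> real" where
  "foct A z = oct A (h1 z / h3 z, h2 z / h3 z)"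

lemma foct_nonneg: "z \<in> P \<Longrightarrow> foct A z \<ge> 0"
  by (simp add: foct_def oct_nonneg P_iff del: oct.simps)

lemma foct_S2: "z \<in> P \<Longrightarrow> (foct AX z, foct AY z, foct AZ z) \<in> S2"
  by (simp add: foct_def oct_S2 P_iff del: oct.simps)

lemma foct_inj: "z \<in> P \<Longrightarrow> z' \<in> P \<Longrightarrow> (\<And>A. foct A z = foct A z') \<Longrightarrow> z = z'"
  unfolding foct_def P_iff using oct_inj kinv_klein(2) by (metis prod.inject)

lemma foct_surj:
  assumes "(x, y, z) \<in> S2" "x \<ge> 0" "y \<ge> 0" "z \<ge> 0"
  obtains p where "p \<in> P" "foct AX p = x" "foct AY p = y" "foct AZ p = z"
proof -
  obtain X Y where p: "(X, Y) \<in> PK" "oct AX (X, Y) = x" "oct AY (X, Y) = y" "oct AZ (X, Y) = z"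
    using oct_surj[OF assms] by (metis prod.collapse)
  have "sqrt (1 - X\<^sup>2 - Y\<^sup>2) > 0" using PK_disc[OF p(1)] by simp
  then have k: "h1 (kinv X Y) / h3 (kinv X Y) = X" "h2 (kinv X Y) / h3 (kinv X Y) = Y"
    unfolding kinv[OF PK_disc[OF p(1)]] by simp_all
  have "kinv X Y \<in> P" using p(1) P_eq_image by force
  then show ?thesis using that[of "kinv X Y"] p k by (simp add: foct_def)
qed

lemma foct_zero_iff:
  assumes "z \<in> P"
  shows "foct A z = 0 \<longleftrightarrow> (\<exists>s. axis_of s = A \<and> ell s z = 0)"
proof -
  have z: "z \<in> uhp" "(h1 z / h3 z, h2 z / h3 z) \<in> PK" using assms by (auto simp: P_iff)
  have ex: "(\<exists>s. Q s) \<longleftrightarrow> Q SX \<or> Q SY1 \<or> Q SZ1 \<or> Q SY2 \<or> Q SZ2" for Q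
    by (metis side.exhaust)
  show ?thesis
    unfolding foct_def ex using oct_zero_iff[OF z(2)] ell_ge_iff(6-10)[OF z(1)]
    by (cases A) auto
qed

lemma continuous_on_foct: "continuous_on P (foct A)"
  unfolding foct_def
proof (rule continuous_on_compose2[OF continuous_on_oct])
  have h: "continuous_on P h1" "continuous_on P h2" "continuous_on P h3"
    using continuous_on_h P_subset_uhp continuous_on_subset by blast+
  moreover have "h3 z \<noteq> 0" if "z \<in> P" for z using h3_pos[of z] that P_subset_uhp by auto
  ultimately show "continuous_on P (\<lambda>z. (h1 z / h3 z, h2 z / h3 z))"
    by (intro continuous_intros) auto
qed (auto simp: P_iff)

end

section \<open>The quotient surface\<close>

lemma matrix_inv_eq: "(A::mat2) ** B = mat 1 \<Longrightarrow> B ** A = mat 1 \<Longrightarrow> matrix_inv A = B"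
proof -
  assume AB: "A ** B = mat 1" "B ** A = mat 1"
  then have "A ** matrix_inv A = mat 1" unfolding matrix_inv_def by (metis (mono_tags, lifting) someI_ex)
  then have "B ** (A ** matrix_inv A) = B" by simp
  then show ?thesis using AB by (simp add: matrix_mul_assoc)
qed

context pentagon begin

definition sg :: "axis \<Rightarrow> side list \<Rightarrow> real" where "sg A w = (- 1) ^ cnt A w"

lemma sg_simps: "sg A (v @ w) = sg A v * sg A w" "sg A (rev w) = sg A w" "sg A w * sg A w = 1" "\<bar>sg A w\<bar> = 1" "sg A w \<noteq> 0"
  by (simp_all add: sg_def power_add power_abs flip: power_mult_distrib)

lemma sg_even: "even (cnt A w) \<Longrightarrow> sg A w = 1" "odd (cnt A w) \<Longrightarrow> sg A w = - 1"
  by (simp_all add: sg_def)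

definition qc :: "axis \<Rightarrow> complex \<Rightarrow> real" where
  "qc A z = (let w = SOME w. wact (rev w) z \<in> P in sg A w * foct A (wact (rev w) z))"

text \<open>Two words leading from \<open>z\<close> into \<open>P\<close> reach the same point
  \<open>p\<close> and differ by a word in walls through \<open>p\<close>. If coordinate
  \<open>A\<close> is nonzero at \<open>p\<close>, none of these walls has axis \<open>A\<close> and
  the signs agree; if it vanishes, the sign is immaterial.\<close>

lemma qc_tile:
  assumes z: "z \<in> uhp" and w: "wact (rev w) z \<in> P"
  shows "qc A z = sg A w * foct A (wact (rev w) z)"
proof -
  define v where "v = (SOME w. wact (rev w) z \<in> P)"
  have v: "wact (rev v) z \<in> P" unfolding v_def using w by (rule someI)
  define p where "p = wact (rev v) z"
  have e: "wact (rev w @ v) p = wact (rev w) z" using z by (simp add: p_def wact_rev')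
  have "wact (rev w @ v) p \<in> P" unfolding e by (rule w)
  from fundamental_domain[OF v[folded p_def] this] obtain u
    where pp: "wact (rev w) z = p" and u: "weq u (rev w @ v)" "\<forall>s\<in>set u. ell s p = 0"
    unfolding e by blast
  have "sg A v = sg A w" if nz: "foct A p \<noteq> 0"
  proof -
    have "\<forall>s \<in> set u. axis_of s \<noteq> A" using u(2) nz foct_zero_iff[OF v[folded p_def]] by blast
    then have "cnt A u = 0" by (simp add: cnt_def filter_empty_conv)
    then have "even (cnt A w + cnt A v)" using u(1) by (auto simp: weq_def)
    then show ?thesis by (cases "even (cnt A w)") (auto simp: sg_even)
  qed
  then show ?thesis unfolding qc_def v_def[symmetric] Let_def p_def[symmetric] pp by auto
qed

lemma qc_wact: "p \<in> P \<Longrightarrow> qc A (wact w p) = sg A w * foct A p"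
  using qc_tile[of "wact w p" w A] P_subset_uhp by (auto simp: wact_uhp wact_rev subset_iff)

definition qm :: "complex \<Rightarrow> real \<times> real \<times> real" where
  "qm z = (qc AX z, qc AY z, qc AZ z)"

lemma tile_obtain:
  assumes "z \<in> uhp"
  obtains w p where "p \<in> P" "z = wact w p"
proof -
  obtain w where "wact w z \<in> P" using tiles_cover assms by blast
  then show ?thesis using that[of "wact w z" "rev w"] assms by (simp add: wact_rev)
qed

lemma S2_abs: "(x, y, z) \<in> S2 \<Longrightarrow> (\<bar>x\<bar>, \<bar>y\<bar>, \<bar>z\<bar>) \<in> S2" and S2_sign:
  "(x, y, z) \<in> S2 \<Longrightarrow> \<bar>a\<bar> = 1 \<Longrightarrow> \<bar>b\<bar> = 1 \<Longrightarrow> \<bar>e\<bar> = 1 \<Longrightarrow> (a * x, b * y, e * z) \<in> S2"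
  by (auto simp: S2_def power_mult_distrib abs_eq_iff' power2_eq_1_iff)

lemma qm_S2: "z \<in> uhp \<Longrightarrow> qm z \<in> S2"
proof -
  assume "z \<in> uhp"
  then obtain w p where "p \<in> P" "z = wact w p" by (rule tile_obtain)
  then show ?thesis by (simp add: qm_def qc_wact S2_sign foct_S2 sg_simps)
qed

definition Gam :: "mat2 set" where
  "Gam = {wm w | w. \<forall>A. even (cnt A w)}"

lemma Gam_I: "(\<And>A. even (cnt A w)) \<Longrightarrow> wm w \<in> Gam"
  by (auto simp: Gam_def)

lemma Gam_D:
  assumes "g \<in> Gam"
  obtains w where "g = wm w" "\<And>A. even (cnt A w)" "even (length w)" "\<And>z. z \<in> uhp \<Longrightarrow> mob g z = wact w z"
proof -
  obtain w where w: "g = wm w" "\<forall>A. even (cnt A w)" using assms by (auto simp: Gam_def)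
  then have "even (length w)" by (simp add: length_eq_cnt)
  then show ?thesis using that w wact_eq_mob by simp
qed

lemma exists_word_with_parities:
  assumes "\<And>A. D A \<Longrightarrow> \<exists>s. axis_of s = A \<and> Q s"
  obtains u where "\<forall>s\<in>set u. Q s" "\<And>A. odd (cnt A u) \<longleftrightarrow> D A"
proof -
  obtain f where f: "\<And>A. D A \<Longrightarrow> axis_of (f A) = A \<and> Q (f A)" using assms by metis
  define u where "u = concat (map (\<lambda>A. if D A then [f A] else []) [AX, AY, AZ])"
  have "\<forall>s\<in>set u. Q s" using f by (auto simp: u_def)
  moreover have "odd (cnt A u) \<longleftrightarrow> D A" for A using f by (cases A) (auto simp: u_def)
  ultimately show ?thesis using that by blast
qed

lemma wact_fixed: "p \<in> uhp \<Longrightarrow> \<forall>s\<in>set u. ell s p = 0 \<Longrightarrow> wact u p = p"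
  by (induction u) (auto simp: act1_fixed)

text \<open>Equal images reduce both points to the same \<open>p\<close> in \<open>P\<close>, with
  signs differing only for coordinates that vanish at \<open>p\<close>. Each such coordinate has a
  wall through \<open>p\<close>; inserting these reflections fixes \<open>p\<close> and makes all
  parities even.\<close>

lemma qm_eq_iff:
  assumes "z \<in> uhp" "z' \<in> uhp"
  shows "qm z = qm z' \<longleftrightarrow> (\<exists>g\<in>Gam. mob g z = z')"
proof
  assume "\<exists>g\<in>Gam. mob g z = z'"
  then obtain u where u: "\<And>A. even (cnt A u)" "z' = wact u z" using Gam_D assms(1) by metis
  obtain w p where p: "p \<in> P" "z = wact w p" using assms(1) by (rule tile_obtain)
  have "qc A z' = qc A z" for A
    using qc_wact[OF p(1), of A "u @ w"] qc_wact[OF p(1), of A w] p(2) u by (simp add: sg_simps sg_even)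
  then show "qm z = qm z'" by (simp add: qm_def)
next
  assume q: "qm z = qm z'"
  obtain v p where p: "p \<in> P" "z = wact v p" using assms(1) by (rule tile_obtain)
  obtain w p' where p': "p' \<in> P" "z' = wact w p'" using assms(2) by (rule tile_obtain)
  have qe: "sg A v * foct A p = sg A w * foct A p'" for A
    using q by (cases A) (simp_all add: qm_def p p' qc_wact)
  have "foct A p = foct A p'" for A
    using arg_cong[OF qe[of A], of abs] foct_nonneg p p' by (simp add: abs_mult sg_simps)
  then have pp: "p' = p" using foct_inj p p' by metis
  have pu: "p \<in> uhp" using p P_subset_uhp by blast
  define D where "D A \<longleftrightarrow> odd (cnt A (v @ w))" for A
  have "\<exists>s. axis_of s = A \<and> ell s p = 0" if "D A" for A
  proof -
    have "sg A v = - sg A w" using that unfolding D_def by (cases "even (cnt A v)") (auto simp: sg_even)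
    then have "sg A w * foct A p = 0" using qe[of A] pp by simp
    then show ?thesis using foct_zero_iff[OF p(1)] sg_simps(5) by simp
  qed
  then obtain u where u: "\<forall>s\<in>set u. ell s p = 0" "\<And>A. odd (cnt A u) \<longleftrightarrow> D A"
    using exists_word_with_parities[of D "\<lambda>s. ell s p = 0"] by blast
  let ?w = "w @ u @ rev v"
  have ev: "\<forall>A. even (cnt A ?w)" using u(2) unfolding D_def by auto
  then have g: "wm ?w \<in> Gam" by (intro Gam_I) blast
  have "wact ?w z = z'" using pu by (simp add: p p' pp wact_rev wact_fixed[OF _ u(1)])
  moreover have "even (length ?w)" by (metis ev length_eq_cnt even_add)
  ultimately have "mob (wm ?w) z = z'" using wact_eq_mob[OF assms(1), of ?w] by simp
  then show "\<exists>g\<in>Gam. mob g z = z'" using g by blast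
qed

text \<open>One word per sign pattern, hence eight tiles that together cover
  \<open>S2\<close>.\<close>

definition sign_words :: "side list set" where
  "sign_words = range (\<lambda>(i, j, k). (if i then [SX] else []) @ (if j then [SY1] else []) @ (if k then [SZ1] else []))"

lemma qm_lift:
  assumes "(x, y, z) \<in> S2"
  obtains b p where "b \<in> sign_words" "p \<in> P" "qm (wact b p) = (x, y, z)"
proof -
  obtain p where p: "p \<in> P" "foct AX p = \<bar>x\<bar>" "foct AY p = \<bar>y\<bar>" "foct AZ p = \<bar>z\<bar>"
    using foct_surj[OF S2_abs[OF assms]] by auto
  let ?b = "(if x < 0 then [SX] else []) @ (if y < 0 then [SY1] else []) @ (if z < 0 then [SZ1] else [])"
  have "?b = (\<lambda>(i, j, k). (if i then [SX] else []) @ (if j then [SY1] else []) @ (if k then [SZ1] else [])) (x < 0, y < 0, z < 0)"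
    by simp
  moreover have "qm (wact ?b p) = (x, y, z)"
    by (auto simp: qm_def qc_wact[OF p(1)] p sg_def simp del: wact_simps)
  ultimately show ?thesis using that p(1) unfolding sign_words_def by blast
qed

section \<open>Continuity of the quotient map\<close>

lemma continuous_on_wact: "continuous_on uhp (wact w)"
proof (induction w)
  case Nil
  then show ?case by (simp add: continuous_on_id cong: continuous_on_cong)
next
  case (Cons s w)
  have "continuous_on uhp (act1 s)"
    unfolding act1_def mob_def
  proof (intro continuous_intros ballI)
    fix z assume "z \<in> uhp"
    then show "of_real (rm s $ 2 $ 1) * cnj z + of_real (rm s $ 2 $ 2) \<noteq> 0"
      using mob_denominator_nonzero[of "rm s" "cnj z"] uhpD[of z] det_rm[of s] by simp
  qed
  then have "continuous_on uhp (\<lambda>z. act1 s (wact w z))"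
    by (rule continuous_on_compose2[OF _ Cons.IH]) (auto intro: wact_uhp)
  then show ?case by simp
qed

definition tile :: "side list \<Rightarrow> complex set" where
  "tile w = {z \<in> uhp. wact (rev w) z \<in> P}"

lemma closedin_tile: "closedin (top_of_set uhp) (tile w)"
proof -
  have "tile w = uhp \<inter> wact (rev w) -` P" by (auto simp: tile_def)
  then show ?thesis
    using continuous_closedin_preimage[OF continuous_on_wact compact_imp_closed[OF compact_P]] by simp
qed

lemma wact_cong_wm: "wm v = wm w \<Longrightarrow> z \<in> uhp \<Longrightarrow> wact v z = wact w z"
proof -
  assume vw: "wm v = wm w" and z: "z \<in> uhp"
  have "(- 1 :: real) ^ length v = (- 1) ^ length w" using det_wm vw by metis
  then have "even (length v) = even (length w)" by (cases "even (length v)"; cases "even (length w)") auto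
  then show ?thesis using wact_eq_mob[OF z] vw by simp
qed

text \<open>\<open>h3\<close> is bounded on the compact set \<open>P\<close>, so a tile meeting the
  region \<open>h3 < h3 x + 1\<close> comes from a word moving one point of bounded
  \<open>h3\<close> to another, and properness applies.\<close>

lemma finite_tiles_near:
  assumes "x \<in> uhp"
  shows "\<exists>V. openin (top_of_set uhp) V \<and> x \<in> V \<and> finite {wm (rev w) | w. tile w \<inter> V \<noteq> {}}"
proof -
  obtain C where C: "\<And>z. z \<in> P \<Longrightarrow> h3 z \<le> C"
    using h3_bounded_on_compact[OF compact_P P_subset_uhp] by blast
  let ?V = "uhp \<inter> h3 -` {..<h3 x + 1}"
  let ?C = "max C (h3 x + 1)"
  have "openin (top_of_set uhp) ?V"
    by (intro continuous_openin_preimage_gen continuous_on_h) auto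
  moreover have "{wm (rev w) | w. tile w \<inter> ?V \<noteq> {}} \<subseteq> {wm w | w. \<exists>z\<in>uhp. h3 z \<le> ?C \<and> h3 (wact w z) \<le> ?C}"
  proof clarify
    fix w assume "tile w \<inter> ?V \<noteq> {}"
    then obtain z where z: "z \<in> uhp" "wact (rev w) z \<in> P" "h3 z < h3 x + 1" by (auto simp: tile_def)
    then have "h3 z \<le> ?C \<and> h3 (wact (rev w) z) \<le> ?C" using C[OF z(2)] by auto
    then show "\<exists>v. wm (rev w) = wm v \<and> (\<exists>z\<in>uhp. h3 z \<le> ?C \<and> h3 (wact v z) \<le> ?C)"
      using z(1) by blast
  qed
  then have "finite {wm (rev w) | w. tile w \<inter> ?V \<noteq> {}}" using finite_wm_h3 finite_subset by blast
  ultimately show ?thesis using assms by (intro exI[of _ ?V]) auto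
qed

text \<open>A tile and the formula for the quotient map on it depend only on the key of the word, and
  words with distinct keys give a locally finite family.\<close>

definition key :: "side list \<Rightarrow> mat2 \<times> bool \<times> bool \<times> bool" where
  "key w = (wm (rev w), even (cnt AX w), even (cnt AY w), even (cnt AZ w))"

definition rep :: "mat2 \<times> bool \<times> bool \<times> bool \<Rightarrow> side list" where
  "rep k = (SOME w. key w = k)"

lemma key_rep: "k \<in> range key \<Longrightarrow> key (rep k) = k"
  unfolding rep_def by (rule someI_ex) auto

lemma continuous_on_qm: "continuous_on uhp qm"
proof -
  let ?I = "rep ` range key"
  let ?f = "\<lambda>w z. (sg AX w * foct AX (wact (rev w) z), sg AY w * foct AY (wact (rev w) z), sg AZ w * foct AZ (wact (rev w) z))"
  have qf: "qm z = ?f w z" if "z \<in> tile w" for w z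
    using that qc_tile by (auto simp: qm_def tile_def)
  have "continuous_map (top_of_set uhp) euclidean qm"
  proof (rule pasting_lemma_locally_finite[where T = tile and I = ?I and f = ?f])
    fix x assume "x \<in> topspace (top_of_set uhp)"
    then obtain V where V: "openin (top_of_set uhp) V" "x \<in> V" "finite {wm (rev w) | w. tile w \<inter> V \<noteq> {}}"
      using finite_tiles_near by auto
    have "key ` {w \<in> ?I. tile w \<inter> V \<noteq> {}} \<subseteq> {wm (rev w) | w. tile w \<inter> V \<noteq> {}} \<times> UNIV"
      by (auto simp: key_def)
    then have "finite (key ` {w \<in> ?I. tile w \<inter> V \<noteq> {}})"
      using finite_cartesian_product[OF V(3) finite] by (rule finite_subset)
    moreover have "inj_on key ?I" by (auto simp: inj_on_def key_rep)
    then have "inj_on key {w \<in> ?I. tile w \<inter> V \<noteq> {}}" by (rule inj_on_subset) auto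
    ultimately have "finite {w \<in> ?I. tile w \<inter> V \<noteq> {}}" by (rule finite_imageD)
    then show "\<exists>V. openin (top_of_set uhp) V \<and> x \<in> V \<and> finite {w \<in> ?I. tile w \<inter> V \<noteq> {}}"
      using V by blast
  next
    fix w
    have "continuous_on (tile w) (\<lambda>z. foct A (wact (rev w) z))" for A
      by (rule continuous_on_compose2[OF continuous_on_foct])
        (auto simp: tile_def intro: continuous_on_subset[OF continuous_on_wact])
    then have "continuous_on (tile w) (?f w)" by (intro continuous_intros)
    moreover have "uhp \<inter> tile w = tile w" by (auto simp: tile_def)
    ultimately show "continuous_map (subtopology (top_of_set uhp) (tile w)) euclidean (?f w)"
      by (simp add: subtopology_subtopology)
  next
    fix x assume x: "x \<in> topspace (top_of_set uhp)"
    then obtain w where w: "wact (rev w) x \<in> P" using tiles_cover[of x] by (metis rev_rev_ident topspace_euclidean_subtopology)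
    let ?w = "rep (key w)"
    have "wm (rev ?w) = wm (rev w)" using key_rep[of "key w"] by (simp add: key_def)
    then have "wact (rev ?w) x = wact (rev w) x" by (rule wact_cong_wm) (use x in simp)
    then have "x \<in> tile ?w" using x w by (simp add: tile_def)
    then show "\<exists>j. j \<in> ?I \<and> x \<in> tile j \<and> qm x = ?f j x" using qf by blast
  next
    fix i j x assume "x \<in> topspace (top_of_set uhp) \<inter> tile i \<inter> tile j"
    then show "?f i x = ?f j x" using qf[of x i] qf[of x j] by simp
  qed (rule closedin_tile)
  then show ?thesis by simp
qed

text \<open>Eight tiles form a compact set \<open>F\<close> that maps onto \<open>S2\<close>. If the
  preimage of \<open>U\<close> is open, the part of \<open>F\<close> outside it is compact with
  image \<open>S2 - U\<close>, so this complement is closed.\<close>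

lemma quotient_map_qm: "quotient_map (top_of_set uhp) (top_of_set S2) qm"
  unfolding quotient_map_def
proof (intro conjI allI impI)
  define F where "F = (\<Union>b\<in>sign_words. wact b ` P)"
  have F: "compact F" "F \<subseteq> uhp"
    unfolding F_def sign_words_def using compact_P P_subset_uhp
    by (auto intro!: compact_UN compact_continuous_image continuous_on_subset[OF continuous_on_wact] wact_uhp)
  have FS: "\<exists>z\<in>F. qm z = s" if sS: "s \<in> S2" for s
  proof -
    obtain x y z where s: "s = (x, y, z)" by (cases s)
    obtain b p where "b \<in> sign_words" "p \<in> P" "qm (wact b p) = (x, y, z)"
      using qm_lift[of x y z] sS unfolding s by blast
    then have "wact b p \<in> F" unfolding F_def by blast
    then show ?thesis using \<open>qm (wact b p) = (x, y, z)\<close> s by blast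
  qed
  show "qm ` topspace (top_of_set uhp) = topspace (top_of_set S2)"
  proof
    show "qm ` topspace (top_of_set uhp) \<subseteq> topspace (top_of_set S2)" using qm_S2 by auto
    show "topspace (top_of_set S2) \<subseteq> qm ` topspace (top_of_set uhp)"
    proof
      fix s assume "s \<in> topspace (top_of_set S2)"
      then obtain z where "z \<in> F" "qm z = s" using FS[of s] by auto
      then show "s \<in> qm ` topspace (top_of_set uhp)" using F(2) by auto
    qed
  qed
  fix U assume U: "U \<subseteq> topspace (top_of_set S2)"
  have pre: "{x \<in> topspace (top_of_set uhp). qm x \<in> U} = uhp \<inter> qm -` U" by auto
  show "openin (top_of_set uhp) {x \<in> topspace (top_of_set uhp). qm x \<in> U} = openin (top_of_set S2) U"
    unfolding pre
  proof
    assume "openin (top_of_set S2) U"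
    then show "openin (top_of_set uhp) (uhp \<inter> qm -` U)"
      by (rule continuous_openin_preimage[OF continuous_on_qm _, rotated]) (use qm_S2 in auto)
  next
    assume o: "openin (top_of_set uhp) (uhp \<inter> qm -` U)"
    have "closedin (top_of_set uhp) (uhp - uhp \<inter> qm -` U)" using o by (intro closedin_diff) auto
    then obtain T where "closed T" "uhp - uhp \<inter> qm -` U = uhp \<inter> T" by (auto simp: closedin_closed)
    then have "F \<inter> T = F \<inter> (uhp - uhp \<inter> qm -` U)" using F by blast
    then have "compact (F \<inter> (uhp - uhp \<inter> qm -` U))" using F(1) \<open>closed T\<close> by (metis compact_Int_closed)
    then have "compact (qm ` (F \<inter> (uhp - uhp \<inter> qm -` U)))"
      by (intro compact_continuous_image continuous_on_subset[OF continuous_on_qm]) auto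
    moreover have "qm ` (F \<inter> (uhp - uhp \<inter> qm -` U)) = S2 - U"
    proof
      show "qm ` (F \<inter> (uhp - uhp \<inter> qm -` U)) \<subseteq> S2 - U" using qm_S2 by blast
      show "S2 - U \<subseteq> qm ` (F \<inter> (uhp - uhp \<inter> qm -` U))"
      proof
        fix s assume s: "s \<in> S2 - U"
        then obtain z where "z \<in> F" "qm z = s" using FS[of s] by blast
        then show "s \<in> qm ` (F \<inter> (uhp - uhp \<inter> qm -` U))" using F(2) s by blast
      qed
    qed
    ultimately have "closed (S2 - U)" using compact_imp_closed by metis
    then have "openin (top_of_set S2) (S2 \<inter> - (S2 - U))" by (intro openin_open_Int open_Compl)
    moreover have "S2 \<inter> - (S2 - U) = U" using U by auto
    ultimately show "openin (top_of_set S2) U" by simp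
  qed
qed

theorem genus2_structure_Gam: "genus2_structure Gam"
  unfolding genus2_structure_def
proof (intro conjI ballI impI)
  show "Gam \<subseteq> {A. det A = 1}" using det_wm by (auto elim!: Gam_D)
  show "mat 1 \<in> Gam" using Gam_I[of "[]"] by simp
  \<comment> \<open>The matrices of the orthogonal walls \<open>SZ1\<close> and \<open>SY2\<close>
    anticommute and have square 1, so their commutator word gives -1, with every letter used
    twice.\<close>
  have "wm [SZ1, SY2, SZ1, SY2] = - mat 1"
    by (simp add: mat2_eq_iff mat2_mult_nth mat2_one_nth rm_def reflm_nth)
  moreover have "wm [SZ1, SY2, SZ1, SY2] \<in> Gam" by (intro Gam_I) auto
  ultimately show "- mat 1 \<in> Gam" by (simp only:)
  fix g assume g: "g \<in> Gam"
  then obtain w where w: "g = wm w" "\<And>A. even (cnt A w)" "even (length w)" "\<And>z. z \<in> uhp \<Longrightarrow> mob g z = wact w z"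
    by (rule Gam_D) blast
  have "matrix_inv g = wm (rev w)" unfolding w(1) by (intro matrix_inv_eq wm_rev wm_rev')
  moreover have "wm (rev w) \<in> Gam" using w(2) by (intro Gam_I) simp
  ultimately show "matrix_inv g \<in> Gam" by simp
  show "g ** h \<in> Gam" if h: "h \<in> Gam" for h
  proof -
    obtain v where v: "h = wm v" "\<And>A. even (cnt A v)" using h by (rule Gam_D) blast
    have "wm (w @ v) \<in> Gam" using w(2) v(2) by (intro Gam_I) simp
    then show ?thesis by (simp add: w(1) v(1) wm_append)
  qed
  \<comment> \<open>Left multiplication by the inverse of \<open>g\<close> transports discreteness
    from 1 to \<open>g\<close>.\<close>
  have "((\<lambda>h. wm (rev w) ** h) \<longlongrightarrow> wm (rev w) ** g) (nhds g)"
    by (intro tendsto_mat2_mult tendsto_const filterlim_ident)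
  then have "filterlim (\<lambda>h. wm (rev w) ** h) (nhds (mat 1)) (nhds g)" by (simp add: w(1) wm_rev)
  then have "\<forall>\<^sub>F h in nhds g. \<forall>v. wm v = wm (rev w) ** h \<longrightarrow> wm (rev w) ** h = mat 1"
    using wm_near_one unfolding filterlim_iff by blast
  then obtain e where e: "e > 0" "\<And>h. dist h g < e \<Longrightarrow> \<forall>v. wm v = wm (rev w) ** h \<longrightarrow> wm (rev w) ** h = mat 1"
    unfolding eventually_nhds_metric by blast
  show "\<exists>e>0. \<forall>h\<in>Gam. dist h g < e \<longrightarrow> h = g"
  proof (intro exI[of _ e] conjI ballI impI e(1))
    fix h assume h: "h \<in> Gam" "dist h g < e"
    obtain v where v: "h = wm v" using h(1) by (rule Gam_D) blast
    have "wm (rev w @ v) = wm (rev w) ** h" by (simp add: v wm_append)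
    then have "wm (rev w) ** h = mat 1" using e(2)[OF h(2)] by blast
    then have "wm w ** (wm (rev w) ** h) = wm w" by simp
    then show "h = g" by (simp add: matrix_mul_assoc wm_rev' w(1))
  qed
  fix z assume z: "z \<in> uhp" and fx: "mob g z = z"
  obtain v p where p: "p \<in> P" "z = wact v p" using z by (rule tile_obtain)
  have pu: "p \<in> uhp" using p P_subset_uhp by blast
  \<comment> \<open>Conjugation moves the fixed point into \<open>P\<close>; the parities remain
    even, and the stabilizer statement applies at \<open>p\<close>.\<close>
  let ?u = "rev v @ w @ v"
  have "wact ?u p = wact (rev v) (wact w z)" by (simp add: p(2))
  also have "\<dots> = p" unfolding w(4)[OF z, symmetric] fx unfolding p(2) by (rule wact_rev[OF pu])
  finally have "wact ?u p = p" .
  then obtain u where u: "weq u ?u" "\<forall>s\<in>set u. ell s p = 0" using fundamental_domain(2)[OF p(1), of ?u] p(1) by auto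
  have "even (cnt A u)" for A using u(1) w(2)[of A] by (auto simp: weq_def)
  then have "wact ?u x = x" if "x \<in> uhp" for x
    using even_stabilizer_trivial[OF p(1) u(2)] u(1) that by (auto simp: weq_def)
  then have c: "wact (rev v) (wact w (wact v x)) = x" if "x \<in> uhp" for x using that by simp
  have "wact w x = x" if x: "x \<in> uhp" for x
  proof -
    have "wact (rev v) (wact w x) = wact (rev v) x"
      using c[of "wact (rev v) x"] x by (simp add: wact_rev' wact_uhp)
    then have "wact v (wact (rev v) (wact w x)) = wact v (wact (rev v) x)" by simp
    then show ?thesis using x by (simp add: wact_rev' wact_uhp)
  qed
  then show "g = mat 1 \<or> g = - mat 1" unfolding w(1) using w(3) by (rule weq_Nil_imp_wm)
next
  show "\<exists>q. quotient_map (top_of_set uhp) (top_of_set S2) q \<and>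
        (\<forall>z\<in>uhp. \<forall>w\<in>uhp. q z = q w \<longleftrightarrow> (\<exists>g\<in>Gam. mob g z = w))"
    using quotient_map_qm qm_eq_iff by blast
qed

end

section \<open>Quaternion algebras\<close>

text \<open>The element \<open>c0 + c1 i + c2 j + c3 ij\<close> for \<open>i = diag (\<surd>m, -\<surd>m)\<close> and \<open>j\<close> antidiagonal
  with entries \<open>\<surd>n\<close>.\<close>

definition quat :: "real \<Rightarrow> real \<Rightarrow> real \<Rightarrow> real \<Rightarrow> real \<Rightarrow> real \<Rightarrow> mat2" where
  "quat m n c0 c1 c2 c3 = c0 *\<^sub>R mat 1 + reflm (c1 * sqrt m) (c2 * sqrt n) (c3 * sqrt m * sqrt n)"

definition QA :: "real set \<Rightarrow> real \<Rightarrow> real \<Rightarrow> mat2 set" where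
  "QA K m n = {quat m n c0 c1 c2 c3 | c0 c1 c2 c3. c0 \<in> K \<and> c1 \<in> K \<and> c2 \<in> K \<and> c3 \<in> K}"

lemma quat_nth:
  "quat m n c0 c1 c2 c3 $1$1 = c0 + c1 * sqrt m" "quat m n c0 c1 c2 c3 $1$2 = c2 * sqrt n + c3 * sqrt m * sqrt n"
  "quat m n c0 c1 c2 c3 $2$1 = c2 * sqrt n - c3 * sqrt m * sqrt n" "quat m n c0 c1 c2 c3 $2$2 = c0 - c1 * sqrt m"
  by (simp_all add: quat_def reflm_nth mat2_one_nth)

lemma mat2_cayley_hamilton: "(A::mat2) ** A = trace A *\<^sub>R A - det A *\<^sub>R mat 1"
  by (simp add: mat2_eq_iff mat2_mult_nth mat2_one_nth det_2 trace_def sum_2 algebra_simps)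

lemma quat_add: "quat m n a0 a1 a2 a3 + quat m n b0 b1 b2 b3 = quat m n (a0 + b0) (a1 + b1) (a2 + b2) (a3 + b3)"
  by (simp add: mat2_eq_iff quat_nth algebra_simps)

lemma quat_scale: "k *\<^sub>R quat m n a0 a1 a2 a3 = quat m n (k * a0) (k * a1) (k * a2) (k * a3)"
  by (simp add: mat2_eq_iff quat_nth algebra_simps)

lemma quat_one: "mat 1 = quat m n 1 0 0 0"
  by (simp add: mat2_eq_iff quat_nth mat2_one_nth)

lemma quat_zero: "0 = quat m n 0 0 0 0"
  by (simp add: mat2_eq_iff quat_nth)

lemma quat_minus: "- quat m n a0 a1 a2 a3 = quat m n (- a0) (- a1) (- a2) (- a3)"
  by (simp add: mat2_eq_iff quat_nth)

lemma trace_quat: "trace (quat m n a0 a1 a2 a3) = 2 * a0"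
  by (simp add: trace_def sum_2 quat_nth)

lemma quat_mult:
  assumes "m \<ge> 0" "n \<ge> 0"
  shows "quat m n a0 a1 a2 a3 ** quat m n b0 b1 b2 b3 = quat m n
    (a0 * b0 + m * a1 * b1 + n * a2 * b2 - m * n * a3 * b3)
    (a0 * b1 + a1 * b0 - n * a2 * b3 + n * a3 * b2)
    (a0 * b2 + a2 * b0 + m * a1 * b3 - m * a3 * b1)
    (a0 * b3 + a3 * b0 + a1 * b2 - a2 * b1)"
proof -
  obtain u v where uv: "u = sqrt m" "v = sqrt n" by blast
  have mn: "m = u * u" "n = v * v" using assms uv by auto
  show ?thesis
    unfolding mat2_eq_iff mat2_mult_nth quat_nth uv[symmetric] unfolding mn
    by (simp add: algebra_simps)
qed

lemma quat_eq_0_iff: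
  assumes "m > 0" "n > 0"
  shows "quat m n a0 a1 a2 a3 = 0 \<longleftrightarrow> a0 = 0 \<and> a1 = 0 \<and> a2 = 0 \<and> a3 = 0"
proof
  assume "quat m n a0 a1 a2 a3 = 0"
  then have e: "a0 + a1 * sqrt m = 0" "a0 - a1 * sqrt m = 0"
     "(a2 + a3 * sqrt m) * sqrt n = 0" "(a2 - a3 * sqrt m) * sqrt n = 0"
    unfolding mat2_eq_iff quat_nth by (auto simp: algebra_simps)
  have "a0 = 0" using e(1,2) by linarith
  moreover have "a1 = 0" using e(1) assms \<open>a0 = 0\<close> by simp
  moreover have "a2 + a3 * sqrt m = 0" "a2 - a3 * sqrt m = 0" using e(3,4) assms by auto
  then have "a2 = 0" by linarith
  moreover have "a3 = 0" using \<open>a2 + a3 * sqrt m = 0\<close> \<open>a2 = 0\<close> assms by simp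
  ultimately show "a0 = 0 \<and> a1 = 0 \<and> a2 = 0 \<and> a3 = 0" by simp
qed (simp add: quat_zero[symmetric])

lemma QA_I: "c0 \<in> K \<Longrightarrow> c1 \<in> K \<Longrightarrow> c2 \<in> K \<Longrightarrow> c3 \<in> K \<Longrightarrow> quat m n c0 c1 c2 c3 \<in> QA K m n"
  unfolding QA_def by blast

lemma QA_E:
  assumes "x \<in> QA K m n"
  obtains c0 c1 c2 c3 where "x = quat m n c0 c1 c2 c3" "c0 \<in> K" "c1 \<in> K" "c2 \<in> K" "c3 \<in> K"
  using assms unfolding QA_def by blast

lemma QA_closed:
  assumes K: "subfield_R K" and mn: "m \<in> K" "n \<in> K" "m \<ge> 0" "n \<ge> 0"
  shows "0 \<in> QA K m n" "x \<in> QA K m n \<Longrightarrow> y \<in> QA K m n \<Longrightarrow> x + y \<in> QA K m n"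
    "x \<in> QA K m n \<Longrightarrow> y \<in> QA K m n \<Longrightarrow> x ** y \<in> QA K m n"
    "x \<in> QA K m n \<Longrightarrow> k \<in> K \<Longrightarrow> k *\<^sub>R x \<in> QA K m n"
    "x \<in> QA K m n \<Longrightarrow> trace x \<in> K" "mat 1 \<in> QA K m n"
proof -
  note i = subfield_R_intros[OF K]
  show "0 \<in> QA K m n" "mat 1 \<in> QA K m n"
    using i(1,2) unfolding quat_zero[of m n] quat_one[of m n] by (auto intro: QA_I)
  assume x: "x \<in> QA K m n"
  then obtain a0 a1 a2 a3 where a: "x = quat m n a0 a1 a2 a3" "a0 \<in> K" "a1 \<in> K" "a2 \<in> K" "a3 \<in> K" by (rule QA_E)
  show "trace x \<in> K" using a i by (simp add: trace_quat)
  show "k *\<^sub>R x \<in> QA K m n" if "k \<in> K" using a i(4) that by (auto simp: quat_scale intro!: QA_I)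
  {
    assume "y \<in> QA K m n"
    then obtain b0 b1 b2 b3 where b: "y = quat m n b0 b1 b2 b3" "b0 \<in> K" "b1 \<in> K" "b2 \<in> K" "b3 \<in> K" by (rule QA_E)
    show "x + y \<in> QA K m n" using a b i(3) by (auto simp: quat_add intro!: QA_I)
    show "x ** y \<in> QA K m n"
      unfolding a(1) b(1) quat_mult[OF mn(3,4)] using a b mn by (intro QA_I i)
  }
qed

text \<open>Prepares the passage to the basis 1, i, ij/m and a multiple of j, in either order of the
  two generators.\<close>

lemma QA_reparametrize:
  assumes K: "subfield_R K" and st: "s \<in> K" "t \<in> K" "s \<noteq> 0" "t \<noteq> 0"
  shows "QA K m n = {quat m n c0 c1 (c3 * s) (c2 * t) | c0 c1 c2 c3. c0 \<in> K \<and> c1 \<in> K \<and> c2 \<in> K \<and> c3 \<in> K}"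
    "QA K m n = {quat m n c0 c2 (c3 * s) (c1 * t) | c0 c1 c2 c3. c0 \<in> K \<and> c1 \<in> K \<and> c2 \<in> K \<and> c3 \<in> K}"
    (is "_ = ?B")
proof -
  let ?A = "{quat m n c0 c1 (c3 * s) (c2 * t) | c0 c1 c2 c3. c0 \<in> K \<and> c1 \<in> K \<and> c2 \<in> K \<and> c3 \<in> K}"
  have "x \<in> ?A \<and> x \<in> ?B" if x: "x \<in> QA K m n" for x
  proof -
    obtain c0 c1 c2 c3 where c: "x = quat m n c0 c1 c2 c3" "c0 \<in> K" "c1 \<in> K" "c2 \<in> K" "c3 \<in> K"
      using x by (rule QA_E)
    have "x = quat m n c0 c1 ((c2 / s) * s) ((c3 / t) * t)" using c(1) st by simp
    moreover have "c2 / s \<in> K" "c3 / t \<in> K" using c st K by (auto intro: subfield_R_divide)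
    ultimately show ?thesis using c(2,3) by blast
  qed
  moreover have "?A \<subseteq> QA K m n" "?B \<subseteq> QA K m n"
    using st subfield_R_D(4)[OF K] by (auto intro!: QA_I)
  ultimately show "QA K m n = ?A" "QA K m n = ?B" by blast+
qed

text \<open>The generators i and ij/m anticommute, have squares \<open>m\<close> and
  \<open>- (n / m)\<close>, and multiply to j or -j.\<close>

lemma quat_iso_QA:
  assumes K: "subfield_R K" and mn: "m \<in> K" "n \<in> K" "m > 0" "n > 0"
  shows "quat_iso K m n (QA K m n)" "quat_iso K m (- (n / m)) (QA K m n)" "quat_iso K (- (n / m)) m (QA K m n)"
proof -
  note i = subfield_R_intros[OF K]
  note q = quat_mult[OF less_imp_le[OF mn(3)] less_imp_le[OF mn(4)]] quat_add quat_scale quat_one[of m n] quat_minus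
  show "quat_iso K m n (QA K m n)"
    unfolding quat_iso_def
    by (rule exI[of _ "quat m n 0 1 0 0"], rule exI[of _ "quat m n 0 0 1 0"])
      (use i(1,2) in \<open>auto simp: q QA_I quat_eq_0_iff[OF mn(3,4)] QA_def\<close>)
  have s: "quat m n 0 1 0 0 ** quat m n 0 0 0 (1 / m) = quat m n 0 0 1 0"
    "quat m n 0 0 0 (1 / m) ** quat m n 0 1 0 0 = quat m n 0 0 (- 1) 0"
    "quat m n 0 1 0 0 ** quat m n 0 1 0 0 = m *\<^sub>R mat 1"
    "quat m n 0 0 0 (1 / m) ** quat m n 0 0 0 (1 / m) = (- (n / m)) *\<^sub>R mat 1"
    "- quat m n 0 0 (-1) 0 = quat m n 0 0 1 0" "- quat m n 0 0 1 0 = quat m n 0 0 (-1) 0"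
    using mn by (simp_all add: q)
  have mem: "quat m n 0 1 0 0 \<in> QA K m n" "quat m n 0 0 0 (1 / m) \<in> QA K m n"
    using i mn by (auto intro!: QA_I)
  have comb: "c0 *\<^sub>R mat 1 + c1 *\<^sub>R quat m n 0 1 0 0 + c2 *\<^sub>R quat m n 0 0 0 (1 / m) + c3 *\<^sub>R quat m n 0 0 k 0
      = quat m n c0 c1 (c3 * k) (c2 * (1 / m))"
    "c0 *\<^sub>R mat 1 + c1 *\<^sub>R quat m n 0 0 0 (1 / m) + c2 *\<^sub>R quat m n 0 1 0 0 + c3 *\<^sub>R quat m n 0 0 k 0
      = quat m n c0 c2 (c3 * k) (c1 * (1 / m))" for c0 c1 c2 c3 k
    by (simp_all add: q)
  have m1: "1 / m \<in> K" "1 / m \<noteq> 0" using i mn by auto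
  show "quat_iso K m (- (n / m)) (QA K m n)"
    unfolding quat_iso_def
  proof (rule exI[of _ "quat m n 0 1 0 0"], rule exI[of _ "quat m n 0 0 0 (1 / m)"], unfold s comb, intro conjI mem refl)
    show "QA K m n = {quat m n c0 c1 (c3 * 1) (c2 * (1 / m)) | c0 c1 c2 c3. c0 \<in> K \<and> c1 \<in> K \<and> c2 \<in> K \<and> c3 \<in> K}"
      by (rule QA_reparametrize(1)[OF K i(2) m1(1) _ m1(2)]) simp
  qed (use mn(3) in \<open>auto simp: quat_eq_0_iff[OF mn(3,4)]\<close>)
  show "quat_iso K (- (n / m)) m (QA K m n)"
    unfolding quat_iso_def
  proof (rule exI[of _ "quat m n 0 0 0 (1 / m)"], rule exI[of _ "quat m n 0 1 0 0"], unfold s comb, intro conjI mem refl)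
    show "QA K m n = {quat m n c0 c2 (c3 * - 1) (c1 * (1 / m)) | c0 c1 c2 c3. c0 \<in> K \<and> c1 \<in> K \<and> c2 \<in> K \<and> c3 \<in> K}"
      by (rule QA_reparametrize(2)[OF K i(5)[OF i(2)] m1(1) _ m1(2)]) simp
  qed (use mn(3) in \<open>auto simp: quat_eq_0_iff[OF mn(3,4)]\<close>)
qed

section \<open>Spans and generated algebras of a group in a quaternion algebra\<close>

lemma lin_span_scale_gen: "c \<in> F \<Longrightarrow> g \<in> G \<Longrightarrow> c *\<^sub>R g \<in> lin_span F G"
  using lin_span.add[OF lin_span.zero, of c F g G] by simp

lemma lin_span_plus: "x \<in> lin_span F G \<Longrightarrow> y \<in> lin_span F G \<Longrightarrow> x + y \<in> lin_span F G"
  by (induction rule: lin_span.induct) (auto simp: add.assoc intro: lin_span.add)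

lemma lin_span_least:
  assumes "0 \<in> T" "\<And>x y. x \<in> T \<Longrightarrow> y \<in> T \<Longrightarrow> x + y \<in> T" "\<And>c g. c \<in> F \<Longrightarrow> g \<in> G \<Longrightarrow> c *\<^sub>R g \<in> T"
  shows "lin_span F G \<subseteq> T"
proof
  fix x assume "x \<in> lin_span F G"
  then show "x \<in> T" by induction (use assms in auto)
qed

lemma alg_gen_least:
  assumes "S \<subseteq> T" "\<And>x y. x \<in> T \<Longrightarrow> y \<in> T \<Longrightarrow> x + y \<in> T" "\<And>x y. x \<in> T \<Longrightarrow> y \<in> T \<Longrightarrow> x ** y \<in> T"
    "\<And>c x. c \<in> F \<Longrightarrow> x \<in> T \<Longrightarrow> c *\<^sub>R x \<in> T"
  shows "alg_gen F S \<subseteq> T"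
proof
  fix x assume "x \<in> alg_gen F S"
  then show "x \<in> T" by induction (use assms in auto)
qed

text \<open>The products 1, g, h, gh form a basis over \<open>K\<close> because \<beta> and \<delta>
  are nonzero. For the invariant algebra, Cayley-Hamilton with determinant 1 gives
  \<open>g = (g^2 + 1) / trace g\<close>, so g and h are recovered from squares, their traces being
  nonzero.\<close>

lemma quaternion_algebra_of_group:
  assumes K: "subfield_R K" and mn: "m \<in> K" "n \<in> K" "m > 0" "n > 0"
    and p: "\<alpha> \<in> K" "\<beta> \<in> K" "\<gamma> \<in> K" "\<delta> \<in> K" "\<alpha> \<noteq> 0" "\<beta> \<noteq> 0" "\<gamma> \<noteq> 0" "\<delta> \<noteq> 0"
    and norm: "\<alpha>\<^sup>2 - m * \<beta>\<^sup>2 = 1" "\<gamma>\<^sup>2 - n * \<delta>\<^sup>2 = 1"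
    and prim: "gen_field {\<alpha>\<^sup>2} = K"
    and G: "G \<subseteq> QA K m n" "mat 1 \<in> G" "\<And>g h. g \<in> G \<Longrightarrow> h \<in> G \<Longrightarrow> g ** h \<in> G"
    and g: "quat m n (- \<alpha>) \<beta> 0 0 \<in> G" and h: "quat m n (- \<gamma>) 0 \<delta> 0 \<in> G"
  shows "trace_field G = K" "inv_trace_field G = K" "quat_alg G = QA K m n" "inv_quat_alg G = QA K m n"
proof -
  note i = subfield_R_intros[OF K]
  note q = quat_mult[OF less_imp_le[OF mn(3)] less_imp_le[OF mn(4)]] quat_add quat_scale quat_one[of m n] quat_minus
  note cl = QA_closed[OF K mn(1,2) less_imp_le[OF mn(3)] less_imp_le[OF mn(4)]]
  let ?g = "quat m n (- \<alpha>) \<beta> 0 0" and ?h = "quat m n (- \<gamma>) 0 \<delta> 0"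
  \<comment> \<open>This trace occurs in both generating sets: as the trace of an element of
    \<open>G\<close> and as the trace of a square.\<close>
  have F: "K \<subseteq> gen_field T" if "trace (?g ** ?g) \<in> T" for T
  proof -
    note f = subfield_R_intros[OF subfield_R_gen_field[of T]]
    have "m * \<beta>\<^sup>2 = \<alpha>\<^sup>2 - 1" using norm by simp
    then have "trace (?g ** ?g) = 4 * \<alpha>\<^sup>2 - 2" by (simp add: q trace_quat power2_eq_square)
    then have "4 * \<alpha>\<^sup>2 - 2 \<in> gen_field T" using that gen_field_superset[of T] by auto
    then have "((4 * \<alpha>\<^sup>2 - 2) + 2) / 4 \<in> gen_field T" by (rule f(8)[OF f(3)[OF _ f(12)] f(12)])
    then have "gen_field {\<alpha>\<^sup>2} \<subseteq> gen_field T" by (intro gen_field_least subfield_R_gen_field) simp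
    then show ?thesis using prim by simp
  qed
  show tf: "trace_field G = K"
    unfolding trace_field_def
  proof
    show "gen_field {trace g |g. g \<in> G} \<subseteq> K" using cl(5) G(1) K by (intro gen_field_least) auto
    show "K \<subseteq> gen_field {trace g |g. g \<in> G}" by (rule F) (use G(3)[OF g g] in blast)
  qed
  show itf: "inv_trace_field G = K"
    unfolding inv_trace_field_def
  proof
    show "gen_field {trace (g ** g) |g. g \<in> G} \<subseteq> K" using cl(3,5) G(1) K by (intro gen_field_least) blast+
    show "K \<subseteq> gen_field {trace (g ** g) |g. g \<in> G}" by (rule F) (use g in blast)
  qed
  have QA_sub: "QA K m n \<subseteq> T"
    if T: "\<And>x y. x \<in> T \<Longrightarrow> y \<in> T \<Longrightarrow> x + y \<in> T"
      "\<And>c x. c \<in> K \<Longrightarrow> x \<in> {mat 1, ?g, ?h, ?g ** ?h} \<Longrightarrow> c *\<^sub>R x \<in> T" for T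
  proof
    fix x assume "x \<in> QA K m n"
    then obtain c0 c1 c2 c3 where c: "x = quat m n c0 c1 c2 c3" "c0 \<in> K" "c1 \<in> K" "c2 \<in> K" "c3 \<in> K" by (rule QA_E)
    \<comment> \<open>The product gh has coordinates \<alpha>\<gamma>, -\<beta>\<gamma>,
      -\<alpha>\<delta>, \<beta>\<delta>, so the system is triangular and is solved from the last
      coordinate upwards.\<close>
    define k3 where "k3 = c3 / (\<beta> * \<delta>)"
    define k2 where "k2 = (c2 + k3 * \<alpha> * \<delta>) / \<delta>"
    define k1 where "k1 = (c1 + k3 * \<beta> * \<gamma>) / \<beta>"
    define k0 where "k0 = c0 + k1 * \<alpha> + k2 * \<gamma> - k3 * \<alpha> * \<gamma>"
    have "k3 \<in> K" unfolding k3_def using c p by (intro i)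
    moreover from this have "k2 \<in> K" "k1 \<in> K" unfolding k2_def k1_def using c p by (simp_all add: i)
    moreover from calculation have "k0 \<in> K" unfolding k0_def using c p by (simp add: i)
    ultimately have kK: "k0 \<in> K" "k1 \<in> K" "k2 \<in> K" "k3 \<in> K" by auto
    have "k0 *\<^sub>R mat 1 + k1 *\<^sub>R ?g + k2 *\<^sub>R ?h + k3 *\<^sub>R (?g ** ?h) = quat m n
        (k0 - k1 * \<alpha> - k2 * \<gamma> + k3 * \<alpha> * \<gamma>) (k1 * \<beta> - k3 * \<beta> * \<gamma>) (k2 * \<delta> - k3 * \<alpha> * \<delta>) (k3 * (\<beta> * \<delta>))"
      by (simp add: q mult.assoc)
    also have "\<dots> = x"
    proof -
      have "k3 * (\<beta> * \<delta>) = c3" using p(6,8) by (simp add: k3_def)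
      moreover have "k2 * \<delta> = c2 + k3 * \<alpha> * \<delta>" using p(8) by (simp add: k2_def)
      moreover have "k1 * \<beta> = c1 + k3 * \<beta> * \<gamma>" using p(6) by (simp add: k1_def)
      moreover have "k0 - k1 * \<alpha> - k2 * \<gamma> + k3 * \<alpha> * \<gamma> = c0" by (simp add: k0_def)
      ultimately show ?thesis by (simp only: c(1) add_diff_cancel_right')
    qed
    finally have "x = k0 *\<^sub>R mat 1 + k1 *\<^sub>R ?g + k2 *\<^sub>R ?h + k3 *\<^sub>R (?g ** ?h)" ..
    also have "\<dots> \<in> T" using kK by (intro T(1) T(2)) auto
    finally show "x \<in> T" .
  qed
  show "quat_alg G = QA K m n"
    unfolding quat_alg_def tf
  proof
    show "lin_span K G \<subseteq> QA K m n" using cl(1,2,4) G(1) by (intro lin_span_least) auto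
    show "QA K m n \<subseteq> lin_span K G"
      using g h G(2) G(3)[OF g h] by (intro QA_sub lin_span_plus lin_span_scale_gen) auto
  qed
  show "inv_quat_alg G = QA K m n"
    unfolding inv_quat_alg_def itf
  proof
    let ?T = "alg_gen K {g ** g |g. g \<in> G}"
    show "?T \<subseteq> QA K m n"
      by (rule alg_gen_least) (use cl(2,3,4) G(1) in auto)
    have sq: "x ** x \<in> ?T" if "x \<in> G" for x using that by (intro alg_gen.gen) blast
    have 1: "mat 1 \<in> ?T" using sq[OF G(2)] by simp
    have x: "x \<in> ?T" if "x \<in> G" "det x = 1" "trace x \<noteq> 0" for x
    proof -
      have "trace x \<in> K" using cl(5) G(1) that(1) by blast
      then have "1 / trace x \<in> K" by (intro i(2,8))
      then have "(1 / trace x) *\<^sub>R (x ** x) + (1 / trace x) *\<^sub>R mat 1 \<in> ?T"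
        using sq[OF that(1)] 1 by (intro alg_gen.add alg_gen.smult)
      moreover have "(1 / trace x) *\<^sub>R (x ** x) + (1 / trace x) *\<^sub>R mat 1 = x"
        using that(2,3) by (simp add: mat2_cayley_hamilton scaleR_diff_right)
      ultimately show ?thesis by simp
    qed
    have "det ?g = \<alpha>\<^sup>2 - m * \<beta>\<^sup>2" "det ?h = \<gamma>\<^sup>2 - n * \<delta>\<^sup>2"
      using mn(3,4) by (simp_all add: det_2 quat_nth power2_eq_square algebra_simps)
    then have gT: "?g \<in> ?T" and hT: "?h \<in> ?T"
      using x g h norm p(5,7) by (simp_all add: trace_quat)
    show "QA K m n \<subseteq> ?T"
      using 1 gT hT alg_gen.mult[OF gT hT] by (intro QA_sub alg_gen.add) (auto intro: alg_gen.smult)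
  qed
qed

section \<open>The surface group inside the quaternion algebra\<close>

context pentagon begin

lemma Gam_quaternions:
  assumes K: "subfield_R K" and mn: "m \<in> K" "n \<in> K" "m > 0" "n > 0"
    and p: "\<alpha> \<in> K" "\<beta> \<in> K" "\<gamma> \<in> K" "\<delta> \<in> K" "\<alpha> > 0" "\<gamma> > 0"
    and norm: "\<alpha>\<^sup>2 - m * \<beta>\<^sup>2 = 1" "\<gamma>\<^sup>2 - n * \<delta>\<^sup>2 = 1"
    and cd: "c = sqrt m * \<beta> / \<alpha>" "d = sqrt n * \<delta> / \<gamma>"
  shows "Gam \<subseteq> QA K m n" "quat m n (- \<alpha>) \<beta> 0 0 \<in> Gam" "quat m n (- \<gamma>) 0 \<delta> 0 \<in> Gam"
proof -
  note i = subfield_R_intros[OF K]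
  note cl = QA_closed[OF K mn(1,2) less_imp_le[OF mn(3)] less_imp_le[OF mn(4)]]
  have c2: "c\<^sup>2 = m * \<beta>\<^sup>2 / \<alpha>\<^sup>2" "d\<^sup>2 = n * \<delta>\<^sup>2 / \<gamma>\<^sup>2"
    using mn by (simp_all add: cd power_mult_distrib power_divide)
  have "1 - c\<^sup>2 = (\<alpha>\<^sup>2 - m * \<beta>\<^sup>2) / \<alpha>\<^sup>2" "1 - d\<^sup>2 = (\<gamma>\<^sup>2 - n * \<delta>\<^sup>2) / \<gamma>\<^sup>2"
    using p(5,6) by (simp_all add: c2 diff_divide_distrib)
  then have "1 - c\<^sup>2 = (1 / \<alpha>)\<^sup>2" "1 - d\<^sup>2 = (1 / \<gamma>)\<^sup>2" unfolding norm by (simp_all add: power_divide)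
  then have ag: "al = \<alpha>" "ga = \<gamma>" using p(5,6) by (simp_all add: al_def ga_def)
  have ac: "\<alpha> * c = \<beta> * sqrt m" "\<gamma> * d = \<delta> * sqrt n" using p(5,6) by (simp_all add: cd)
  define D where "D = c\<^sup>2 + d\<^sup>2 - 1"
  have D: "D > 0" "D \<in> K" using pentagon.cd[OF pentagon_axioms] p mn unfolding D_def by (simp, unfold c2, intro i)
  \<comment> \<open>\<open>S A\<close> moves every reflection with label \<open>A\<close> into
    \<open>QA K m n\<close>. Only its square lies in \<open>K\<close>, which is why even counts are
    needed.\<close>
  define S where "S A = (case A of AX \<Rightarrow> sqrt D * sqrt m * sqrt n | AY \<Rightarrow> sqrt n | AZ \<Rightarrow> sqrt m)" for A
  have S2: "(S A)\<^sup>2 \<in> K" "S A \<noteq> 0" for A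
    using D mn by (cases A; auto simp: S_def power_mult_distrib intro!: i)+
  have gen: "\<exists>q\<in>QA K m n. S (axis_of s) *\<^sub>R rm s = q" for s
  proof (cases s)
    case SX
    have e: "sqrt D * et = 1" using D(1) by (simp add: et_def D_def)
    have "S AX *\<^sub>R rm SX = quat m n 0 (- (n * \<delta> / \<gamma>)) (- (m * \<beta> / \<alpha>)) 1"
    proof -
      have x: "sqrt n * d = n * \<delta> / \<gamma>" "sqrt m * c = m * \<beta> / \<alpha>" using mn by (simp_all add: cd)
      have "S AX *\<^sub>R rm SX = (sqrt D * et) *\<^sub>R reflm (- (sqrt n * d) * sqrt m) (- (sqrt m * c) * sqrt n) (sqrt m * sqrt n)"
        by (simp add: mat2_eq_iff rm_def reflm_nth S_def algebra_simps)
      then show ?thesis unfolding e x by (simp add: quat_def)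
    qed
    then show ?thesis using p mn SX by (auto intro!: QA_I i)
  next
    case SY1
    have "S AY *\<^sub>R rm SY1 = quat m n 0 0 (- \<alpha>) \<beta>"
      by (simp add: mat2_eq_iff rm_def reflm_nth quat_nth S_def ag ac algebra_simps)
    then show ?thesis using p SY1 i(1,5) by (auto intro!: QA_I)
  next
    case SY2
    have "S AY *\<^sub>R rm SY2 = quat m n 0 0 1 0"
      by (simp add: mat2_eq_iff rm_def reflm_nth quat_nth S_def)
    then show ?thesis using SY2 i(1,2) by (auto intro!: QA_I)
  next
    case SZ1
    have "S AZ *\<^sub>R rm SZ1 = quat m n 0 1 0 0"
      by (simp add: mat2_eq_iff rm_def reflm_nth quat_nth S_def)
    then show ?thesis using SZ1 i(1,2) by (auto intro!: QA_I)
  next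
    case SZ2
    have "S AZ *\<^sub>R rm SZ2 = quat m n 0 (- \<gamma>) 0 \<delta>"
      by (simp add: mat2_eq_iff rm_def reflm_nth quat_nth S_def ag ac algebra_simps)
    then show ?thesis using p SZ2 i(1,5) by (auto intro!: QA_I)
  qed
  have word: "(S AX ^ cnt AX w * S AY ^ cnt AY w * S AZ ^ cnt AZ w) *\<^sub>R wm w \<in> QA K m n" for w
  proof (induction w)
    case (Cons s w)
    let ?k = "S AX ^ cnt AX w * S AY ^ cnt AY w * S AZ ^ cnt AZ w"
    have "(S AX ^ cnt AX (s # w) * S AY ^ cnt AY (s # w) * S AZ ^ cnt AZ (s # w)) = S (axis_of s) * ?k"
      by (cases s) simp_all
    then have "(S AX ^ cnt AX (s # w) * S AY ^ cnt AY (s # w) * S AZ ^ cnt AZ (s # w)) *\<^sub>R wm (s # w)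
        = (S (axis_of s) *\<^sub>R rm s) ** (?k *\<^sub>R wm w)"
      by (simp add: mat2_scaleR_mult)
    then show ?case using gen[of s] Cons cl(3) by simp
  qed (simp add: cl)
  show "Gam \<subseteq> QA K m n"
  proof
    fix x assume "x \<in> Gam"
    then obtain w where w: "x = wm w" "\<And>A. even (cnt A w)" by (rule Gam_D) blast
    let ?k = "S AX ^ cnt AX w * S AY ^ cnt AY w * S AZ ^ cnt AZ w"
    have "S A ^ cnt A w \<in> K" for A
    proof -
      obtain l where "cnt A w = 2 * l" using w(2)[of A] by (auto elim: evenE)
      then have "S A ^ cnt A w = ((S A)\<^sup>2) ^ l" by (simp add: power_mult)
      then show ?thesis using S2(1) i by simp
    qed
    then have "?k \<in> K" "?k \<noteq> 0" using i(4) S2(2) by simp_all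
    then have "inverse ?k *\<^sub>R (?k *\<^sub>R wm w) \<in> QA K m n" by (intro cl(4)[OF word i(6)])
    moreover have "inverse ?k *\<^sub>R (?k *\<^sub>R wm w) = wm w"
      unfolding scaleR_scaleR left_inverse[OF \<open>?k \<noteq> 0\<close>] by simp
    ultimately show "x \<in> QA K m n" by (simp only: w(1))
  qed
  have "wm [SY1, SY2] = quat m n (- \<alpha>) \<beta> 0 0" "wm [SZ1, SZ2] = quat m n (- \<gamma>) 0 \<delta> 0"
    by (simp_all add: mat2_eq_iff rm_def mat2_mult_nth mat2_one_nth reflm_nth quat_nth ag ac)
  moreover have "wm [SY1, SY2] \<in> Gam" "wm [SZ1, SZ2] \<in> Gam" by (intro Gam_I; auto)+
  ultimately show "quat m n (- \<alpha>) \<beta> 0 0 \<in> Gam" "quat m n (- \<gamma>) 0 \<delta> 0 \<in> Gam" by simp_all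
qed

end

section \<open>Choice of the parameters and conclusion\<close>

text \<open>Rational parametrisation of the conic \<open>\<alpha>^2 - m \<beta>^2 = 1\<close>. The
  bounds say \<open>1/5 < m t^2 < 1\<close>; the value 1/5 corresponds to \<alpha> = 3/2, that is,
  to 1 - 1/\<alpha>^2 = 5/9, and two such squares add up to more than 1.\<close>

lemma hyperbola_point:
  assumes m: "m > 0" and t: "sqrt (1 / (5 * m)) < t" "t < sqrt (1 / m)"
  defines "\<alpha> \<equiv> (1 + m * t\<^sup>2) / (1 - m * t\<^sup>2)" and "\<beta> \<equiv> 2 * t / (1 - m * t\<^sup>2)"
  shows "m * t\<^sup>2 < 1" "\<alpha> > 3/2" "\<beta> > 0" "\<alpha>\<^sup>2 - m * \<beta>\<^sup>2 = 1" "0 < sqrt m * \<beta> / \<alpha>" "sqrt m * \<beta> / \<alpha> < 1"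
    "(sqrt m * \<beta> / \<alpha>)\<^sup>2 > 5/9"
proof -
  have "sqrt (1 / (5 * m)) > 0" using m by simp
  then have t0: "t > 0" using t(1) by linarith
  have "sqrt (1 / (5 * m)) ^ 2 < t\<^sup>2" "t\<^sup>2 < sqrt (1 / m) ^ 2"
    by (rule power_strict_mono; use t t0 m in simp)+
  then have lo: "1 / 5 < m * t\<^sup>2" and hi: "m * t\<^sup>2 < 1" using m by (auto simp: field_simps)
  show "m * t\<^sup>2 < 1" by (rule hi)
  show a: "\<alpha> > 3/2" using lo hi by (simp add: \<alpha>_def pos_less_divide_eq)
  show b: "\<beta> > 0" using t0 hi by (simp add: \<beta>_def)
  have "\<alpha>\<^sup>2 - m * \<beta>\<^sup>2 = ((1 + m * t\<^sup>2)\<^sup>2 - m * (2 * t)\<^sup>2) / (1 - m * t\<^sup>2)\<^sup>2"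
    by (simp add: \<alpha>_def \<beta>_def power_divide diff_divide_distrib)
  also have "(1 + m * t\<^sup>2)\<^sup>2 - m * (2 * t)\<^sup>2 = (1 - m * t\<^sup>2)\<^sup>2" by (simp add: power2_eq_square algebra_simps)
  finally show n: "\<alpha>\<^sup>2 - m * \<beta>\<^sup>2 = 1" using hi by simp
  show p: "0 < sqrt m * \<beta> / \<alpha>" using m a b by simp
  have c2: "(sqrt m * \<beta> / \<alpha>)\<^sup>2 = 1 - 1 / \<alpha>\<^sup>2"
  proof -
    have "(sqrt m * \<beta> / \<alpha>)\<^sup>2 = (\<alpha>\<^sup>2 - 1) / \<alpha>\<^sup>2" using m n by (simp add: power_divide power_mult_distrib)
    then show ?thesis using a by (simp add: diff_divide_distrib)
  qed
  moreover have "1 / \<alpha>\<^sup>2 > 0" using a by simp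
  ultimately have "(sqrt m * \<beta> / \<alpha>)\<^sup>2 < 1" by linarith
  then have "\<bar>sqrt m * \<beta> / \<alpha>\<bar> < 1" by (simp only: abs_square_less_1)
  then show "sqrt m * \<beta> / \<alpha> < 1" by linarith
  have "(3/2)\<^sup>2 < \<alpha>\<^sup>2" using a by (intro power_strict_mono) auto
  then have "1 / \<alpha>\<^sup>2 < 4 / 9" using a by (simp add: field_simps power2_eq_square)
  then show "(sqrt m * \<beta> / \<alpha>)\<^sup>2 > 5/9" unfolding c2 by linarith
qed

theorem genus2_with_quaternion_algebra:
  assumes K: "real_number_field K" and mn: "m \<in> K" "n \<in> K" "m > 0" "n > 0"
  shows "\<exists>G. genus2_structure G \<and> trace_field G = K \<and> inv_trace_field G = K \<and>
    quat_alg G = QA K m n \<and> inv_quat_alg G = QA K m n"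
proof -
  have sK: "subfield_R K" using K by (simp add: real_number_field_def)
  note i = subfield_R_intros[OF sK]
  have lt: "sqrt (1 / (5 * m)) < sqrt (1 / m)" "sqrt (1 / (5 * n)) < sqrt (1 / n)"
    using mn by (simp_all add: divide_strict_left_mono)
  obtain t where t: "t \<in> K" "sqrt (1 / (5 * m)) < t" "t < sqrt (1 / m)"
    "m * t\<^sup>2 \<noteq> 1 \<Longrightarrow> gen_field {((1 + m * t\<^sup>2) / (1 - m * t\<^sup>2))\<^sup>2} = K"
    using primitive_cosh_square[OF K mn(1) _ lt(1)] mn(3) by auto
  \<comment> \<open>Since \<alpha> already generates the field, \<gamma> only has to be large, and a
    rational parameter suffices.\<close>
  obtain s where s: "s \<in> \<rat>" "sqrt (1 / (5 * n)) < s" "s < sqrt (1 / n)"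
    using Rats_dense_in_real[OF lt(2)] by blast
  have sK': "s \<in> K" using s(1) subfield_R_Rats[OF sK] by blast
  define \<alpha> where "\<alpha> = (1 + m * t\<^sup>2) / (1 - m * t\<^sup>2)"
  define \<beta> where "\<beta> = 2 * t / (1 - m * t\<^sup>2)"
  define \<gamma> where "\<gamma> = (1 + n * s\<^sup>2) / (1 - n * s\<^sup>2)"
  define \<delta> where "\<delta> = 2 * s / (1 - n * s\<^sup>2)"
  note ab = hyperbola_point[OF mn(3) t(2,3), folded \<alpha>_def \<beta>_def]
  note gd = hyperbola_point[OF mn(4) s(2,3), folded \<gamma>_def \<delta>_def]
  have pK: "\<alpha> \<in> K" "\<beta> \<in> K" "\<gamma> \<in> K" "\<delta> \<in> K"
    unfolding \<alpha>_def \<beta>_def \<gamma>_def \<delta>_def using t(1) sK' mn by (auto intro!: i)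
  have prim: "gen_field {\<alpha>\<^sup>2} = K" using t(4) ab(1) by (simp add: \<alpha>_def)
  interpret pentagon "sqrt m * \<beta> / \<alpha>" "sqrt n * \<delta> / \<gamma>"
    by unfold_locales (use ab gd in linarith)+
  have pos: "\<alpha> > 0" "\<gamma> > 0" using ab gd by linarith+
  note Gq = Gam_quaternions[OF sK mn pK pos ab(4) gd(4) refl refl]
  have "mat 1 \<in> Gam" "\<And>g h. g \<in> Gam \<Longrightarrow> h \<in> Gam \<Longrightarrow> g ** h \<in> Gam"
    using genus2_structure_Gam by (auto simp: genus2_structure_def)
  then show ?thesis
    using quaternion_algebra_of_group[OF sK mn pK _ _ _ _ ab(4) gd(4) prim Gq(1) _ _ Gq(2,3)]
      genus2_structure_Gam pos ab(3) gd(3) by (intro exI[of _ Gam]) auto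
qed

text \<open>On trace-free real 2x2 matrices squaring is a quadratic form of signature (2, 1), and
  anticommuting means orthogonal. \<open>I\<close> and \<open>J\<close> would span a negative
  definite plane, which this signature excludes.\<close>

lemma no_definite_quaternions:
  assumes I: "I ** I = a *\<^sub>R (mat 1 :: mat2)" and J: "J ** J = b *\<^sub>R (mat 1 :: mat2)" and IJ: "I ** J = - (J ** I)"
    and neg: "a < 0" "b < 0"
  shows False
proof -
  have trace0: "X$2$2 = - X$1$1" "X$1$2 * X$2$1 < - (X$1$1 * X$1$1)"
    if X: "X ** X = k *\<^sub>R (mat 1 :: mat2)" "k < 0" for X k
  proof -
    have e: "X$1$1 * X$1$1 + X$1$2 * X$2$1 = k" "X$1$2 * (X$1$1 + X$2$2) = 0" "X$2$1 * (X$1$1 + X$2$2) = 0"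
      using X(1) by (auto simp: mat2_eq_iff mat2_mult_nth mat2_one_nth algebra_simps)
    have "X$1$1 + X$2$2 = 0"
    proof (rule ccontr)
      assume "X$1$1 + X$2$2 \<noteq> 0"
      then have "X$1$1 * X$1$1 = k" using e by simp
      then show False using X(2) zero_le_square[of "X$1$1"] by linarith
    qed
    then show "X$2$2 = - X$1$1" by linarith
    show "X$1$2 * X$2$1 < - (X$1$1 * X$1$1)" using e(1) X(2) by linarith
  qed
  define p q r s t u where "p = I$1$1" "q = I$1$2" "r = I$2$1" "s = J$1$1" "t = J$1$2" "u = J$2$1"
  note defs = this
  have 1: "p * p < - (q * r)" and 2: "s * s < - (t * u)"
    using trace0(2)[OF I neg(1)] trace0(2)[OF J neg(2)] by (simp_all add: defs)
  have "(I ** J)$1$1 = - (J ** I)$1$1" using IJ by simp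
  then have 3: "q * u + r * t = - 2 * (p * s)" by (simp add: mat2_mult_nth defs algebra_simps)
  have "(p * p) * (s * s) < (- (q * r)) * (- (t * u))"
    using 1 2 by (intro mult_strict_mono') auto
  moreover have "(q * u + r * t)\<^sup>2 - 4 * ((- (q * r)) * (- (t * u))) = (q * u - r * t)\<^sup>2"
    by (simp add: power2_eq_square algebra_simps)
  moreover have "(q * u + r * t)\<^sup>2 = 4 * ((p * p) * (s * s))" unfolding 3 by (simp add: power2_eq_square algebra_simps)
  ultimately show False using zero_le_power2[of "q * u - r * t"] by linarith
qed

theorem theorem1p3:
  fixes K :: "real set" and a b :: real
  assumes "real_number_field K"
    and "a \<in> K" "b \<in> K" "a \<noteq> 0" "b \<noteq> 0"
    and "quat_iso UNIV a b UNIV"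
  shows "\<exists>G. genus2_structure G \<and> trace_field G = K \<and> quat_iso K a b (quat_alg G) \<and>
             inv_trace_field G = trace_field G \<and> inv_quat_alg G = quat_alg G"
proof -
  have sK: "subfield_R K" using assms(1) by (simp add: real_number_field_def)
  have abK: "- (a * b) \<in> K" using assms(2,3) by (intro subfield_R_intros[OF sK])
  \<comment> \<open>The symbols (a, b), (a, -ab) and (b, -ab) present the same algebra, and one of
    them has positive entries unless a and b are both negative. Splitting over the reals rules that
    out.\<close>
  have "\<exists>m n. m \<in> K \<and> n \<in> K \<and> m > 0 \<and> n > 0 \<and> quat_iso K a b (QA K m n)"
  proof -
    consider "a > 0" "b > 0" | "a > 0" "b < 0" | "a < 0" "b > 0" | "a < 0" "b < 0"
      using assms(4,5) by linarith
    then show ?thesis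
    proof cases
      case 1
      then show ?thesis using quat_iso_QA(1)[OF sK assms(2,3)] assms by blast
    next
      case 2
      then have n: "- (a * b) > 0" by (simp add: mult_less_0_iff)
      have "- (- (a * b) / a) = b" using 2 by simp
      then show ?thesis using quat_iso_QA(2)[OF sK assms(2) abK 2(1) n] assms(2) abK 2(1) n by metis
    next
      case 3
      then have n: "- (a * b) > 0" by (simp add: mult_less_0_iff)
      have "- (- (a * b) / b) = a" using 3 by simp
      then show ?thesis using quat_iso_QA(3)[OF sK assms(3) abK 3(2) n] assms(3) abK 3(2) n by metis
    next
      case 4
      obtain I J :: mat2 where "I ** I = a *\<^sub>R mat 1" "J ** J = b *\<^sub>R mat 1" "I ** J = - (J ** I)"
        using assms(6) unfolding quat_iso_def by metis
      then show ?thesis using no_definite_quaternions 4 by blast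
    qed
  qed
  then obtain m n where mn: "m \<in> K" "n \<in> K" "m > 0" "n > 0" "quat_iso K a b (QA K m n)" by blast
  show ?thesis using genus2_with_quaternion_algebra[OF assms(1) mn(1-4)] mn(5) by metis
qed

end
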